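(* Let $(T^*Q,G,\omega,H)$ be a regular orbit reducible Hamiltonian system with dynamical vector field $X_H$. Let $\gamma: Q\to T^*Q$ be a one-form on $Q$, let $\lambda=\gamma\circ\pi_Q: T^*Q\to T^*Q$, let $\varepsilon: T^*Q\to T^*Q$ be any $G$-equivariant symplectic map, and put $X_H^\varepsilon=T\pi_Q\circ X_H\circ\varepsilon$. Let $\mu\in\mathfrak{g}^*$ be a regular value of the momentum map $\mathbf{J}$, let $\mathcal{O}_\mu$ be the regular reducible orbit of the Hamiltonian system, and assume that $\mathrm{Im}(\gamma)\subset\mathbf{J}^{-1}(\mu)$, that $\gamma$ is $G$-invariant, and that $\varepsilon(\mathbf{J}^{-1}(\mathcal{O}_\mu))\subset\mathbf{J}^{-1}(\mathcal{O}_\mu)$. Put $\bar\gamma=\pi_{\mathcal{O}_\mu}\circ\gamma: Q\to(T^*Q)_{\mathcal{O}_\mu}$, $\bar\lambda=\pi_{\mathcal{O}_\mu}\circ\lambda:\mathbf{J}^{-1}(\mathcal{O}_\mu)\to(T^*Q)_{\mathcal{O}_\mu}$ and $\bar\varepsilon=\pi_{\mathcal{O}_\mu}\circ\varepsilon:\mathbf{J}^{-1}(\mathcal{O}_\mu)\to(T^*Q)_{\mathcal{O}_\mu}$. Then $\varepsilon$ and $\bar\varepsilon$ satisfy the equation $$T\bar\varepsilon\circ X_{h_{\mathcal{O}_\mu}\circ\bar\varepsilon}=T\bar\lambda\circ X_H\circ\varepsilon$$ if and only if they satisfy the equation $$T\bar\gamma\circ X_H^\varepsilon=X_{h_{\mathcal{O}_\mu}}\circ\bar\varepsilon$$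 (both being equalities of maps $\mathbf{J}^{-1}(\mathcal{O}_\mu)\to T(T^*Q)_{\mathcal{O}_\mu}$). The second equation is called the Type II Hamilton-Jacobi equation for the regular orbit reduced Hamiltonian system $((T^*Q)_{\mathcal{O}_\mu},\omega_{\mathcal{O}_\mu},h_{\mathcal{O}_\mu})$.
   Context: All manifolds are real, smooth and finite dimensional; all actions are smooth left actions. $Q$ is a smooth manifold, $\pi_Q: T^*Q\to Q$ the projection, $\omega$ the canonical symplectic form on $T^*Q$; the Hamiltonian vector field of a function $f$ is determined by $\mathbf{i}_{X_f}\omega=\mathbf{d}f$. A one-form on $Q$ is identified with a section $\gamma: Q\to T^*Q$. A symplectic map $\varepsilon$ is a smooth map with $\varepsilon^*\omega=\omega$. A Lie group $G$ with Lie algebra $\mathfrak{g}$ acts freely and properly on $Q$; the cotangent lifted action on $T^*Q$ is symplectic, free and proper and is assumed to admit an $\mathrm{Ad}^*$-equivariant momentum map $\mathbf{J}: T^*Q\to\mathfrak{g}^*$. For a regular value $\mu$ of $\mathbf{J}$, $\mathcal{O}_\mu=G\cdot\mu\subset\mathfrak{g}^*$ is the coadjoint orbit, $i_{\mathcal{O}_\mu}:\mathbf{J}^{-1}(\mathcal{O}_\mu)\to T^*Q$ the natural injection, $\pi_{\mathcal{O}_\mu}:\mathbf{J}^{-1}(\mathcal{O}_\mu)\to(T^*Q)_{\mathcal{O}_\mu}:=\mathbf{J}^{-1}(\mathcal{O}_\mu)/G$ the projection, and $\mathbf{J}_{\mathcal{O}_\mu}=\mathbf{J}\circ i_{\mathcal{O}_\mu}$.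 The quotient $(T^*Q)_{\mathcal{O}_\mu}$ carries the symplectic form $\omega_{\mathcal{O}_\mu}$ uniquely determined by $i_{\mathcal{O}_\mu}^*\omega=\pi_{\mathcal{O}_\mu}^*\omega_{\mathcal{O}_\mu}+\mathbf{J}_{\mathcal{O}_\mu}^*\omega_{\mathcal{O}_\mu}^+$, where $\omega^+_{\mathcal{O}_\mu}(\nu)(\xi_{\mathfrak{g}^*}(\nu),\eta_{\mathfrak{g}^*}(\nu))=\langle\nu,[\xi,\eta]\rangle$ for $\nu\in\mathcal{O}_\mu$, $\xi,\eta\in\mathfrak{g}$ (with $\xi_{\mathfrak{g}^*}$ the infinitesimal generator of the coadjoint action). $(T^*Q,G,\omega,H)$ is a regular orbit reducible Hamiltonian system if $H: T^*Q\to\mathbb{R}$ is $G$-invariant and there is an orbit $\mathcal{O}_\mu$, $\mu$ a regular value of $\mathbf{J}$ (the regular reducible orbit), such that $((T^*Q)_{\mathcal{O}_\mu},\omega_{\mathcal{O}_\mu},h_{\mathcal{O}_\mu})$, with $h_{\mathcal{O}_\mu}$ defined by $h_{\mathcal{O}_\mu}\circ\pi_{\mathcal{O}_\mu}=H\circ i_{\mathcal{O}_\mu}$, is a Hamiltonian system; $X_{h_{\mathcal{O}_\mu}}$ is the Hamiltonian vector field of $h_{\mathcal{O}_\mu}$ with respect to $\omega_{\mathcal{O}_\mu}$. The dynamical vector field of $(T^*Q,G,\omega,H)$ is $X_H$. $G$-invariance of $\gamma$ means $\gamma(g\cdot q)=g\cdot\gamma(q)$ for $g\in G$, $q\in Q$.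 $G$-equivariance of $\varepsilon$ means $\varepsilon(g\cdot\alpha)=g\cdot\varepsilon(\alpha)$ for $g\in G$, $\alpha\in T^*Q$. $X_{h_{\mathcal{O}_\mu}\circ\bar\varepsilon}$ is the Hamiltonian vector field on $T^*Q$ of the function $h_{\mathcal{O}_\mu}\circ\bar\varepsilon$. Since $h_{\mathcal{O}_\mu}\circ\bar\varepsilon=H\circ\varepsilon$ on $\mathbf{J}^{-1}(\mathcal{O}_\mu)$, this function is understood on $T^*Q$ as $H\circ\varepsilon$, i.e. $X_{h_{\mathcal{O}_\mu}\circ\bar\varepsilon}$ is the restriction to $\mathbf{J}^{-1}(\mathcal{O}_\mu)$ of $X_{H\circ\varepsilon}$, and $T\bar\varepsilon\circ X_{h_{\mathcal{O}_\mu}\circ\bar\varepsilon}$ means $T\pi_{\mathcal{O}_\mu}\circ T\varepsilon\circ X_{h_{\mathcal{O}_\mu}\circ\bar\varepsilon}$ (the vectors $T\varepsilon(X_{H\circ\varepsilon})=X_H\circ\varepsilon$ are tangent to $\mathbf{J}^{-1}(\mathcal{O}_\mu)$). Likewise $T\bar\lambda$ means $T\pi_{\mathcal{O}_\mu}\circ T\lambda$, where $\lambda$ takes values in $\mathrm{Im}(\gamma)\subset\mathbf{J}^{-1}(\mu)\subset\mathbf{J}^{-1}(\mathcal{O}_\mu)$. *)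

theory Defs
  imports "HOL-Analysis.Analysis" "HOL-Algebra.Group_Action"
begin

section \<open>Model spaces\<close>

text \<open>Manifolds are modelled on finite-dimensional real inner product spaces. The class
  \<open>euclidean_space\<close> is not used because it excludes dimension 0, which does occur here
  (discrete groups, zero-dimensional coadjoint orbits and reduced spaces).\<close>

class finite_dim_inner = real_inner +
  assumes finite_dim_ax: "\<exists>B::'a set. finite B \<and>
    (\<forall>S. B \<subseteq> S \<and> 0 \<in> S \<and> (\<forall>x\<in>S. \<forall>y\<in>S. x + y \<in> S) \<and> (\<forall>c. \<forall>x\<in>S. c *\<^sub>R x \<in> S) \<longrightarrow> S = UNIV)"

text \<open>The axiom spells out \<open>span B = UNIV\<close>, which a class specification cannot mention.\<close>

lemma finite_dim: "\<exists>B::'a::finite_dim_inner set. finite B \<and> span B = UNIV"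
proof -
  obtain B :: "'a set" where B: "finite B"
    and min: "\<forall>S. B \<subseteq> S \<and> 0 \<in> S \<and> (\<forall>x\<in>S. \<forall>y\<in>S. x + y \<in> S) \<and>
      (\<forall>c. \<forall>x\<in>S. c *\<^sub>R x \<in> S) \<longrightarrow> S = UNIV"
    using finite_dim_ax by (elim exE conjE)
  have "span B = UNIV"
    by (rule min[rule_format]) (simp add: span_superset span_zero span_add span_scale)
  with B show ?thesis by (intro exI[of _ B] conjI)
qed

lemma finite_dim_inner_classI:
  assumes "\<exists>B::'a::real_inner set. finite B \<and> span B = UNIV"
  shows "\<exists>B::'a set. finite B \<and>
    (\<forall>S. B \<subseteq> S \<and> 0 \<in> S \<and> (\<forall>x\<in>S. \<forall>y\<in>S. x + y \<in> S) \<and> (\<forall>c. \<forall>x\<in>S. c *\<^sub>R x \<in> S) \<longrightarrow> S = UNIV)"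
proof -
  obtain B :: "'a set" where B: "finite B" "span B = UNIV" using assms by blast
  have "S = UNIV" if "B \<subseteq> S" "0 \<in> S" "\<forall>x\<in>S. \<forall>y\<in>S. x + y \<in> S" "\<forall>c. \<forall>x\<in>S. c *\<^sub>R x \<in> S" for S
  proof -
    have "subspace S" using that(2-4) by (simp add: subspace_def)
    then have "span B \<subseteq> S" using that(1) by (intro span_minimal)
    then show ?thesis unfolding B(2) by (rule top_le)
  qed
  then have "\<forall>S. B \<subseteq> S \<and> 0 \<in> S \<and> (\<forall>x\<in>S. \<forall>y\<in>S. x + y \<in> S) \<and>
      (\<forall>c. \<forall>x\<in>S. c *\<^sub>R x \<in> S) \<longrightarrow> S = UNIV"
    by simp
  with B(1) show ?thesis by (intro exI[of _ B] conjI)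
qed

instance euclidean_space \<subseteq> finite_dim_inner
  by standard (rule finite_dim_inner_classI, intro exI[of _ Basis] conjI finite_Basis span_Basis)

instance prod :: (finite_dim_inner, finite_dim_inner) finite_dim_inner
proof (standard, rule finite_dim_inner_classI)
  obtain A :: "'a set" where A: "finite A" "span A = UNIV" using finite_dim by blast
  obtain B :: "'b set" where B: "finite B" "span B = UNIV" using finite_dim by blast
  let ?C = "(\<lambda>a. (a, 0)) ` A \<union> (\<lambda>b. (0, b)) ` B :: ('a \<times> 'b) set"
  have l1: "linear (\<lambda>a::'a. (a, 0::'b))" by (rule linearI) auto
  have l2: "linear (\<lambda>b::'b. (0::'a, b))" by (rule linearI) auto
  have "(x, y) \<in> span ?C" for x y
  proof -
    have "(x, 0::'b) \<in> span ((\<lambda>a. (a, 0)) ` A)"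
      unfolding linear_span_image[OF l1] A(2) by (rule rangeI)
    moreover have "(0::'a, y) \<in> span ((\<lambda>b. (0, b)) ` B)"
      unfolding linear_span_image[OF l2] B(2) by (rule rangeI)
    ultimately have "(x, 0) \<in> span ?C" "(0, y) \<in> span ?C"
      using span_mono[of _ ?C] by blast+
    then show ?thesis using span_add[of "(x, 0)" ?C "(0, y)"] by simp
  qed
  then show "\<exists>C::('a \<times> 'b) set. finite C \<and> span C = UNIV"
    using A(1) B(1) by (intro exI[of _ ?C]) auto
qed

text \<open>The one-point model space.\<close>

instantiation unit :: real_inner
begin
definition zero_unit :: unit where "zero_unit = ()"
definition plus_unit :: "unit \<Rightarrow> unit \<Rightarrow> unit" where "plus_unit x y = ()"
definition scaleR_unit :: "real \<Rightarrow> unit \<Rightarrow> unit" where "scaleR_unit r x = ()"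
definition inner_unit :: "unit \<Rightarrow> unit \<Rightarrow> real" where "inner_unit x y = 0"
definition norm_unit :: "unit \<Rightarrow> real" where "norm_unit x = 0"
definition dist_unit :: "unit \<Rightarrow> unit \<Rightarrow> real" where "dist_unit x y = 0"
definition sgn_unit :: "unit \<Rightarrow> unit" where "sgn_unit x = ()"
definition uniformity_unit :: "(unit \<times> unit) filter" where
  "uniformity_unit = (INF e\<in>{0<..}. principal {(x, y). dist x y < e})"
definition open_unit :: "unit set \<Rightarrow> bool" where
  "open_unit U = (\<forall>x\<in>U. eventually (\<lambda>(x', y). x' = x \<longrightarrow> y \<in> U) uniformity)"
instance
  by standard (simp_all add: inner_unit_def norm_unit_def dist_unit_def uniformity_unit_def open_unit_def)
end

instance unit :: finite_dim_inner
proof (standard, rule finite_dim_inner_classI)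
  have "x \<in> span {()}" for x :: unit
    using span_base[of "()" "{()}"] by simp
  then have "span {()} = (UNIV :: unit set)" by blast
  then show "\<exists>B::unit set. finite B \<and> span B = UNIV" by (intro exI[of _ "{()}"]) simp
qed

section \<open>Smooth manifolds and tangent maps\<close>

text \<open>Both notions are meant for open \<open>S\<close>.\<close>

primrec Ck_on :: "nat \<Rightarrow> 'a::real_normed_vector set \<Rightarrow> ('a \<Rightarrow> 'b::real_normed_vector) \<Rightarrow> bool" where
  "Ck_on 0 S f \<longleftrightarrow> continuous_on S f"
| "Ck_on (Suc k) S f \<longleftrightarrow> (\<forall>x\<in>S. f differentiable (at x)) \<and>
     (\<forall>v. Ck_on k S (\<lambda>x. frechet_derivative f (at x) v))"

definition smooth_on :: "'a::real_normed_vector set \<Rightarrow> ('a \<Rightarrow> 'b::real_normed_vector) \<Rightarrow> bool" where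
  "smooth_on S f \<longleftrightarrow> (\<forall>k. Ck_on k S f)"

text \<open>A chart is a domain together with a coordinate map. Besides its atlas, a manifold
  carries a preferred chart \<open>chart_at M p\<close> around each point \<open>p\<close>. It serves only to represent
  the tangent space at \<open>p\<close>: \<open>T\<^sub>pM\<close> is the model space, a vector standing for the tangent
  vector with these coordinates in the chart \<open>chart_at M p\<close>. The tangent bundle consists of
  the pairs \<open>(p, v)\<close>.\<close>

type_synonym ('a, 'e) chart = "'a set \<times> ('a \<Rightarrow> 'e)"

record ('a, 'e) mfd =
  atlas :: "('a, 'e) chart set"
  chart_at :: "'a \<Rightarrow> ('a, 'e) chart"

definition chart_inv :: "('a, 'e) chart \<Rightarrow> 'e \<Rightarrow> 'a" where
  "chart_inv c = inv_into (fst c) (snd c)"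

definition mcarrier :: "('a, 'e) mfd \<Rightarrow> 'a set" where
  "mcarrier M = (\<Union>c\<in>atlas M. fst c)"

definition mtop :: "('a, 'e::topological_space) mfd \<Rightarrow> 'a topology" where
  "mtop M = topology_generated_by {fst c \<inter> snd c -` W | c W. c \<in> atlas M \<and> open W}"

definition manifold :: "('a, 'e::finite_dim_inner) mfd \<Rightarrow> bool" where
  "manifold M \<longleftrightarrow>
     (\<forall>c\<in>atlas M. inj_on (snd c) (fst c) \<and> open (snd c ` fst c)) \<and>
     (\<forall>c\<in>atlas M. \<forall>d\<in>atlas M. open (snd c ` (fst c \<inter> fst d)) \<and>
        smooth_on (snd c ` (fst c \<inter> fst d)) (snd d \<circ> chart_inv c)) \<and>
     (\<forall>p\<in>mcarrier M. chart_at M p \<in> atlas M \<and> p \<in> fst (chart_at M p)) \<and>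
     Hausdorff_space (mtop M) \<and> second_countable (mtop M)"

definition euclid :: "('e, 'e) mfd" where
  "euclid = \<lparr>atlas = {(UNIV, \<lambda>x. x)}, chart_at = (\<lambda>_. (UNIV, \<lambda>x. x))\<rparr>"

definition prod_chart :: "('a, 'e) chart \<Rightarrow> ('b, 'f) chart \<Rightarrow> ('a \<times> 'b, 'e \<times> 'f) chart" where
  "prod_chart c d = (fst c \<times> fst d, \<lambda>(x, y). (snd c x, snd d y))"

definition prod_mfd :: "('a, 'e) mfd \<Rightarrow> ('b, 'f) mfd \<Rightarrow> ('a \<times> 'b, 'e \<times> 'f) mfd" where
  "prod_mfd M N =
     \<lparr>atlas = {prod_chart c d | c d. c \<in> atlas M \<and> d \<in> atlas N},
      chart_at = (\<lambda>(x, y). prod_chart (chart_at M x) (chart_at N y))\<rparr>"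

definition smooth_map ::
  "('a, 'e::finite_dim_inner) mfd \<Rightarrow> ('b, 'f::finite_dim_inner) mfd \<Rightarrow> ('a \<Rightarrow> 'b) \<Rightarrow> bool" where
  "smooth_map M N f \<longleftrightarrow> f ` mcarrier M \<subseteq> mcarrier N \<and> continuous_map (mtop M) (mtop N) f \<and>
     (\<forall>c\<in>atlas M. \<forall>d\<in>atlas N.
        smooth_on (snd c ` (fst c \<inter> f -` fst d)) (snd d \<circ> f \<circ> chart_inv c))"

text \<open>\<open>tan_at M N f p\<close> is \<open>T\<^sub>pf : T\<^sub>pM \<rightarrow> T\<^bsub>f p\<^esub>N\<close>, and \<open>tan_map M N f\<close> is \<open>Tf : TM \<rightarrow> TN\<close>.\<close>

definition tan_at :: "('a, 'e::finite_dim_inner) mfd \<Rightarrow> ('b, 'f::finite_dim_inner) mfd \<Rightarrow>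
    ('a \<Rightarrow> 'b) \<Rightarrow> 'a \<Rightarrow> 'e \<Rightarrow> 'f" where
  "tan_at M N f p =
     frechet_derivative (snd (chart_at N (f p)) \<circ> f \<circ> chart_inv (chart_at M p))
       (at (snd (chart_at M p) p))"

definition tan_map :: "('a, 'e::finite_dim_inner) mfd \<Rightarrow> ('b, 'f::finite_dim_inner) mfd \<Rightarrow>
    ('a \<Rightarrow> 'b) \<Rightarrow> 'a \<times> 'e \<Rightarrow> 'b \<times> 'f" where
  "tan_map M N f = (\<lambda>(p, v). (f p, tan_at M N f p v))"

definition tangent_bundle :: "('a, 'e) mfd \<Rightarrow> ('a \<times> 'e) set" where
  "tangent_bundle M = mcarrier M \<times> UNIV"

definition immersion where
  "immersion M N f \<longleftrightarrow> smooth_map M N f \<and> (\<forall>p\<in>mcarrier M. inj (tan_at M N f p))"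

definition submersion where
  "submersion M N f \<longleftrightarrow> smooth_map M N f \<and> (\<forall>p\<in>mcarrier M. surj (tan_at M N f p))"

definition smooth_embedding where
  "smooth_embedding M N f \<longleftrightarrow> immersion M N f \<and> embedding_map (mtop M) (mtop N) f"

definition regular_value where
  "regular_value M N f y \<longleftrightarrow> y \<in> mcarrier N \<and> (\<forall>p\<in>mcarrier M. f p = y \<longrightarrow> surj (tan_at M N f p))"

section \<open>Differential forms and Hamiltonian vector fields\<close>

text \<open>A \<open>k\<close>-form assigns to each point \<open>p\<close> a function of \<open>k\<close> vectors in \<open>T\<^sub>pM\<close>.
  Pulling back along \<open>chart_inv c\<close> gives the local representative in the chart \<open>c\<close>.\<close>

definition pullback1 :: "('a, 'e::finite_dim_inner) mfd \<Rightarrow> ('b, 'f::finite_dim_inner) mfd \<Rightarrow>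
    ('a \<Rightarrow> 'b) \<Rightarrow> ('b \<Rightarrow> 'f \<Rightarrow> real) \<Rightarrow> 'a \<Rightarrow> 'e \<Rightarrow> real" where
  "pullback1 M N f \<theta> p v = \<theta> (f p) (tan_at M N f p v)"

definition pullback2 :: "('a, 'e::finite_dim_inner) mfd \<Rightarrow> ('b, 'f::finite_dim_inner) mfd \<Rightarrow>
    ('a \<Rightarrow> 'b) \<Rightarrow> ('b \<Rightarrow> 'f \<Rightarrow> 'f \<Rightarrow> real) \<Rightarrow> 'a \<Rightarrow> 'e \<Rightarrow> 'e \<Rightarrow> real" where
  "pullback2 M N f \<omega> p v w = \<omega> (f p) (tan_at M N f p v) (tan_at M N f p w)"

definition ext_deriv1 :: "('a, 'e::finite_dim_inner) mfd \<Rightarrow> ('a \<Rightarrow> 'e \<Rightarrow> real) \<Rightarrow>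
    'a \<Rightarrow> 'e \<Rightarrow> 'e \<Rightarrow> real" where
  "ext_deriv1 M \<theta> p v w =
     (let c = chart_at M p; \<theta>' = pullback1 euclid M (chart_inv c) \<theta> in
        frechet_derivative (\<lambda>x. \<theta>' x w) (at (snd c p)) v
      - frechet_derivative (\<lambda>x. \<theta>' x v) (at (snd c p)) w)"

definition ext_deriv2 :: "('a, 'e::finite_dim_inner) mfd \<Rightarrow> ('a \<Rightarrow> 'e \<Rightarrow> 'e \<Rightarrow> real) \<Rightarrow>
    'a \<Rightarrow> 'e \<Rightarrow> 'e \<Rightarrow> 'e \<Rightarrow> real" where
  "ext_deriv2 M \<omega> p u v w =
     (let c = chart_at M p; \<omega>' = pullback2 euclid M (chart_inv c) \<omega> in
        frechet_derivative (\<lambda>x. \<omega>' x v w) (at (snd c p)) u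
      + frechet_derivative (\<lambda>x. \<omega>' x w u) (at (snd c p)) v
      + frechet_derivative (\<lambda>x. \<omega>' x u v) (at (snd c p)) w)"

definition two_form :: "('a, 'e::finite_dim_inner) mfd \<Rightarrow> ('a \<Rightarrow> 'e \<Rightarrow> 'e \<Rightarrow> real) \<Rightarrow> bool" where
  "two_form M \<omega> \<longleftrightarrow>
     (\<forall>p\<in>mcarrier M. bilinear (\<omega> p) \<and> (\<forall>v. \<omega> p v v = 0)) \<and>
     (\<forall>c\<in>atlas M. \<forall>v w. smooth_on (snd c ` fst c) (\<lambda>x. pullback2 euclid M (chart_inv c) \<omega> x v w))"

definition symplectic_form :: "('a, 'e::finite_dim_inner) mfd \<Rightarrow> ('a \<Rightarrow> 'e \<Rightarrow> 'e \<Rightarrow> real) \<Rightarrow> bool" where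
  "symplectic_form M \<omega> \<longleftrightarrow> two_form M \<omega> \<and>
     (\<forall>p\<in>mcarrier M. \<forall>u v w. ext_deriv2 M \<omega> p u v w = 0) \<and>
     (\<forall>p\<in>mcarrier M. \<forall>v. (\<forall>w. \<omega> p v w = 0) \<longrightarrow> v = 0)"

definition symplectic_map :: "('a, 'e::finite_dim_inner) mfd \<Rightarrow> ('a \<Rightarrow> 'e \<Rightarrow> 'e \<Rightarrow> real) \<Rightarrow>
    ('a \<Rightarrow> 'a) \<Rightarrow> bool" where
  "symplectic_map M \<omega> \<epsilon> \<longleftrightarrow> smooth_map M M \<epsilon> \<and>
     (\<forall>p\<in>mcarrier M. \<forall>v w. pullback2 M M \<epsilon> \<omega> p v w = \<omega> p v w)"

definition ham_vf :: "('a, 'e::finite_dim_inner) mfd \<Rightarrow> ('a \<Rightarrow> 'e \<Rightarrow> 'e \<Rightarrow> real) \<Rightarrow>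
    ('a \<Rightarrow> real) \<Rightarrow> 'a \<Rightarrow> 'a \<times> 'e" where
  "ham_vf M \<omega> f p = (p, THE X. \<forall>v. \<omega> p X v = tan_at M euclid f p v)"

section \<open>Cotangent bundles\<close>

text \<open>A covector at \<open>q\<close> is a pair \<open>(q, a)\<close>, where \<open>a\<close> stands for the functional \<open>v \<mapsto> a \<bullet> v\<close>
  on \<open>T\<^sub>qQ\<close>; thus precomposing the functional with a linear map means applying the adjoint to \<open>a\<close>.
  A chart \<open>c\<close> of \<open>Q\<close> induces the usual bundle chart, assigning to \<open>(q, a)\<close> the pair \<open>(x, b)\<close>
  with \<open>x = c(q)\<close> and \<open>b \<bullet> w = a \<bullet> T\<^sub>x(c\<^sup>-\<^sup>1) w\<close>.\<close>

definition cot_chart :: "('q, 'e::finite_dim_inner) mfd \<Rightarrow> ('q, 'e) chart \<Rightarrow>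
    ('q \<times> 'e, 'e \<times> 'e) chart" where
  "cot_chart Q c =
     (fst c \<times> UNIV, \<lambda>(q, a). (snd c q, adjoint (tan_at euclid Q (chart_inv c) (snd c q)) a))"

definition cotangent :: "('q, 'e::finite_dim_inner) mfd \<Rightarrow> ('q \<times> 'e, 'e \<times> 'e) mfd" where
  "cotangent Q = \<lparr>atlas = cot_chart Q ` atlas Q, chart_at = (\<lambda>(q, a). cot_chart Q (chart_at Q q))\<rparr>"

text \<open>The projection of the cotangent bundle is \<open>fst\<close>.\<close>

definition one_form :: "('q, 'e::finite_dim_inner) mfd \<Rightarrow> ('q \<Rightarrow> 'q \<times> 'e) \<Rightarrow> bool" where
  "one_form Q \<gamma> \<longleftrightarrow> smooth_map Q (cotangent Q) \<gamma> \<and> (\<forall>q\<in>mcarrier Q. fst (\<gamma> q) = q)"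

definition tautological_form :: "('q, 'e::finite_dim_inner) mfd \<Rightarrow> 'q \<times> 'e \<Rightarrow> 'e \<times> 'e \<Rightarrow> real" where
  "tautological_form Q z v = snd z \<bullet> tan_at (cotangent Q) Q fst z v"

text \<open>The sign makes \<open>\<omega> = dq \<and> dp\<close>, so that \<open>i\<^sub>X \<omega> = df\<close> yields Hamilton's equations.\<close>

definition canonical_form :: "('q, 'e::finite_dim_inner) mfd \<Rightarrow>
    'q \<times> 'e \<Rightarrow> 'e \<times> 'e \<Rightarrow> 'e \<times> 'e \<Rightarrow> real" where
  "canonical_form Q z v w = - ext_deriv1 (cotangent Q) (tautological_form Q) z v w"

section \<open>Lie groups and actions\<close>

definition lie_group :: "'g monoid \<Rightarrow> ('g, 'k::finite_dim_inner) mfd \<Rightarrow> bool" where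
  "lie_group G L \<longleftrightarrow> group G \<and> manifold L \<and> mcarrier L = carrier G \<and>
     smooth_map (prod_mfd L L) L (\<lambda>(g, h). g \<otimes>\<^bsub>G\<^esub> h) \<and> smooth_map L L (\<lambda>g. inv\<^bsub>G\<^esub> g)"

definition lie_action :: "'g monoid \<Rightarrow> ('g, 'k::finite_dim_inner) mfd \<Rightarrow>
    ('a, 'e::finite_dim_inner) mfd \<Rightarrow> ('g \<Rightarrow> 'a \<Rightarrow> 'a) \<Rightarrow> bool" where
  "lie_action G L M act \<longleftrightarrow> smooth_map (prod_mfd L M) M (\<lambda>(g, x). act g x) \<and>
     (\<forall>x\<in>mcarrier M. act \<one>\<^bsub>G\<^esub> x = x \<and>
        (\<forall>g\<in>carrier G. \<forall>h\<in>carrier G. act (g \<otimes>\<^bsub>G\<^esub> h) x = act g (act h x)))"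

definition free_action :: "'g monoid \<Rightarrow> ('a, 'e) mfd \<Rightarrow> ('g \<Rightarrow> 'a \<Rightarrow> 'a) \<Rightarrow> bool" where
  "free_action G M act \<longleftrightarrow> (\<forall>g\<in>carrier G. \<forall>x\<in>mcarrier M. act g x = x \<longrightarrow> g = \<one>\<^bsub>G\<^esub>)"

definition proper_action :: "('g, 'k::finite_dim_inner) mfd \<Rightarrow>
    ('a, 'e::finite_dim_inner) mfd \<Rightarrow> ('g \<Rightarrow> 'a \<Rightarrow> 'a) \<Rightarrow> bool" where
  "proper_action L M act \<longleftrightarrow>
     proper_map (prod_topology (mtop L) (mtop M)) (prod_topology (mtop M) (mtop M))
       (\<lambda>(g, x). (act g x, x))"

definition inf_gen :: "'g monoid \<Rightarrow> ('g, 'k::finite_dim_inner) mfd \<Rightarrow>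
    ('a, 'e::finite_dim_inner) mfd \<Rightarrow> ('g \<Rightarrow> 'a \<Rightarrow> 'a) \<Rightarrow> 'k \<Rightarrow> 'a \<Rightarrow> 'e" where
  "inf_gen G L M act \<xi> x = tan_at L M (\<lambda>g. act g x) \<one>\<^bsub>G\<^esub> \<xi>"

text \<open>The Lie algebra is \<open>T\<^sub>eG\<close>, with the bracket of left-invariant vector fields;
  here vector fields are given by their components \<open>X(p) \<in> T\<^sub>pM\<close>.\<close>

definition vf_rep :: "('a, 'e::finite_dim_inner) mfd \<Rightarrow> ('a, 'e) chart \<Rightarrow> ('a \<Rightarrow> 'e) \<Rightarrow> 'e \<Rightarrow> 'e" where
  "vf_rep M c X x = tan_at M euclid (snd c) (chart_inv c x) (X (chart_inv c x))"

definition vf_bracket :: "('a, 'e::finite_dim_inner) mfd \<Rightarrow> ('a \<Rightarrow> 'e) \<Rightarrow> ('a \<Rightarrow> 'e) \<Rightarrow> 'a \<Rightarrow> 'e" where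
  "vf_bracket M X Y p =
     (let c = chart_at M p; x = snd c p; X' = vf_rep M c X; Y' = vf_rep M c Y in
        frechet_derivative Y' (at x) (X' x) - frechet_derivative X' (at x) (Y' x))"

definition left_inv_vf :: "'g monoid \<Rightarrow> ('g, 'k::finite_dim_inner) mfd \<Rightarrow> 'k \<Rightarrow> 'g \<Rightarrow> 'k" where
  "left_inv_vf G L \<xi> g = tan_at L L (\<lambda>h. g \<otimes>\<^bsub>G\<^esub> h) \<one>\<^bsub>G\<^esub> \<xi>"

definition lie_bracket :: "'g monoid \<Rightarrow> ('g, 'k::finite_dim_inner) mfd \<Rightarrow> 'k \<Rightarrow> 'k \<Rightarrow> 'k" where
  "lie_bracket G L \<xi> \<eta> = vf_bracket L (left_inv_vf G L \<xi>) (left_inv_vf G L \<eta>) \<one>\<^bsub>G\<^esub>"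

definition Ad :: "'g monoid \<Rightarrow> ('g, 'k::finite_dim_inner) mfd \<Rightarrow> 'g \<Rightarrow> 'k \<Rightarrow> 'k" where
  "Ad G L g = tan_at L L (\<lambda>h. g \<otimes>\<^bsub>G\<^esub> h \<otimes>\<^bsub>G\<^esub> inv\<^bsub>G\<^esub> g) \<one>\<^bsub>G\<^esub>"

text \<open>As with covectors, \<open>\<nu>\<close> in the dual of the Lie algebra stands for \<open>\<xi> \<mapsto> \<nu> \<bullet> \<xi>\<close>; as a
  manifold, this dual is \<open>euclid\<close>. The coadjoint action and the cotangent lift are the left
  actions \<open>\<langle>g\<cdot>\<nu>, \<xi>\<rangle> = \<langle>\<nu>, Ad\<^bsub>g\<inverse>\<^esub> \<xi>\<rangle>\<close> and \<open>\<langle>g\<cdot>\<alpha>, v\<rangle> = \<langle>\<alpha>, T\<Phi>\<^bsub>g\<inverse>\<^esub> v\<rangle>\<close> for \<open>v \<in> T\<^bsub>g\<cdot>q\<^esub>Q\<close>.\<close>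

definition coadjoint :: "'g monoid \<Rightarrow> ('g, 'k::finite_dim_inner) mfd \<Rightarrow> 'g \<Rightarrow> 'k \<Rightarrow> 'k" where
  "coadjoint G L g \<nu> = adjoint (Ad G L (inv\<^bsub>G\<^esub> g)) \<nu>"

definition cot_lift :: "'g monoid \<Rightarrow> ('q, 'e::finite_dim_inner) mfd \<Rightarrow> ('g \<Rightarrow> 'q \<Rightarrow> 'q) \<Rightarrow>
    'g \<Rightarrow> 'q \<times> 'e \<Rightarrow> 'q \<times> 'e" where
  "cot_lift G Q act g = (\<lambda>(q, a). (act g q, adjoint (tan_at Q Q (act (inv\<^bsub>G\<^esub> g)) (act g q)) a))"

text \<open>\<open>J\<close> is an \<open>Ad\<^sup>*\<close>-equivariant momentum map of the cotangent lifted action.\<close>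

definition momentum_map :: "'g monoid \<Rightarrow> ('g, 'k::finite_dim_inner) mfd \<Rightarrow>
    ('q, 'e::finite_dim_inner) mfd \<Rightarrow> ('g \<Rightarrow> 'q \<Rightarrow> 'q) \<Rightarrow> ('q \<times> 'e \<Rightarrow> 'k) \<Rightarrow> bool" where
  "momentum_map G L Q act J \<longleftrightarrow> smooth_map (cotangent Q) euclid J \<and>
     (\<forall>z\<in>mcarrier (cotangent Q). \<forall>\<xi> v.
        canonical_form Q z (inf_gen G L (cotangent Q) (cot_lift G Q act) \<xi> z) v
          = tan_at (cotangent Q) euclid (\<lambda>z. J z \<bullet> \<xi>) z v) \<and>
     (\<forall>g\<in>carrier G. \<forall>z\<in>mcarrier (cotangent Q). J (cot_lift G Q act g z) = coadjoint G L g (J z))"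

section \<open>Regular orbit reduction\<close>

text \<open>The orbit through \<open>\<mu>\<close> need not be embedded in the dual of the Lie algebra. Its smooth
  structure is the one of the homogeneous space \<open>G/G\<^sub>\<mu>\<close>, with which it is an immersed submanifold.\<close>

definition coadjoint_orbit :: "'g monoid \<Rightarrow> ('g, 'k::finite_dim_inner) mfd \<Rightarrow> 'k \<Rightarrow>
    ('k, 'o::finite_dim_inner) mfd \<Rightarrow> bool" where
  "coadjoint_orbit G L \<mu> Orb \<longleftrightarrow> manifold Orb \<and> mcarrier Orb = orbit G (coadjoint G L) \<mu> \<and>
     submersion L Orb (\<lambda>g. coadjoint G L g \<mu>) \<and> immersion Orb euclid (\<lambda>\<nu>. \<nu>)"

definition orbit_plus_form :: "'g monoid \<Rightarrow> ('g, 'k::finite_dim_inner) mfd \<Rightarrow>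
    ('k, 'o::finite_dim_inner) mfd \<Rightarrow> ('k \<Rightarrow> 'o \<Rightarrow> 'o \<Rightarrow> real) \<Rightarrow> bool" where
  "orbit_plus_form G L Orb \<omega>p \<longleftrightarrow> two_form Orb \<omega>p \<and>
     (\<forall>\<nu>\<in>mcarrier Orb. \<forall>\<xi> \<eta>.
        \<omega>p \<nu> (inf_gen G L Orb (coadjoint G L) \<xi> \<nu>) (inf_gen G L Orb (coadjoint G L) \<eta> \<nu>)
          = \<nu> \<bullet> lie_bracket G L \<xi> \<eta>)"

text \<open>\<open>N\<close> is \<open>J\<^sup>-\<^sup>1(Orb)\<close>. As \<open>J\<close> is transversal to the immersed submanifold \<open>Orb\<close>, this
  preimage carries the smooth structure of the fibre product of \<open>J\<close> and the inclusion of \<open>Orb\<close>,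
  an embedded submanifold of \<open>M \<times> Orb\<close>. This makes \<open>J\<close> a smooth map from \<open>N\<close> to \<open>Orb\<close>.\<close>

definition orbit_level :: "('a, 'e::finite_dim_inner) mfd \<Rightarrow> ('a \<Rightarrow> 'k) \<Rightarrow>
    ('k, 'o::finite_dim_inner) mfd \<Rightarrow> ('a, 'n::finite_dim_inner) mfd \<Rightarrow> bool" where
  "orbit_level M J Orb N \<longleftrightarrow> manifold N \<and> mcarrier N = {z \<in> mcarrier M. J z \<in> mcarrier Orb} \<and>
     smooth_embedding N (prod_mfd M Orb) (\<lambda>z. (z, J z))"

text \<open>\<open>R\<close> is \<open>N/G\<close> with the quotient manifold structure; \<open>orbit G act\<close> is the projection.\<close>

definition orbit_space :: "'g monoid \<Rightarrow> ('g \<Rightarrow> 'a \<Rightarrow> 'a) \<Rightarrow> ('a, 'n::finite_dim_inner) mfd \<Rightarrow>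
    ('a set, 'r::finite_dim_inner) mfd \<Rightarrow> bool" where
  "orbit_space G act N R \<longleftrightarrow> manifold R \<and> mcarrier R = orbits G (mcarrier N) act \<and>
     submersion N R (orbit G act)"

definition reduced_form :: "('a, 'e::finite_dim_inner) mfd \<Rightarrow> ('a \<Rightarrow> 'e \<Rightarrow> 'e \<Rightarrow> real) \<Rightarrow>
    ('a \<Rightarrow> 'k) \<Rightarrow> ('k, 'o::finite_dim_inner) mfd \<Rightarrow> ('k \<Rightarrow> 'o \<Rightarrow> 'o \<Rightarrow> real) \<Rightarrow>
    ('a, 'n::finite_dim_inner) mfd \<Rightarrow> ('a \<Rightarrow> 'b) \<Rightarrow> ('b, 'r::finite_dim_inner) mfd \<Rightarrow>
    ('b \<Rightarrow> 'r \<Rightarrow> 'r \<Rightarrow> real) \<Rightarrow> bool" where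
  "reduced_form M \<omega> J Orb \<omega>p N \<pi> R \<omega>R \<longleftrightarrow> symplectic_form R \<omega>R \<and>
     (\<forall>z\<in>mcarrier N. \<forall>v w. pullback2 N M (\<lambda>z. z) \<omega> z v w =
        pullback2 N R \<pi> \<omega>R z v w + pullback2 N Orb J \<omega>p z v w)"

text \<open>All of \<open>Orb\<close>, \<open>\<omega>p\<close>, \<open>N\<close>, \<open>R\<close>, \<open>\<omega>R\<close>, \<open>h\<close> are determined by the other arguments,
  up to the choice of atlases for the same smooth structures and to values outside the carriers.\<close>

definition regular_orbit_reducible ::
  "'g monoid \<Rightarrow> ('g, 'k::finite_dim_inner) mfd \<Rightarrow> ('q, 'e::finite_dim_inner) mfd \<Rightarrow>
   ('g \<Rightarrow> 'q \<Rightarrow> 'q) \<Rightarrow> ('q \<times> 'e \<Rightarrow> 'k) \<Rightarrow> ('q \<times> 'e \<Rightarrow> real) \<Rightarrow> 'k \<Rightarrow>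
   ('k, 'o::finite_dim_inner) mfd \<Rightarrow> ('k \<Rightarrow> 'o \<Rightarrow> 'o \<Rightarrow> real) \<Rightarrow>
   ('q \<times> 'e, 'n::finite_dim_inner) mfd \<Rightarrow> (('q \<times> 'e) set, 'r::finite_dim_inner) mfd \<Rightarrow>
   (('q \<times> 'e) set \<Rightarrow> 'r \<Rightarrow> 'r \<Rightarrow> real) \<Rightarrow> (('q \<times> 'e) set \<Rightarrow> real) \<Rightarrow> bool" where
  "regular_orbit_reducible G L Q act J H \<mu> Orb \<omega>p N R \<omega>R h \<longleftrightarrow>
     smooth_map (cotangent Q) euclid H \<and>
     (\<forall>g\<in>carrier G. \<forall>z\<in>mcarrier (cotangent Q). H (cot_lift G Q act g z) = H z) \<and>
     regular_value (cotangent Q) euclid J \<mu> \<and>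
     coadjoint_orbit G L \<mu> Orb \<and>
     orbit_plus_form G L Orb \<omega>p \<and>
     orbit_level (cotangent Q) J Orb N \<and>
     orbit_space G (cot_lift G Q act) N R \<and>
     reduced_form (cotangent Q) (canonical_form Q) J Orb \<omega>p N (orbit G (cot_lift G Q act)) R \<omega>R \<and>
     smooth_map R euclid h \<and>
     (\<forall>z\<in>mcarrier N. h (orbit G (cot_lift G Q act) z) = H z)"

text \<open>\<open>tan_sub N M N' f\<close> is \<open>Tf : TN \<rightarrow> TN'\<close> for an immersed submanifold \<open>N\<close> of \<open>M\<close>, applied to
  vectors of \<open>TM\<close> that are tangent to \<open>N\<close>, i.e. in the image of the injective tangent map of
  the inclusion.\<close>

definition tan_sub :: "('a, 'n::finite_dim_inner) mfd \<Rightarrow> ('a, 'e::finite_dim_inner) mfd \<Rightarrow>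
    ('b, 'r::finite_dim_inner) mfd \<Rightarrow> ('a \<Rightarrow> 'b) \<Rightarrow> 'a \<times> 'e \<Rightarrow> 'b \<times> 'r" where
  "tan_sub N M N' f = tan_map N N' f \<circ> inv_into (tangent_bundle N) (tan_map N M (\<lambda>z. z))"

end

theory Submission
  imports Defs
begin

text \<open>The equivalence holds pointwise: at \<open>z\<close> with \<open>y = \<epsilon> z\<close>, the left side of either equation equals
  the right side of the other. Since \<open>\<epsilon>\<close> is symplectic, \<open>T\<epsilon>\<close> carries \<open>X\<^bsub>H \<circ> \<epsilon>\<^esub>(z)\<close> to \<open>X\<^sub>H(y)\<close>, and the
  reduction theorem projects \<open>X\<^sub>H(y)\<close> to \<open>X\<^sub>h(\<pi> y)\<close>; this is one identity. For the other,
  \<open>J \<circ> \<gamma>\<close> is constant, so \<open>\<gamma>\<close> is differentiable as a map into \<open>J\<^sup>-\<^sup>1(Orb)\<close>, and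
  \<open>T\<pi> \<circ> T\<gamma> \<circ> T fst = T(\<pi> \<circ> \<gamma>) \<circ> T fst\<close> by the chain rule.

  In the reduction theorem, \<open>X\<^sub>H\<close> lies in the kernel of \<open>TJ\<close> by Noether's theorem. That kernel is
  tangent to \<open>J\<^sup>-\<^sup>1(Orb)\<close>, because \<open>J\<close> is a submersion along the whole preimage (by equivariance,
  from the regular value \<open>\<mu>\<close>), so each kernel vector is the velocity of a curve in a fibre of \<open>J\<close>,
  and such a curve is differentiable into the embedded submanifold.\<close>

section \<open>Finite-dimensional inner product spaces\<close>

text \<open>The calculus is first order and pointwise: \<open>mdiff\<close> asks for one derivative
  in the preferred charts. Higher regularity enters where a derivative becomes a coordinate or must
  be controlled near a point. The fibre coordinates of bundle charts and of the lifted action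
  contain first derivatives, so second derivatives of transition maps and of the action make them
  differentiable; the contraction argument needs a continuous derivative of \<open>J\<close>.

  The obstacle is that \<open>N\<close> has a model space of its own and \<open>tan_sub\<close>
  inverts the tangent map of its inclusion, so it says something about a vector only once that
  vector has been exhibited as tangent to \<open>N\<close>. Moreover \<open>Orb\<close> may have a
  finer topology than the induced one, so differentiability of \<open>J \<circ> f\<close> into the
  dual of the Lie algebra may fail to give differentiability into \<open>Orb\<close>. Constancy of
  \<open>J \<circ> f\<close> does give it, which is why the curves and \<open>\<gamma>\<close> are
  kept inside one fibre of \<open>J\<close>.

  Points with \<open>J = \<mu>\<close> come from \<open>\<gamma>\<close> and turn the needed
  identities of the coadjoint action into equivariance of \<open>J\<close>.\<close>

lemma finite_dim_expansion:
  "\<exists>B::'a::finite_dim_inner set. finite B \<and> (\<forall>x. (\<Sum>e\<in>B. (x \<bullet> e) *\<^sub>R e) = x)"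
proof -
  obtain B0 :: "'a set" where B0: "finite B0" "span B0 = UNIV" using finite_dim by blast
  obtain C :: "'a set" where C: "finite C" "span C = UNIV" "pairwise orthogonal C"
    using basis_orthogonal[OF B0(1)] B0(2) by auto
  \<comment> \<open>Orthogonality does not exclude 0 from \<open>C\<close>; it is dropped so that
    the remaining vectors can be normalised.\<close>
  define B where "B = (\<lambda>c. c /\<^sub>R norm c) ` (C - {0})"
  have inj: "inj_on (\<lambda>c. c /\<^sub>R norm c) (C - {0})"
  proof (rule inj_onI, rule ccontr)
    fix c d assume cd: "c \<in> C - {0}" "d \<in> C - {0}" "c /\<^sub>R norm c = d /\<^sub>R norm d" "c \<noteq> d"
    then have "c \<bullet> d = 0" using C(3) by (auto simp: pairwise_def orthogonal_def)
    then have "(c /\<^sub>R norm c) \<bullet> (d /\<^sub>R norm d) = 0" by simp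
    then have "(d /\<^sub>R norm d) \<bullet> (d /\<^sub>R norm d) = 0" using cd(3) by simp
    then show False using cd(2) by simp
  qed
  have "(\<Sum>e\<in>B. (x \<bullet> e) *\<^sub>R e) = x" for x
  proof -
    have lin: "linear (\<lambda>x. (\<Sum>e\<in>B. (x \<bullet> e) *\<^sub>R e))"
      by (rule linearI) (simp_all add: inner_left_distrib scaleR_left_distrib sum.distrib scaleR_sum_right)
    have "(\<Sum>e\<in>B. (x \<bullet> e) *\<^sub>R e) = id x" if "x \<in> C" for x
    proof -
      have "(\<Sum>e\<in>B. (x \<bullet> e) *\<^sub>R e) = (\<Sum>c\<in>C - {0}. (x \<bullet> (c /\<^sub>R norm c)) *\<^sub>R (c /\<^sub>R norm c))"
        unfolding B_def by (simp add: sum.reindex[OF inj])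
      also have "\<dots> = (\<Sum>c\<in>C - {0}. if c = x then x else 0)"
      proof (rule sum.cong[OF refl])
        fix c assume c: "c \<in> C - {0}"
        show "(x \<bullet> (c /\<^sub>R norm c)) *\<^sub>R (c /\<^sub>R norm c) = (if c = x then x else 0)"
        proof (cases "c = x")
          case True
          then show ?thesis using c by (simp add: power2_norm_eq_inner[symmetric] power2_eq_square field_simps)
        next
          case False
          then have "x \<bullet> c = 0" using C(3) c that by (auto simp: pairwise_def orthogonal_def)
          then show ?thesis using False by simp
        qed
      qed
      also have "\<dots> = x" using C(1) that by (cases "x = 0") simp_all
      finally show ?thesis by simp
    qed
    moreover have "x \<in> span C" by (simp add: C(2))
    ultimately have "(\<Sum>e\<in>B. (x \<bullet> e) *\<^sub>R e) = id x"
      by (rule linear_eq_on_span[OF lin linear_id])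
    then show ?thesis by simp
  qed
  moreover have "finite B" unfolding B_def using C(1) by simp
  ultimately show ?thesis by blast
qed

text \<open>Only the reproducing property of a Parseval frame is recorded. It gives coordinates in
  every dimension, 0 included.\<close>

definition frame :: "'a::finite_dim_inner set" where
  "frame = (SOME B. finite B \<and> (\<forall>x. (\<Sum>e\<in>B. (x \<bullet> e) *\<^sub>R e) = x))"

lemma finite_frame [simp]: "finite (frame :: 'a::finite_dim_inner set)"
  and frame_expansion: "(\<Sum>e\<in>frame. (x \<bullet> e) *\<^sub>R e) = (x :: 'a)"
  using someI_ex[OF finite_dim_expansion[where 'a='a]] unfolding frame_def by blast+

lemma linear_frame_expansion:
  fixes f :: "'a::finite_dim_inner \<Rightarrow> 'b::real_vector"
  assumes "linear f"
  shows "f x = (\<Sum>e\<in>frame. (x \<bullet> e) *\<^sub>R f e)"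
proof -
  have "f x = f (\<Sum>e\<in>frame. (x \<bullet> e) *\<^sub>R e)" by (simp add: frame_expansion)
  also have "\<dots> = (\<Sum>e\<in>frame. (x \<bullet> e) *\<^sub>R f e)"
    by (simp add: linear_sum[OF assms] linear_cmul[OF assms])
  finally show ?thesis .
qed

lemma linear_frame_bound:
  fixes f :: "'a::finite_dim_inner \<Rightarrow> 'b::real_normed_vector"
  assumes "linear f"
  shows "norm (f x) \<le> norm x * (\<Sum>e\<in>frame. norm e * norm (f e))"
proof -
  have "norm (f x) \<le> (\<Sum>e\<in>frame. norm ((x \<bullet> e) *\<^sub>R f e))"
    by (subst linear_frame_expansion[OF assms]) (rule norm_sum)
  also have "\<dots> \<le> (\<Sum>e\<in>frame. norm x * (norm e * norm (f e)))"
  proof (rule sum_mono)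
    fix e :: 'a
    have "\<bar>x \<bullet> e\<bar> * norm (f e) \<le> (norm x * norm e) * norm (f e)"
      by (intro mult_right_mono Cauchy_Schwarz_ineq2 norm_ge_zero)
    then show "norm ((x \<bullet> e) *\<^sub>R f e) \<le> norm x * (norm e * norm (f e))"
      by (simp add: mult.assoc)
  qed
  finally show ?thesis by (simp add: sum_distrib_left)
qed

lemma linear_imp_bounded_linear:
  fixes f :: "'a::finite_dim_inner \<Rightarrow> 'b::real_normed_vector"
  assumes "linear f"
  shows "bounded_linear f"
  using linear_frame_bound[OF assms] assms
  by (simp add: bounded_linear_def bounded_linear_axioms_def) blast

lemma riesz_finite_dim:
  fixes f :: "'a::finite_dim_inner \<Rightarrow> real"
  assumes "linear f"
  shows "f x = (\<Sum>e\<in>frame. f e *\<^sub>R e) \<bullet> x"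
proof -
  have "f x = (\<Sum>e\<in>frame. (x \<bullet> e) *\<^sub>R f e)" by (rule linear_frame_expansion[OF assms])
  also have "\<dots> = (\<Sum>e\<in>frame. f e *\<^sub>R e) \<bullet> x"
    unfolding inner_sum_left by (rule sum.cong) (simp_all add: inner_commute)
  finally show ?thesis .
qed

text \<open>\<open>adjoint\<close> is a choice; the Riesz representation in \<open>frame\<close>
  supplies the witness that makes it meaningful.\<close>

lemma adjoint_inner:
  fixes f :: "'a::finite_dim_inner \<Rightarrow> 'b::finite_dim_inner"
  assumes "linear f"
  shows "f x \<bullet> y = x \<bullet> adjoint f y"
proof -
  have "f x \<bullet> y = x \<bullet> (\<Sum>e\<in>frame. (f e \<bullet> y) *\<^sub>R e)" for x y
  proof -
    have "linear (\<lambda>x. f x \<bullet> y)"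
      using assms by (intro linearI) (simp_all add: linear_add linear_cmul inner_left_distrib)
    from riesz_finite_dim[OF this, of x] show ?thesis by (simp only: inner_commute)
  qed
  then have "\<exists>f'. \<forall>x y. f x \<bullet> y = x \<bullet> f' y"
    by (intro exI[of _ "\<lambda>y. \<Sum>e\<in>frame. (f e \<bullet> y) *\<^sub>R e"] allI)
  then show ?thesis unfolding adjoint_def by (rule someI2_ex) blast
qed

text \<open>Writes the adjoint through the values of \<open>f\<close> alone. When \<open>f\<close>
  varies with a point, this is what shows that its adjoint varies differentiably.\<close>

lemma adjoint_frame:
  fixes f :: "'a::finite_dim_inner \<Rightarrow> 'b::finite_dim_inner"
  assumes "linear f"
  shows "adjoint f y = (\<Sum>e\<in>frame. (f e \<bullet> y) *\<^sub>R e)"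
proof -
  have "adjoint f y = (\<Sum>e\<in>frame. (adjoint f y \<bullet> e) *\<^sub>R e)" by (simp add: frame_expansion)
  then show ?thesis by (simp add: adjoint_inner[OF assms] inner_commute[of _ "adjoint f y"])
qed

lemma linear_adjoint:
  fixes f :: "'a::finite_dim_inner \<Rightarrow> 'b::finite_dim_inner"
  assumes "linear f"
  shows "linear (adjoint f)"
  by (rule linearI)
     (simp_all add: adjoint_frame[OF assms] inner_right_distrib scaleR_left_distrib sum.distrib
       scaleR_sum_right)

lemma adjoint_comp:
  fixes f :: "'a::finite_dim_inner \<Rightarrow> 'b::finite_dim_inner" and g :: "'b \<Rightarrow> 'c::finite_dim_inner"
  assumes "linear f" "linear g"
  shows "adjoint (g \<circ> f) y = adjoint f (adjoint g y)"
  using adjoint_unique[of "g \<circ> f" "adjoint f \<circ> adjoint g"]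
  by (simp add: adjoint_inner[OF assms(1)] adjoint_inner[OF assms(2)] fun_eq_iff)

lemma adjoint_id' [simp]: "adjoint (\<lambda>x::'a::real_inner. x) y = y"
  using adjoint_unique[of "\<lambda>x::'a. x" "\<lambda>x. x"] by simp

text \<open>The dimension count needs a finite basis: a finite spanning set is thinned to a maximal
  independent subset, and the locale is interpreted with it.\<close>

lemma linear_surj_iff_inj_finite_dim:
  fixes f :: "'a::finite_dim_inner \<Rightarrow> 'a"
  assumes "linear f"
  shows "surj f \<longleftrightarrow> inj f"
proof -
  obtain A :: "'a set" where A: "finite A" "span A = UNIV" using finite_dim by blast
  obtain B where B: "B \<subseteq> A" "independent B" "A \<subseteq> span B"
    using maximal_independent_subset[of A] by blast
  have "finite B" using A(1) B(1) by (rule finite_subset[rotated])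
  moreover have "span B = UNIV" using B(3) A(2) by (metis span_mono span_span top_le)
  ultimately interpret finite_dimensional_vector_space "scaleR :: real \<Rightarrow> 'a \<Rightarrow> 'a" B
    using B(2) by unfold_locales
      (simp_all add: dependent_raw_def[symmetric] span_raw_def[symmetric] algebra_simps)
  show ?thesis
    using linear_inj_imp_surj linear_surj_imp_inj assms unfolding linear_def by blast
qed

text \<open>Serves the Banach fixed point theorem below. The limit is assembled from the limits of
  the \<open>frame\<close> coefficients.\<close>

lemma complete_finite_dim: "complete (UNIV :: 'a::finite_dim_inner set)"
  unfolding complete_def
proof (intro allI impI)
  fix X :: "nat \<Rightarrow> 'a" assume "(\<forall>n. X n \<in> UNIV) \<and> Cauchy X"
  then have X: "Cauchy X" by simp
  have "\<exists>l. (\<lambda>n. X n \<bullet> e) \<longlonglongrightarrow> l" for e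
    using bounded_linear.Cauchy[OF bounded_linear_inner_left X, of e]
    by (simp add: Cauchy_convergent_iff convergent_def)
  then obtain l where l: "\<And>e. (\<lambda>n. X n \<bullet> e) \<longlonglongrightarrow> l e" by metis
  have "(\<lambda>n. \<Sum>e\<in>frame. (X n \<bullet> e) *\<^sub>R e) \<longlonglongrightarrow> (\<Sum>e\<in>frame. l e *\<^sub>R e)"
    by (intro tendsto_intros l)
  then show "\<exists>l\<in>UNIV. X \<longlonglongrightarrow> l" by (auto simp: frame_expansion)
qed

section \<open>Curves in level sets\<close>

lemma has_derivative_bound_near:
  fixes f :: "real \<Rightarrow> 'b::real_normed_vector"
  assumes "(f has_derivative (\<lambda>h. 0)) (at 0)" "0 < e"
  shows "\<forall>\<^sub>F t in at 0. norm (f t - f 0) \<le> e * \<bar>t\<bar>"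
proof -
  obtain d where "d > 0" and d: "\<And>t. norm (t - 0) < d \<Longrightarrow> norm (f t - f 0 - 0) \<le> e * norm (t - 0)"
    using assms unfolding has_derivative_at_alt by blast
  then show ?thesis
    unfolding eventually_at by (intro exI[of _ d]) (auto simp: dist_norm)
qed

text \<open>Lyusternik's theorem along a line: solve \<open>f (x0 + t v + A s) = f x0\<close> for \<open>s\<close> by a contraction,
  where \<open>A\<close> is a right inverse of the derivative at \<open>x0\<close>; the solution satisfies \<open>s = o(t)\<close>.\<close>

lemma curve_in_level_set:
  fixes f :: "'a::finite_dim_inner \<Rightarrow> 'b::finite_dim_inner"
  assumes S: "open S" "x0 \<in> S"
    and df: "\<And>x. x \<in> S \<Longrightarrow> (f has_derivative D x) (at x)"
    and cont: "\<And>v. continuous_on S (\<lambda>x. D x v)"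
    and surj: "surj (D x0)" and v: "D x0 v = 0"
  obtains c :: "real \<Rightarrow> 'a" where "c 0 = x0" "(c has_derivative (\<lambda>t. t *\<^sub>R v)) (at 0)"
    "\<forall>\<^sub>F t in nhds 0. f (c t) = f x0"
proof -
  have linD: "linear (D x)" if "x \<in> S" for x
    using df[OF that] by (rule has_derivative_linear)
  obtain A where A: "linear A" "D x0 \<circ> A = id"
    using linear_surjective_right_inverse[OF linD[OF S(2)] surj] by blast
  have blA: "bounded_linear A" using A(1) by (rule linear_imp_bounded_linear)
  \<comment> \<open>Continuity of the derivative is given only direction by direction. This finite
    sum turns it into a continuous bound for the operator norm of
    \<open>D x \<circ> A - D x0 \<circ> A\<close>.\<close>
  define \<Theta> where "\<Theta> x = (\<Sum>e\<in>frame. norm e * norm (D x (A e) - D x0 (A e)))" for x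
  have cont\<Theta>: "continuous_on S \<Theta>"
    unfolding \<Theta>_def by (intro continuous_intros cont)
  have "\<Theta> x0 = 0" by (simp add: \<Theta>_def)
  have "open {x \<in> S. \<Theta> x < 1/2}"
  proof -
    have "{x \<in> S. \<Theta> x < 1/2} = S \<inter> \<Theta> -` {..<1/2}" by auto
    then show ?thesis
      using continuous_open_preimage[OF cont\<Theta> S(1), of "{..<1/2}"] by simp
  qed
  then obtain r where r: "r > 0" "ball x0 r \<subseteq> {x \<in> S. \<Theta> x < 1/2}"
    using S(2) \<open>\<Theta> x0 = 0\<close> by (auto simp: open_contains_ball)
  obtain K where K: "K > 0" "\<And>s. norm (A s) \<le> norm s * K"
    using bounded_linear.pos_bounded[OF blA] by blast
  \<comment> \<open>Both \<open>t *\<^sub>R v\<close> and \<open>A s\<close> are to stay within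
    \<open>r/4\<close>, which keeps \<open>p t s\<close> inside the ball. The summand 1 in
    \<open>\<tau>\<close> covers \<open>v = 0\<close>.\<close>
  define \<delta> where "\<delta> = r / (4 * K)"
  define \<tau> where "\<tau> = r / 4 / (norm v + 1)"
  have pos: "\<delta> > 0" "\<tau> > 0" using r K by (simp_all add: \<delta>_def \<tau>_def add_nonneg_pos)
  define p where "p t s = x0 + t *\<^sub>R v + A s" for t s
  \<comment> \<open>Fixed points of \<open>T t\<close> are exactly the solutions. Since
    \<open>D x0 \<circ> A\<close> is the identity, the derivative of \<open>T t\<close> is minus the
    deviation measured by \<open>\<Theta>\<close>, hence of norm at most 1/2 near
    \<open>x0\<close>.\<close>
  define T where "T t s = s - (f (p t s) - f x0)" for t s
  have p_ball: "p t s \<in> ball x0 r" if "\<bar>t\<bar> \<le> \<tau>" "s \<in> cball 0 \<delta>" for t s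
  proof -
    have "norm (t *\<^sub>R v) \<le> \<tau> * (norm v + 1)"
      using that pos by (simp add: mult_mono)
    moreover have "norm v + 1 \<noteq> 0" using norm_ge_zero[of v] by linarith
    then have "\<tau> * (norm v + 1) = r / 4" unfolding \<tau>_def by (rule nonzero_eq_divide_eq[THEN iffD1, OF _ refl])
    ultimately have 1: "norm (t *\<^sub>R v) \<le> r / 4" by simp
    have "norm (A s) \<le> \<delta> * K" using K(2)[of s] that(2) K(1) by (smt (verit) mem_cball_0 mult_right_mono)
    also have "\<dots> = r / 4" using K(1) by (simp add: \<delta>_def)
    finally have "norm (A s) \<le> r / 4" .
    with 1 have "norm (t *\<^sub>R v + A s) \<le> r / 2"
      by (intro order_trans[OF norm_triangle_ineq]) simp
    moreover have "dist x0 (p t s) = norm (t *\<^sub>R v + A s)"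
      unfolding p_def by (metis add.assoc add_diff_cancel_left' dist_commute dist_norm)
    ultimately show ?thesis using r(1) by simp
  qed
  have contr: "norm (T t s - T t s') \<le> 1/2 * norm (s - s')"
    if t: "\<bar>t\<bar> \<le> \<tau>" and s: "s \<in> cball 0 \<delta>" "s' \<in> cball 0 \<delta>" for t s s'
  proof (rule differentiable_bound[OF convex_cball[of 0 \<delta>] _ _ s])
    fix u assume u: "u \<in> cball (0::'b) \<delta>"
    have pS: "p t u \<in> S" "\<Theta> (p t u) < 1/2" using p_ball[OF t u] r(2) by auto
    have "((\<lambda>s. p t s) has_derivative A) (at u)"
      unfolding p_def
      by (rule has_derivative_eq_rhs, (rule derivative_intros bounded_linear.has_derivative[OF blA])+) simp
    from has_derivative_compose[OF this df[OF pS(1)]]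
    have "((\<lambda>s. T t s) has_derivative (\<lambda>w. w - D (p t u) (A w))) (at u)"
      unfolding T_def by (auto intro!: derivative_eq_intros)
    then show "(T t has_derivative (\<lambda>w. w - D (p t u) (A w))) (at u within cball 0 \<delta>)"
      by (rule has_derivative_at_withinI)
    show "onorm (\<lambda>w. w - D (p t u) (A w)) \<le> 1/2"
    proof (rule onorm_bound)
      fix w
      let ?L = "\<lambda>w. D (p t u) (A w) - D x0 (A w)"
      have "linear ?L"
        using linear_compose_sub[OF linear_compose[OF A(1) linD[OF pS(1)]]
            linear_compose[OF A(1) linD[OF S(2)]]] by (simp add: o_def)
      from linear_frame_bound[OF this, of w]
      have "norm (?L w) \<le> norm w * \<Theta> (p t u)" by (simp add: \<Theta>_def)
      also have "\<dots> \<le> norm w * (1/2)" using pS(2) by (intro mult_left_mono) auto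
      finally show "norm (w - D (p t u) (A w)) \<le> 1/2 * norm w"
        using A(2) by (simp add: norm_minus_commute o_def fun_eq_iff)
    qed simp
  qed
  \<comment> \<open>As \<open>v\<close> lies in the kernel of \<open>D x0\<close>, the defect
    \<open>\<rho>\<close> of the straight line is \<open>o(t)\<close>.\<close>
  have d0: "((\<lambda>t. f (x0 + t *\<^sub>R v)) has_derivative (\<lambda>h. 0)) (at 0)"
  proof -
    have "((\<lambda>t. x0 + t *\<^sub>R v) has_derivative (\<lambda>h. h *\<^sub>R v)) (at 0)"
      by (auto intro!: derivative_eq_intros)
    from has_derivative_compose[OF this] df[OF S(2)]
    have "((\<lambda>t. f (x0 + t *\<^sub>R v)) has_derivative (\<lambda>h. D x0 (h *\<^sub>R v))) (at 0)" by simp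
    then show ?thesis by (simp add: linear_cmul[OF linD[OF S(2)]] v)
  qed
  define \<rho> where "\<rho> t = norm (f (x0 + t *\<^sub>R v) - f x0)" for t
  have \<rho>: "\<forall>\<^sub>F t in at 0. \<rho> t \<le> e * \<bar>t\<bar>" if "e > 0" for e
    using has_derivative_bound_near[OF d0 that] by (simp add: \<rho>_def)
  have T0: "norm (T t 0) = \<rho> t" for t
    by (simp add: T_def p_def \<rho>_def linear_0[OF A(1)] norm_minus_commute)
  have sol: "\<exists>s. norm s \<le> 2 * \<rho> t \<and> f (p t s) = f x0" if t: "\<bar>t\<bar> \<le> \<tau>" and small: "\<rho> t \<le> \<delta> / 2" for t
  proof -
    have "T t ` cball 0 \<delta> \<subseteq> cball 0 \<delta>"
    proof (intro image_subsetI)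
      fix s :: 'b assume s: "s \<in> cball 0 \<delta>"
      have "norm (T t s) \<le> norm (T t s - T t 0) + norm (T t 0)"
        by (metis diff_add_cancel norm_triangle_ineq)
      also have "\<dots> \<le> 1/2 * norm (s - 0) + \<delta> / 2"
        using contr[OF t s, of 0] small pos by (simp add: T0)
      also have "\<dots> \<le> \<delta>" using s by simp
      finally show "T t s \<in> cball 0 \<delta>" by simp
    qed
    moreover have "complete (cball (0::'b) \<delta>)"
      using complete_finite_dim closed_cball complete_Int_closed by fastforce
    ultimately obtain s where s: "s \<in> cball 0 \<delta>" "T t s = s"
      using Banach_fix[of "cball 0 \<delta>" "1/2" "T t"] contr[OF t] pos by (auto simp: dist_norm)
    \<comment> \<open>From \<open>norm s \<le> norm s / 2 + \<rho> t\<close> the correction inherits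
      the rate of the defect.\<close>
    have "norm s = norm (T t s - T t 0 + T t 0)" by (simp add: s(2))
    also have "\<dots> \<le> 1/2 * norm (s - 0) + \<rho> t"
      using contr[OF t s(1), of 0] pos T0 by (intro order_trans[OF norm_triangle_ineq]) simp
    finally have "norm s \<le> 2 * \<rho> t" by simp
    moreover have "f (p t s) = f x0" using s(2) by (simp add: T_def)
    ultimately show ?thesis by blast
  qed
  \<comment> \<open>The value 0 where no solution is chosen makes
    \<open>norm (s t) \<le> 2 * \<rho> t\<close> hold for every \<open>t\<close>.\<close>
  define s where "s t = (if \<bar>t\<bar> \<le> \<tau> \<and> \<rho> t \<le> \<delta> / 2
    then SOME s. norm s \<le> 2 * \<rho> t \<and> f (p t s) = f x0 else 0)" for t
  have s: "norm (s t) \<le> 2 * \<rho> t \<and> f (p t (s t)) = f x0" if "\<bar>t\<bar> \<le> \<tau>" "\<rho> t \<le> \<delta> / 2" for t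
    using someI_ex[OF sol[OF that]] that by (simp add: s_def)
  have s_bound: "norm (s t) \<le> 2 * \<rho> t" for t
    using s[of t] by (cases "\<bar>t\<bar> \<le> \<tau> \<and> \<rho> t \<le> \<delta> / 2") (auto simp: s_def \<rho>_def)
  have s0: "s 0 = 0" using s_bound[of 0] by (simp add: \<rho>_def)
  show ?thesis
  proof
    show "p 0 (s 0) = x0" by (simp add: p_def s0 linear_0[OF A(1)])
    have "(s has_derivative (\<lambda>h. 0)) (at 0)"
      unfolding has_derivative_at_alt
    proof (intro conjI allI impI)
      fix e :: real assume e: "e > 0"
      from \<rho>[of "e/2"] e obtain d where d: "d > 0" "\<And>t. t \<noteq> 0 \<Longrightarrow> \<bar>t\<bar> < d \<Longrightarrow> \<rho> t \<le> e/2 * \<bar>t\<bar>"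
        unfolding eventually_at by (auto simp: dist_norm)
      have "norm (s t - s 0 - 0) \<le> e * norm (t - 0)" if "norm (t - 0) < d" for t
        using d(2)[of t] that s_bound[of t] s0 by (cases "t = 0") auto
      then show "\<exists>d>0. \<forall>y. norm (y - 0) < d \<longrightarrow> norm (s y - s 0 - 0) \<le> e * norm (y - 0)"
        using d(1) by blast
    qed simp
    from bounded_linear.has_derivative[OF blA this]
    show "((\<lambda>t. p t (s t)) has_derivative (\<lambda>t. t *\<^sub>R v)) (at 0)"
      unfolding p_def by (auto intro!: derivative_eq_intros simp: linear_0[OF A(1)])
    have "\<forall>\<^sub>F t in at 0. \<rho> t \<le> \<bar>t\<bar>" using \<rho>[of 1] by simp
    moreover have "\<forall>\<^sub>F t in at 0. \<bar>t\<bar> < min \<tau> (\<delta>/2)"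
      using pos unfolding eventually_at by (intro exI[of _ "min \<tau> (\<delta>/2)"]) (auto simp: dist_norm)
    ultimately have "\<forall>\<^sub>F t in at 0. f (p t (s t)) = f x0"
      by eventually_elim (use s in auto)
    then show "\<forall>\<^sub>F t in nhds 0. f (p t (s t)) = f x0"
      by (simp add: eventually_nhds_conv_at p_def s0 linear_0[OF A(1)])
  qed
qed

section \<open>Differentiable maps between manifolds\<close>

lemma has_derivative_transform_nhds:
  assumes "(f has_derivative D) (at a)" "\<forall>\<^sub>F x in nhds a. f x = g x"
  shows "(g has_derivative D) (at a)"
  by (rule has_derivative_transform_eventually[OF assms(1)])
     (use assms(2) in \<open>simp_all add: eventually_nhds_conv_at\<close>)

lemma has_derivative_cong_nhds:
  assumes "\<forall>\<^sub>F x in nhds a. f x = g x"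
  shows "(f has_derivative D) (at a) \<longleftrightarrow> (g has_derivative D) (at a)"
  using has_derivative_transform_nhds[of f D a g] has_derivative_transform_nhds[of g D a f] assms
  by (auto simp: eq_commute)

lemma differentiable_cong_nhds:
  assumes "\<forall>\<^sub>F x in nhds a. f x = g x"
  shows "f differentiable (at a) \<longleftrightarrow> g differentiable (at a)"
  using has_derivative_cong_nhds[OF assms] by (simp add: differentiable_def)

lemma frechet_derivative_cong_nhds:
  assumes "\<forall>\<^sub>F x in nhds a. f x = g x"
  shows "frechet_derivative f (at a) = frechet_derivative g (at a)"
  using has_derivative_cong_nhds[OF assms] by (simp add: frechet_derivative_def)

lemma has_derivative_imp_tendsto:
  assumes "(f has_derivative D) (at a)"
  shows "filterlim f (nhds (f a)) (nhds a)"
  using has_derivative_continuous[OF assms] by (simp add: isCont_def tendsto_at_iff_tendsto_nhds)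

lemma chart_inv_eq: "inj_on (snd c) (fst c) \<Longrightarrow> p \<in> fst c \<Longrightarrow> snd c p = x \<Longrightarrow> chart_inv c x = p"
  by (auto simp: chart_inv_def)

lemma chart_inv_in: "x \<in> snd c ` fst c \<Longrightarrow> chart_inv c x \<in> fst c"
  by (simp add: chart_inv_def inv_into_into)

lemma chart_chart_inv: "x \<in> snd c ` fst c \<Longrightarrow> snd c (chart_inv c x) = x"
  by (simp add: chart_inv_def f_inv_into_f)

text \<open>The part of \<open>manifold\<close> that the tangent calculus depends on. Unlike smoothness of the
  transition maps, it is easily inherited by cotangent bundles and products.\<close>

definition diff_atlas :: "('a, 'e::finite_dim_inner) mfd \<Rightarrow> bool" where
  "diff_atlas M \<longleftrightarrow>
     (\<forall>c\<in>atlas M. inj_on (snd c) (fst c) \<and> open (snd c ` fst c)) \<and>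
     (\<forall>c\<in>atlas M. \<forall>d\<in>atlas M. open (snd c ` (fst c \<inter> fst d)) \<and>
        (\<forall>x\<in>snd c ` (fst c \<inter> fst d). (snd d \<circ> chart_inv c) differentiable (at x))) \<and>
     (\<forall>p\<in>mcarrier M. chart_at M p \<in> atlas M \<and> p \<in> fst (chart_at M p))"

lemma smooth_on_differentiable: "smooth_on S f \<Longrightarrow> x \<in> S \<Longrightarrow> f differentiable (at x)"
  unfolding smooth_on_def by (drule spec[of _ "Suc 0"]) simp

lemma smooth_on_continuous_derivative:
  "smooth_on S f \<Longrightarrow> continuous_on S (\<lambda>x. frechet_derivative f (at x) v)"
  unfolding smooth_on_def by (drule spec[of _ "Suc 0"]) simp

lemma smooth_on_differentiable_derivative:
  "smooth_on S f \<Longrightarrow> x \<in> S \<Longrightarrow> (\<lambda>x. frechet_derivative f (at x) v) differentiable (at x)"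
  unfolding smooth_on_def by (drule spec[of _ "Suc (Suc 0)"]) simp

lemma manifold_diff_atlas: "manifold M \<Longrightarrow> diff_atlas M"
  unfolding manifold_def diff_atlas_def
  by (elim conjE, intro conjI ballI) (blast intro: smooth_on_differentiable)+

section \<open>Charts, their overlaps and the generated topology\<close>

context
  fixes M :: "('a, 'e::finite_dim_inner) mfd"
  assumes M: "diff_atlas M"
begin

lemma chart_inj: "c \<in> atlas M \<Longrightarrow> inj_on (snd c) (fst c)"
  and chart_open: "c \<in> atlas M \<Longrightarrow> open (snd c ` fst c)"
  and chart_overlap_open: "c \<in> atlas M \<Longrightarrow> d \<in> atlas M \<Longrightarrow> open (snd c ` (fst c \<inter> fst d))"
  and transition_differentiable: "c \<in> atlas M \<Longrightarrow> d \<in> atlas M \<Longrightarrow> x \<in> snd c ` (fst c \<inter> fst d) \<Longrightarrow>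
    (snd d \<circ> chart_inv c) differentiable (at x)"
  and chart_at_atlas: "p \<in> mcarrier M \<Longrightarrow> chart_at M p \<in> atlas M"
  and chart_at_domain: "p \<in> mcarrier M \<Longrightarrow> p \<in> fst (chart_at M p)"
  using M by (auto simp: diff_atlas_def)

lemma chart_inv_chart: "c \<in> atlas M \<Longrightarrow> p \<in> fst c \<Longrightarrow> chart_inv c (snd c p) = p"
  by (rule chart_inv_eq[OF chart_inj]) auto

lemma eventually_chart: "c \<in> atlas M \<Longrightarrow> p \<in> fst c \<Longrightarrow> \<forall>\<^sub>F x in nhds (snd c p). x \<in> snd c ` fst c"
  by (rule eventually_nhds_in_open[OF chart_open]) auto

lemma chart_domain_carrier: "c \<in> atlas M \<Longrightarrow> fst c \<subseteq> mcarrier M"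
  by (auto simp: mcarrier_def)

text \<open>Induction over how the topology is generated. Intersections need injectivity of the
  chart, and a generator from another chart needs continuity of the transition map.\<close>

lemma openin_chart_image:
  assumes "openin (mtop M) U" and c: "c \<in> atlas M"
  shows "open (snd c ` (fst c \<inter> U))"
proof -
  have "generate_topology_on {fst c \<inter> snd c -` W | c W. c \<in> atlas M \<and> open W} U"
    using assms(1) unfolding mtop_def by (rule openin_topology_generated_by)
  then show ?thesis
  proof induction
    case Empty
    then show ?case by simp
  next
    case (Int a b)
    have "snd c ` (fst c \<inter> (a \<inter> b)) = snd c ` (fst c \<inter> a) \<inter> snd c ` (fst c \<inter> b)"
      using chart_inj[OF c] by (auto simp: inj_on_def)
    then show ?case using Int.IH by auto
  next
    case (UN K)
    have "snd c ` (fst c \<inter> \<Union>K) = (\<Union>k\<in>K. snd c ` (fst c \<inter> k))" by auto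
    then show ?case using UN.IH by auto
  next
    case (Basis s)
    then obtain d W where d: "s = fst d \<inter> snd d -` W" "d \<in> atlas M" "open W" by blast
    let ?O = "snd c ` (fst c \<inter> fst d)"
    have "continuous_on ?O (snd d \<circ> chart_inv c)"
      by (intro continuous_at_imp_continuous_on ballI differentiable_imp_continuous_within
          transition_differentiable c d(2))
    then have "open (?O \<inter> (snd d \<circ> chart_inv c) -` W)"
      by (rule continuous_open_preimage[OF _ chart_overlap_open[OF c d(2)] d(3)])
    moreover have "?O \<inter> (snd d \<circ> chart_inv c) -` W = snd c ` (fst c \<inter> s)"
      using chart_inv_chart[OF c] unfolding d(1) by (auto simp: image_iff)
    ultimately show ?case by simp
  qed
qed

lemma topspace_mtop: "topspace (mtop M) = mcarrier M"
proof -
  have "\<exists>c W. p \<in> fst c \<inter> snd c -` W \<and> c \<in> atlas M \<and> open W" if "p \<in> mcarrier M" for p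
    using that by (intro exI[of _ "chart_at M p"] exI[of _ UNIV]) (simp add: chart_at_atlas chart_at_domain)
  then show ?thesis
    unfolding mtop_def topology_generated_by_topspace mcarrier_def by blast
qed

lemma openin_chart_domain: "c \<in> atlas M \<Longrightarrow> open W \<Longrightarrow> openin (mtop M) (fst c \<inter> snd c -` W)"
  unfolding mtop_def openin_topology_generated_by_iff by (rule generate_topology_on.Basis) blast

end

text \<open>The neighbourhood filter of a point, transported from the model space so that local
  statements reduce to \<open>nhds\<close> there.\<close>

definition mnhds :: "('a, 'e::finite_dim_inner) mfd \<Rightarrow> 'a \<Rightarrow> 'a filter" where
  "mnhds M p = filtermap (chart_inv (chart_at M p)) (nhds (snd (chart_at M p) p))"

definition mrep :: "('a, 'e::finite_dim_inner) mfd \<Rightarrow> ('b, 'f::finite_dim_inner) mfd \<Rightarrow>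
    ('a \<Rightarrow> 'b) \<Rightarrow> 'a \<Rightarrow> 'e \<Rightarrow> 'f" where
  "mrep M N f p = snd (chart_at N (f p)) \<circ> f \<circ> chart_inv (chart_at M p)"

text \<open>The eventual clause stands for continuity: without it the representative could be
  evaluated where \<open>f\<close> has left the target chart and \<open>mrep\<close> means
  nothing.\<close>

definition mdiff :: "('a, 'e::finite_dim_inner) mfd \<Rightarrow> ('b, 'f::finite_dim_inner) mfd \<Rightarrow>
    ('a \<Rightarrow> 'b) \<Rightarrow> 'a \<Rightarrow> bool" where
  "mdiff M N f p \<longleftrightarrow> p \<in> mcarrier M \<and> f p \<in> mcarrier N \<and>
     (\<forall>\<^sub>F q in mnhds M p. f q \<in> fst (chart_at N (f p))) \<and>
     mrep M N f p differentiable (at (snd (chart_at M p) p))"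

lemma mdiff_carrier: "mdiff M N f p \<Longrightarrow> p \<in> mcarrier M" "mdiff M N f p \<Longrightarrow> f p \<in> mcarrier N"
  by (simp_all add: mdiff_def)

lemma tan_at_mrep: "tan_at M N f p = frechet_derivative (mrep M N f p) (at (snd (chart_at M p) p))"
  by (simp add: tan_at_def mrep_def)

lemma mrep_has_derivative:
  "mdiff M N f p \<Longrightarrow> (mrep M N f p has_derivative tan_at M N f p) (at (snd (chart_at M p) p))"
  by (unfold mdiff_def tan_at_mrep) (simp only: frechet_derivative_works)

lemma linear_tan_at: "mdiff M N f p \<Longrightarrow> linear (tan_at M N f p)"
  by (rule has_derivative_linear[OF mrep_has_derivative])

lemma tan_at_unique:
  "(mrep M N f p has_derivative D) (at (snd (chart_at M p) p)) \<Longrightarrow> tan_at M N f p = D"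
  by (simp add: tan_at_mrep frechet_derivative_at[symmetric])

lemma mnhds_chart:
  assumes "diff_atlas M" "p \<in> mcarrier M"
  shows "\<forall>\<^sub>F q in mnhds M p. q \<in> fst (chart_at M p)"
  using eventually_chart[OF assms(1) chart_at_atlas[OF assms] chart_at_domain[OF assms]]
  unfolding mnhds_def eventually_filtermap by eventually_elim (rule chart_inv_in)

lemma mnhds_carrier:
  assumes "diff_atlas M" "p \<in> mcarrier M"
  shows "\<forall>\<^sub>F q in mnhds M p. q \<in> mcarrier M"
  using mnhds_chart[OF assms]
  by eventually_elim (use chart_domain_carrier[OF assms(1) chart_at_atlas[OF assms]] in blast)

lemma mnhds_at:
  assumes "diff_atlas M" "p \<in> mcarrier M" "\<forall>\<^sub>F q in mnhds M p. P q"
  shows "P p"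
  using eventually_nhds_x_imp_x[OF assms(3)[unfolded mnhds_def eventually_filtermap]]
  by (simp add: chart_inv_chart[OF assms(1) chart_at_atlas[OF assms(1,2)] chart_at_domain[OF assms(1,2)]])

lemma mnhds_open:
  assumes "diff_atlas M" "openin (mtop M) U" "p \<in> U"
  shows "\<forall>\<^sub>F q in mnhds M p. q \<in> U"
proof -
  have p: "p \<in> mcarrier M"
    using openin_subset[OF assms(2)] assms(3) topspace_mtop[OF assms(1)] by auto
  let ?c = "chart_at M p"
  note c = chart_at_atlas[OF assms(1) p] chart_at_domain[OF assms(1) p]
  have "\<forall>\<^sub>F x in nhds (snd ?c p). x \<in> snd ?c ` (fst ?c \<inter> U)"
    by (rule eventually_nhds_in_open[OF openin_chart_image[OF assms(1,2) c(1)]]) (use c assms in auto)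
  then show ?thesis unfolding mnhds_def eventually_filtermap
    by eventually_elim (auto simp: chart_inv_chart[OF assms(1) c(1)])
qed

lemma mnhds_mono:
  assumes "diff_atlas M" "p \<in> mcarrier M" "\<And>q. q \<in> mcarrier M \<Longrightarrow> P q"
  shows "\<forall>\<^sub>F q in mnhds M p. P q"
  using mnhds_carrier[OF assms(1,2)] by eventually_elim (rule assms(3))

lemma mdiff_filterlim:
  assumes N: "diff_atlas N" and M: "diff_atlas M" and f: "mdiff M N f p"
  shows "filterlim f (mnhds N (f p)) (mnhds M p)"
proof -
  let ?d = "chart_at N (f p)"
  note p = mdiff_carrier[OF f]
  have p': "chart_inv (chart_at M p) (snd (chart_at M p) p) = p"
    by (rule chart_inv_chart[OF M chart_at_atlas[OF M p(1)] chart_at_domain[OF M p(1)]])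
  have "filterlim (mrep M N f p) (nhds (snd ?d (f p))) (nhds (snd (chart_at M p) p))"
    using has_derivative_imp_tendsto[OF mrep_has_derivative[OF f]] by (simp add: mrep_def p')
  then have "filterlim (\<lambda>x. chart_inv ?d (mrep M N f p x)) (mnhds N (f p)) (nhds (snd (chart_at M p) p))"
    unfolding mnhds_def filterlim_def by (metis filtermap_filtermap filtermap_mono)
  moreover have "\<forall>\<^sub>F x in nhds (snd (chart_at M p) p).
      chart_inv ?d (mrep M N f p x) = f (chart_inv (chart_at M p) x)"
    using f unfolding mdiff_def mnhds_def eventually_filtermap
    by (elim conjE eventually_mono) (simp add: mrep_def chart_inv_chart[OF N chart_at_atlas[OF N p(2)]])
  ultimately have "filterlim (\<lambda>x. f (chart_inv (chart_at M p) x)) (mnhds N (f p)) (nhds (snd (chart_at M p) p))"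
    by (subst (asm) filterlim_cong[OF refl refl])
  then show ?thesis unfolding mnhds_def[of M] by (simp add: filterlim_filtermap)
qed

section \<open>Chain rule and local representatives\<close>

context
  fixes M :: "('a, 'e::finite_dim_inner) mfd" and N :: "('b, 'f::finite_dim_inner) mfd"
  assumes M: "diff_atlas M" and N: "diff_atlas N"
begin

lemma mdiff_cong:
  assumes "mdiff M N f p" "\<forall>\<^sub>F q in mnhds M p. f q = g q"
  shows "mdiff M N g p" "tan_at M N g p = tan_at M N f p"
proof -
  note p = mdiff_carrier[OF assms(1)]
  have fg: "f p = g p" by (rule mnhds_at[OF M p(1) assms(2)])
  have "\<forall>\<^sub>F x in nhds (snd (chart_at M p) p). mrep M N f p x = mrep M N g p x"
    using assms(2) unfolding mnhds_def eventually_filtermap by eventually_elim (simp add: mrep_def fg)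
  note eq = differentiable_cong_nhds[OF this] frechet_derivative_cong_nhds[OF this]
  have "\<forall>\<^sub>F q in mnhds M p. f q \<in> fst (chart_at N (f p))" using assms(1) by (simp add: mdiff_def)
  with assms(2) have "\<forall>\<^sub>F q in mnhds M p. g q \<in> fst (chart_at N (g p))"
    by eventually_elim (simp add: fg)
  then show "mdiff M N g p" using assms(1) eq(1) fg by (simp add: mdiff_def)
  show "tan_at M N g p = tan_at M N f p" by (simp add: tan_at_mrep eq(2))
qed

lemma mdiff_compose:
  fixes P :: "('c, 'h::finite_dim_inner) mfd"
  assumes f: "mdiff M N f p" and g: "mdiff N P g (f p)"
  shows "mdiff M P (\<lambda>x. g (f x)) p"
    and "tan_at M P (\<lambda>x. g (f x)) p v = tan_at N P g (f p) (tan_at M N f p v)"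
proof -
  note p = mdiff_carrier[OF f]
  let ?x = "snd (chart_at M p) p" and ?d = "chart_at N (f p)"
  have p': "chart_inv (chart_at M p) ?x = p"
    by (rule chart_inv_chart[OF M chart_at_atlas[OF M p(1)] chart_at_domain[OF M p(1)]])
  have "(mrep N P g (f p) has_derivative tan_at N P g (f p)) (at (mrep M N f p ?x))"
    using mrep_has_derivative[OF g] by (simp add: mrep_def p')
  from has_derivative_compose[OF mrep_has_derivative[OF f] this]
  have "((\<lambda>x. mrep N P g (f p) (mrep M N f p x)) has_derivative
      (\<lambda>v. tan_at N P g (f p) (tan_at M N f p v))) (at ?x)" .
  \<comment> \<open>The middle charts cancel only where \<open>f\<close> stays in the chart at
    \<open>f p\<close>, so the two representatives are compared near the point.\<close>
  moreover have "\<forall>\<^sub>F x in nhds ?x. mrep N P g (f p) (mrep M N f p x) = mrep M P (\<lambda>x. g (f x)) p x"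
    using f unfolding mdiff_def mnhds_def eventually_filtermap
    by (elim conjE eventually_mono) (simp add: mrep_def chart_inv_chart[OF N chart_at_atlas[OF N p(2)]])
  ultimately have *: "(mrep M P (\<lambda>x. g (f x)) p has_derivative
      (\<lambda>v. tan_at N P g (f p) (tan_at M N f p v))) (at ?x)"
    by (rule has_derivative_transform_nhds)
  then show "tan_at M P (\<lambda>x. g (f x)) p v = tan_at N P g (f p) (tan_at M N f p v)"
    by (simp add: tan_at_unique)
  have "\<forall>\<^sub>F q in mnhds M p. g (f q) \<in> fst (chart_at P (g (f p)))"
    using mdiff_filterlim[OF N M f] g unfolding filterlim_iff mdiff_def by blast
  then show "mdiff M P (\<lambda>x. g (f x)) p"
    using * p(1) mdiff_carrier(2)[OF g] unfolding mdiff_def differentiable_def by blast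
qed

lemma mdiff_const:
  assumes "p \<in> mcarrier M" "y \<in> mcarrier N"
  shows "mdiff M N (\<lambda>_. y) p" "tan_at M N (\<lambda>_. y) p v = 0"
proof -
  have "(mrep M N (\<lambda>_. y) p has_derivative (\<lambda>_. 0)) (at (snd (chart_at M p) p))"
    by (simp add: mrep_def o_def)
  then show "mdiff M N (\<lambda>_. y) p" "tan_at M N (\<lambda>_. y) p v = 0"
    using assms chart_at_domain[OF N assms(2)] by (auto simp: mdiff_def differentiable_def tan_at_unique)
qed

text \<open>\<open>smooth_map\<close> speaks of an overlap whose coordinate image is not assumed
  open, while \<open>smooth_on\<close> is meant for open sets. Continuity of \<open>f\<close>
  provides the openness.\<close>

lemma smooth_map_mrep:
  assumes f: "smooth_map M N f" and p: "p \<in> mcarrier M"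
  obtains S where "open S" "snd (chart_at M p) p \<in> S" "smooth_on S (mrep M N f p)"
    "\<And>x. x \<in> S \<Longrightarrow> x \<in> snd (chart_at M p) ` fst (chart_at M p)"
    "\<And>x. x \<in> S \<Longrightarrow> f (chart_inv (chart_at M p) x) \<in> fst (chart_at N (f p))"
proof -
  let ?c = "chart_at M p" and ?d = "chart_at N (f p)"
  let ?S = "snd ?c ` (fst ?c \<inter> f -` fst ?d)"
  have fp: "f p \<in> mcarrier N" using f p by (auto simp: smooth_map_def)
  note c = chart_at_atlas[OF M p] chart_at_domain[OF M p]
  note d = chart_at_atlas[OF N fp] chart_at_domain[OF N fp]
  have "openin (mtop M) {x \<in> topspace (mtop M). f x \<in> fst ?d}"
    using f openin_chart_domain[OF N d(1) open_UNIV]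
    unfolding smooth_map_def by (intro openin_continuous_map_preimage) auto
  from openin_chart_image[OF M this c(1)]
  have "open (snd ?c ` (fst ?c \<inter> {x \<in> topspace (mtop M). f x \<in> fst ?d}))" .
  moreover have "fst ?c \<inter> {x \<in> topspace (mtop M). f x \<in> fst ?d} = fst ?c \<inter> f -` fst ?d"
    using chart_domain_carrier[OF M c(1)] by (auto simp: topspace_mtop[OF M])
  ultimately have "open ?S" by simp
  moreover have "smooth_on ?S (mrep M N f p)"
    using f c(1) d(1) by (simp add: smooth_map_def mrep_def)
  ultimately show ?thesis
    by (intro that[of ?S]) (use c d chart_inv_chart[OF M c(1)] in auto)
qed

lemma smooth_map_mdiff:
  assumes f: "smooth_map M N f" and p: "p \<in> mcarrier M"
  shows "mdiff M N f p"
proof -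
  obtain S where S: "open S" "snd (chart_at M p) p \<in> S" "smooth_on S (mrep M N f p)"
    "\<And>x. x \<in> S \<Longrightarrow> f (chart_inv (chart_at M p) x) \<in> fst (chart_at N (f p))"
    using smooth_map_mrep[OF f p] by metis
  have "\<forall>\<^sub>F q in mnhds M p. f q \<in> fst (chart_at N (f p))"
    unfolding mnhds_def eventually_filtermap
    using eventually_nhds_in_open[OF S(1,2)] by eventually_elim (rule S(4))
  moreover have "f p \<in> mcarrier N" using f p by (auto simp: smooth_map_def)
  ultimately show ?thesis
    using p smooth_on_differentiable[OF S(3,2)] by (simp add: mdiff_def)
qed

end

lemma mdiff_id:
  assumes M: "diff_atlas M" and p: "p \<in> mcarrier M"
  shows "mdiff M M (\<lambda>x. x) p" "tan_at M M (\<lambda>x. x) p v = v"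
proof -
  have "\<forall>\<^sub>F x in nhds (snd (chart_at M p) p). (\<lambda>x. x) x = mrep M M (\<lambda>x. x) p x"
    using eventually_chart[OF M chart_at_atlas[OF M p] chart_at_domain[OF M p]]
    by eventually_elim (simp add: mrep_def chart_chart_inv)
  with has_derivative_ident
  have "(mrep M M (\<lambda>x. x) p has_derivative (\<lambda>x. x)) (at (snd (chart_at M p) p))"
    by (rule has_derivative_transform_nhds)
  then show "mdiff M M (\<lambda>x. x) p" "tan_at M M (\<lambda>x. x) p v = v"
    using p mnhds_chart[OF M p] by (auto simp: mdiff_def differentiable_def tan_at_unique)
qed

subsection \<open>Euclidean spaces and charts\<close>

lemma euclid_simps [simp]:
  "atlas euclid = {(UNIV, \<lambda>x. x)}" "chart_at euclid p = (UNIV, \<lambda>x. x)" "mcarrier euclid = UNIV"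
  by (simp_all add: euclid_def mcarrier_def)

lemma chart_inv_euclid [simp]: "chart_inv (UNIV, \<lambda>x. x) x = x"
  by (rule chart_inv_eq) auto

lemma diff_atlas_euclid: "diff_atlas (euclid :: ('e::finite_dim_inner, 'e) mfd)"
  by (auto simp: diff_atlas_def o_def)

lemma mnhds_euclid [simp]: "mnhds euclid x = nhds x"
  by (simp add: mnhds_def filter_eq_iff eventually_filtermap)

lemma mdiff_euclid_iff: "mdiff euclid euclid f x \<longleftrightarrow> f differentiable (at x)"
  by (simp add: mdiff_def mrep_def o_def)

lemma tan_at_euclid: "(f has_derivative D) (at x) \<Longrightarrow> tan_at euclid euclid f x = D"
  by (rule tan_at_unique) (simp add: mrep_def o_def)

context
  fixes M :: "('a, 'e::finite_dim_inner) mfd" and c :: "('a, 'e) chart"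
  assumes M: "diff_atlas M" and c: "c \<in> atlas M"
begin

lemma mdiff_chart:
  assumes "p \<in> fst c"
  shows "mdiff M euclid (snd c) p"
proof -
  have p: "p \<in> mcarrier M" using chart_domain_carrier[OF M c] assms by auto
  show ?thesis
    using transition_differentiable[OF M chart_at_atlas[OF M p] c] p assms chart_at_domain[OF M p]
    by (simp add: mdiff_def mrep_def o_def)
qed

lemma mdiff_chart_inv:
  assumes x: "x \<in> snd c ` fst c"
  shows "mdiff euclid M (chart_inv c) x"
proof -
  let ?d = "chart_at M (chart_inv c x)"
  have p: "chart_inv c x \<in> fst c" "chart_inv c x \<in> mcarrier M"
    using chart_inv_in[OF x] chart_domain_carrier[OF M c] by auto
  note d = chart_at_atlas[OF M p(2)] chart_at_domain[OF M p(2)]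
  have x': "x \<in> snd c ` (fst c \<inter> fst ?d)" using p(1) d(2) chart_chart_inv[OF x, symmetric] by (intro image_eqI[where x="chart_inv c x"]) auto
  have "\<forall>\<^sub>F y in nhds x. chart_inv c y \<in> fst ?d"
    using eventually_nhds_in_open[OF chart_overlap_open[OF M c d(1)] x']
    by eventually_elim (auto simp: chart_inv_chart[OF M c])
  then show ?thesis
    using transition_differentiable[OF M c d(1) x'] p by (simp add: mdiff_def mrep_def o_def)
qed

lemma tan_chart_chart_inv:
  assumes x: "x \<in> snd c ` fst c"
  shows "tan_at M euclid (snd c) (chart_inv c x) (tan_at euclid M (chart_inv c) x v) = v"
proof -
  have "\<forall>\<^sub>F y in mnhds euclid x. y = snd c (chart_inv c y)"
    using eventually_nhds_in_open[OF chart_open[OF M c] x] unfolding mnhds_euclid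
    by eventually_elim (simp add: chart_chart_inv)
  from mdiff_cong(2)[OF diff_atlas_euclid diff_atlas_euclid mdiff_id(1)[OF diff_atlas_euclid] this]
  have "tan_at euclid euclid (\<lambda>y. snd c (chart_inv c y)) x v = v"
    by (simp add: mdiff_id(2)[OF diff_atlas_euclid])
  then show ?thesis
    by (simp add: mdiff_compose(2)[OF diff_atlas_euclid M mdiff_chart_inv[OF x]
          mdiff_chart[OF chart_inv_in[OF x]]])
qed

lemma mnhds_chart_domain:
  assumes "p \<in> fst c"
  shows "\<forall>\<^sub>F q in mnhds M p. q \<in> fst c"
  using mnhds_open[OF M openin_chart_domain[OF M c open_UNIV]] assms by simp

lemma tan_chart_inv_chart:
  assumes p: "p \<in> fst c"
  shows "tan_at euclid M (chart_inv c) (snd c p) (tan_at M euclid (snd c) p v) = v"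
proof -
  have p': "p \<in> mcarrier M" using chart_domain_carrier[OF M c] p by auto
  have "\<forall>\<^sub>F y in mnhds M p. y = chart_inv c (snd c y)"
    using mnhds_chart_domain[OF p] by eventually_elim (simp add: chart_inv_chart[OF M c])
  from mdiff_cong(2)[OF M M mdiff_id(1)[OF M p'] this]
  have "tan_at M M (\<lambda>y. chart_inv c (snd c y)) p v = v" by (simp add: mdiff_id(2)[OF M p'])
  then show ?thesis
    using mdiff_compose(2)[OF M diff_atlas_euclid mdiff_chart[OF p] mdiff_chart_inv] p by simp
qed

end

text \<open>Tangent vectors at \<open>p\<close> are by convention coordinates in
  \<open>chart_at M p\<close>, so undoing that very chart changes nothing. Other charts satisfy just
  the two inverse laws above.\<close>

lemma tan_chart_inv_at:
  assumes M: "diff_atlas M" and p: "p \<in> mcarrier M"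
  shows "tan_at euclid M (chart_inv (chart_at M p)) (snd (chart_at M p) p) v = v"
proof -
  let ?c = "chart_at M p"
  note c = chart_at_atlas[OF M p] chart_at_domain[OF M p]
  have p': "chart_inv ?c (snd ?c p) = p" by (rule chart_inv_chart[OF M c])
  have ev: "\<forall>\<^sub>F x in nhds (snd ?c p). (\<lambda>x. x) x = snd ?c (chart_inv ?c x)"
    using eventually_chart[OF M c] by eventually_elim (simp add: chart_chart_inv)
  have *: "((\<lambda>x. snd ?c (chart_inv ?c x)) has_derivative (\<lambda>v. v)) (at (snd ?c p))"
    by (rule has_derivative_transform_nhds[OF has_derivative_ident ev])
  show "tan_at euclid M (chart_inv ?c) (snd ?c p) v = v"
    by (subst tan_at_unique[of _ _ _ _ "\<lambda>v. v"]) (use * in \<open>simp_all add: mrep_def o_def p'\<close>)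
qed

subsection \<open>Products\<close>

lemma prod_chart_simps [simp]:
  "fst (prod_chart c d) = fst c \<times> fst d" "snd (prod_chart c d) (x, y) = (snd c x, snd d y)"
  by (simp_all add: prod_chart_def)

lemma prod_chart_image [simp]: "snd (prod_chart c d) ` (A \<times> B) = snd c ` A \<times> snd d ` B"
  by (force simp: prod_chart_def)

lemma prod_chart_atlas: "c \<in> atlas M \<Longrightarrow> d \<in> atlas N \<Longrightarrow> prod_chart c d \<in> atlas (prod_mfd M N)"
  unfolding prod_mfd_def mfd.simps by blast

lemma prod_mfd_simps [simp]:
  "mcarrier (prod_mfd M N) = mcarrier M \<times> mcarrier N"
  "chart_at (prod_mfd M N) (p, q) = prod_chart (chart_at M p) (chart_at N q)"
proof -
  show "mcarrier (prod_mfd M N) = mcarrier M \<times> mcarrier N"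
  proof (intro equalityI subsetI)
    fix z assume "z \<in> mcarrier M \<times> mcarrier N"
    then obtain c d where "c \<in> atlas M" "d \<in> atlas N" "z \<in> fst c \<times> fst d"
      by (auto simp: mcarrier_def)
    then show "z \<in> mcarrier (prod_mfd M N)"
      unfolding mcarrier_def by (intro UN_I[of "prod_chart c d"] prod_chart_atlas) simp_all
  next
    fix z assume "z \<in> mcarrier (prod_mfd M N)"
    then obtain c d where "c \<in> atlas M" "d \<in> atlas N" "z \<in> fst (prod_chart c d)"
      unfolding mcarrier_def prod_mfd_def mfd.simps by blast
    then show "z \<in> mcarrier M \<times> mcarrier N" unfolding mcarrier_def by auto
  qed
qed (simp add: prod_mfd_def)

lemma inj_prod_chart:
  "inj_on (snd c) (fst c) \<Longrightarrow> inj_on (snd d) (fst d) \<Longrightarrow> inj_on (snd (prod_chart c d)) (fst c \<times> fst d)"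
  by (auto simp: inj_on_def prod_chart_def)

lemma chart_inv_prod:
  assumes "inj_on (snd c) (fst c)" "inj_on (snd d) (fst d)" "x \<in> snd c ` fst c" "y \<in> snd d ` fst d"
  shows "chart_inv (prod_chart c d) (x, y) = (chart_inv c x, chart_inv d y)"
  by (rule chart_inv_eq) (use assms in \<open>auto simp: inj_prod_chart chart_chart_inv chart_inv_in\<close>)

context
  fixes M :: "('a, 'e::finite_dim_inner) mfd" and N :: "('b, 'f::finite_dim_inner) mfd"
  assumes M: "diff_atlas M" and N: "diff_atlas N"
begin

lemma diff_atlas_prod: "diff_atlas (prod_mfd M N)"
  unfolding diff_atlas_def
proof (intro conjI ballI)
  fix C assume "C \<in> atlas (prod_mfd M N)"
  then obtain c d where C: "C = prod_chart c d" and c: "c \<in> atlas M" and d: "d \<in> atlas N"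
    by (auto simp: prod_mfd_def)
  show "inj_on (snd C) (fst C)" "open (snd C ` fst C)"
    by (simp_all add: C inj_prod_chart chart_inj[OF M c] chart_inj[OF N d] open_Times
        chart_open[OF M c] chart_open[OF N d])
  fix D assume "D \<in> atlas (prod_mfd M N)"
  then obtain c' d' where D: "D = prod_chart c' d'" and c': "c' \<in> atlas M" and d': "d' \<in> atlas N"
    by (auto simp: prod_mfd_def)
  show op: "open (snd C ` (fst C \<inter> fst D))"
    by (simp add: C D Times_Int_Times open_Times chart_overlap_open[OF M c c'] chart_overlap_open[OF N d d'])
  fix z assume z: "z \<in> snd C ` (fst C \<inter> fst D)"
  obtain x y where xy: "z = (x, y)" by (cases z)
  have x: "x \<in> snd c ` (fst c \<inter> fst c')" and y: "y \<in> snd d ` (fst d \<inter> fst d')"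
    using z by (auto simp: C D xy Times_Int_Times)
  have ev: "\<forall>\<^sub>F z in nhds z. (\<lambda>z. ((snd c' \<circ> chart_inv c) (fst z), (snd d' \<circ> chart_inv d) (snd z))) z
      = (snd D \<circ> chart_inv C) z"
    using eventually_nhds_in_open[OF op z]
  proof eventually_elim
    case (elim w)
    then show ?case
      by (cases w) (auto simp: C D chart_inv_prod chart_inj[OF M c] chart_inj[OF N d] Times_Int_Times)
  qed
  obtain D1 D2 where "((snd c' \<circ> chart_inv c) has_derivative D1) (at x)"
    "((snd d' \<circ> chart_inv d) has_derivative D2) (at y)"
    using transition_differentiable[OF M c c' x] transition_differentiable[OF N d d' y]
    by (auto simp: differentiable_def)
  then have "((snd c' \<circ> chart_inv c) has_derivative D1) (at (fst z))"
    "((snd d' \<circ> chart_inv d) has_derivative D2) (at (snd z))" by (simp_all add: xy)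
  from has_derivative_Pair[OF has_derivative_compose[OF has_derivative_fst[OF has_derivative_ident] this(1)]
      has_derivative_compose[OF has_derivative_snd[OF has_derivative_ident] this(2)]]
  have "((\<lambda>z. ((snd c' \<circ> chart_inv c) (fst z), (snd d' \<circ> chart_inv d) (snd z)))
      has_derivative (\<lambda>v. (D1 (fst v), D2 (snd v)))) (at z)" .
  then show "(snd D \<circ> chart_inv C) differentiable (at z)"
    unfolding differentiable_def by (intro exI) (rule has_derivative_transform_nhds[OF _ ev])
next
  fix z assume z: "z \<in> mcarrier (prod_mfd M N)"
  obtain p q where pq: "z = (p, q)" by (cases z)
  with z have p: "p \<in> mcarrier M" and q: "q \<in> mcarrier N" by simp_all
  show "chart_at (prod_mfd M N) z \<in> atlas (prod_mfd M N)"
    using chart_at_atlas[OF M p] chart_at_atlas[OF N q] by (simp add: pq prod_chart_atlas)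
  show "z \<in> fst (chart_at (prod_mfd M N) z)"
    by (simp add: pq chart_at_domain[OF M p] chart_at_domain[OF N q])
qed

lemma mdiff_Pair:
  fixes A :: "('c, 'h::finite_dim_inner) mfd"
  assumes f: "mdiff A M f p" and g: "mdiff A N g p"
  shows "mdiff A (prod_mfd M N) (\<lambda>x. (f x, g x)) p"
    and "tan_at A (prod_mfd M N) (\<lambda>x. (f x, g x)) p v = (tan_at A M f p v, tan_at A N g p v)"
proof -
  have "mrep A (prod_mfd M N) (\<lambda>x. (f x, g x)) p = (\<lambda>x. (mrep A M f p x, mrep A N g p x))"
    by (simp add: mrep_def fun_eq_iff)
  then have *: "(mrep A (prod_mfd M N) (\<lambda>x. (f x, g x)) p has_derivative
      (\<lambda>v. (tan_at A M f p v, tan_at A N g p v))) (at (snd (chart_at A p) p))"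
    using has_derivative_Pair[OF mrep_has_derivative[OF f] mrep_has_derivative[OF g]] by simp
  then show "tan_at A (prod_mfd M N) (\<lambda>x. (f x, g x)) p v = (tan_at A M f p v, tan_at A N g p v)"
    by (simp add: tan_at_unique)
  have "\<forall>\<^sub>F q in mnhds A p. f q \<in> fst (chart_at M (f p)) \<and> g q \<in> fst (chart_at N (g p))"
    using f g unfolding mdiff_def by (intro eventually_conj) auto
  then show "mdiff A (prod_mfd M N) (\<lambda>x. (f x, g x)) p"
    using * mdiff_carrier[OF f] mdiff_carrier[OF g] by (auto simp: mdiff_def differentiable_def)
qed

lemma mdiff_fst_snd:
  assumes p: "p \<in> mcarrier M" and q: "q \<in> mcarrier N"
  shows "mdiff (prod_mfd M N) M fst (p, q)" "mdiff (prod_mfd M N) N snd (p, q)"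
proof -
  let ?c = "chart_at M p" and ?d = "chart_at N q" and ?P = "prod_mfd M N"
  note c = chart_at_atlas[OF M p] chart_at_domain[OF M p]
  note d = chart_at_atlas[OF N q] chart_at_domain[OF N q]
  let ?z = "snd (chart_at ?P (p, q)) (p, q)"
  have ev: "\<forall>\<^sub>F z in nhds ?z. z \<in> (snd ?c ` fst ?c) \<times> (snd ?d ` fst ?d)"
    by (rule eventually_nhds_in_open) (use c d chart_open[OF M c(1)] chart_open[OF N d(1)] in \<open>auto intro: open_Times\<close>)
  then have "\<forall>\<^sub>F z in nhds ?z. fst z = mrep ?P M fst (p, q) z" "\<forall>\<^sub>F z in nhds ?z. snd z = mrep ?P N snd (p, q) z"
    by (auto elim!: eventually_mono
        simp: mrep_def chart_inv_prod chart_inj[OF M c(1)] chart_inj[OF N d(1)] chart_chart_inv)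
  from has_derivative_transform_nhds[OF has_derivative_fst[OF has_derivative_ident] this(1)]
    has_derivative_transform_nhds[OF has_derivative_snd[OF has_derivative_ident] this(2)]
  have *: "(mrep ?P M fst (p, q) has_derivative fst) (at ?z)"
     "(mrep ?P N snd (p, q) has_derivative snd) (at ?z)" .
  from ev have "\<forall>\<^sub>F z in mnhds ?P (p, q). z \<in> fst ?c \<times> fst ?d"
    unfolding mnhds_def eventually_filtermap
    by eventually_elim (auto simp: chart_inv_prod chart_inj[OF M c(1)] chart_inj[OF N d(1)] chart_inv_in)
  then have "\<forall>\<^sub>F z in mnhds ?P (p, q). fst z \<in> fst ?c" "\<forall>\<^sub>F z in mnhds ?P (p, q). snd z \<in> fst ?d"
    by (auto elim: eventually_mono)
  then show "mdiff ?P M fst (p, q)" "mdiff ?P N snd (p, q)"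
    using * p q by (auto simp: mdiff_def differentiable_def)
qed

end

section \<open>Cotangent bundles\<close>

lemma mdiff_to_euclid_iff:
  "mdiff A euclid f p \<longleftrightarrow> p \<in> mcarrier A \<and>
     (\<lambda>x. f (chart_inv (chart_at A p) x)) differentiable (at (snd (chart_at A p) p))"
  by (simp add: mdiff_def mrep_def o_def)

lemma mdiff_to_euclid_Pair:
  assumes "mdiff A euclid f p" "mdiff A euclid g p"
  shows "mdiff A euclid (\<lambda>x. (f x, g x)) p"
  using assms unfolding mdiff_to_euclid_iff differentiable_def
  by (elim conjE exE, intro conjI exI) (assumption, rule has_derivative_Pair)

text \<open>The sum is that of \<open>adjoint_frame\<close>, with the values of the linear map and
  the argument both varying; it serves for the fibre coordinates below.\<close>

lemma mdiff_to_euclid_sum_inner_scaleR: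
  assumes "\<And>e. e \<in> B \<Longrightarrow> mdiff A euclid (f e) p" "mdiff A euclid g p"
  shows "mdiff A euclid (\<lambda>x. \<Sum>e\<in>B. (f e x \<bullet> g x) *\<^sub>R e) p"
proof -
  let ?r = "chart_inv (chart_at A p)" and ?x = "snd (chart_at A p) p"
  have "(\<lambda>x. (f e (?r x) \<bullet> g (?r x)) *\<^sub>R e) differentiable (at ?x)" if e: "e \<in> B" for e
  proof -
    obtain D1 D2 where "((\<lambda>x. f e (?r x)) has_derivative D1) (at ?x)" "((\<lambda>x. g (?r x)) has_derivative D2) (at ?x)"
      using assms(1)[OF e] assms(2) unfolding mdiff_to_euclid_iff differentiable_def by blast
    from has_derivative_scaleR_left[OF has_derivative_inner[OF this]] show ?thesis
      unfolding differentiable_def by blast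
  qed
  then obtain D where D: "\<And>e. e \<in> B \<Longrightarrow> ((\<lambda>x. (f e (?r x) \<bullet> g (?r x)) *\<^sub>R e) has_derivative D e) (at ?x)"
    unfolding differentiable_def by metis
  have "((\<lambda>x. \<Sum>e\<in>B. (f e (?r x) \<bullet> g (?r x)) *\<^sub>R e) has_derivative (\<lambda>x. \<Sum>e\<in>B. D e x)) (at ?x)"
    by (rule has_derivative_sum) (rule D)
  then show ?thesis using assms(2) unfolding mdiff_to_euclid_iff differentiable_def by blast
qed

lemma mdiff_euclidI: "(f has_derivative D) (at x) \<Longrightarrow> mdiff euclid euclid f x"
  by (auto simp: mdiff_euclid_iff differentiable_def)

lemma cotangent_simps [simp]:
  "atlas (cotangent Q) = cot_chart Q ` atlas Q"
  "chart_at (cotangent Q) (q, a) = cot_chart Q (chart_at Q q)"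
  "mcarrier (cotangent Q) = mcarrier Q \<times> UNIV"
  by (auto simp: cotangent_def mcarrier_def cot_chart_def)

lemma cot_chart_simps [simp]:
  "fst (cot_chart Q c) = fst c \<times> UNIV"
  "snd (cot_chart Q c) (q, a) = (snd c q, adjoint (tan_at euclid Q (chart_inv c) (snd c q)) a)"
  by (simp_all add: cot_chart_def)

locale cotangent_bundle =
  fixes Q :: "('q, 'e::finite_dim_inner) mfd"
  assumes manifold_base: "manifold Q"
begin

lemma Q: "diff_atlas Q" by (rule manifold_diff_atlas[OF manifold_base])

context
  fixes c :: "('q, 'e) chart"
  assumes c: "c \<in> atlas Q"
begin

lemma linear_tan_chart: "q \<in> fst c \<Longrightarrow> linear (tan_at Q euclid (snd c) q)"
  by (rule linear_tan_at[OF mdiff_chart[OF Q c]])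

lemma linear_tan_chart_inv: "q \<in> fst c \<Longrightarrow> linear (tan_at euclid Q (chart_inv c) (snd c q))"
  by (rule linear_tan_at[OF mdiff_chart_inv[OF Q c]]) simp

lemma adjoint_chart_chart_inv:
  assumes "q \<in> fst c"
  shows "adjoint (tan_at Q euclid (snd c) q) (adjoint (tan_at euclid Q (chart_inv c) (snd c q)) a) = a"
    and "adjoint (tan_at euclid Q (chart_inv c) (snd c q)) (adjoint (tan_at Q euclid (snd c) q) b) = b"
proof -
  have "tan_at euclid Q (chart_inv c) (snd c q) \<circ> tan_at Q euclid (snd c) q = (\<lambda>v. v)"
    by (simp add: fun_eq_iff tan_chart_inv_chart[OF Q c assms])
  then show "adjoint (tan_at Q euclid (snd c) q) (adjoint (tan_at euclid Q (chart_inv c) (snd c q)) a) = a"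
    by (simp add: adjoint_comp[OF linear_tan_chart[OF assms] linear_tan_chart_inv[OF assms], symmetric])
  have "tan_at Q euclid (snd c) q \<circ> tan_at euclid Q (chart_inv c) (snd c q) = (\<lambda>v. v)"
    using tan_chart_chart_inv[OF Q c, of "snd c q"] assms by (simp add: fun_eq_iff chart_inv_chart[OF Q c])
  then show "adjoint (tan_at euclid Q (chart_inv c) (snd c q)) (adjoint (tan_at Q euclid (snd c) q) b) = b"
    by (simp add: adjoint_comp[OF linear_tan_chart_inv[OF assms] linear_tan_chart[OF assms], symmetric])
qed

lemma inj_cot_chart: "inj_on (snd (cot_chart Q c)) (fst c \<times> UNIV)"
proof (rule inj_onI; clarify)
  fix q a q' a'
  assume *: "q \<in> fst c" "q' \<in> fst c" "snd (cot_chart Q c) (q, a) = snd (cot_chart Q c) (q', a')"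
  then have "q = q'" using chart_inj[OF Q c] by (auto dest: inj_onD)
  with * show "q = q' \<and> a = a'" using adjoint_chart_chart_inv(1)[of q] by (metis cot_chart_simps(2) snd_conv)
qed

lemma cot_chart_image:
  assumes "U \<subseteq> fst c"
  shows "snd (cot_chart Q c) ` (U \<times> UNIV) = snd c ` U \<times> UNIV"
proof (intro equalityI subsetI)
  fix z assume "z \<in> snd c ` U \<times> (UNIV :: 'e set)"
  then obtain q b where "q \<in> U" "z = (snd c q, b)" by auto
  then show "z \<in> snd (cot_chart Q c) ` (U \<times> UNIV)"
    using adjoint_chart_chart_inv(2)[of q b] assms
    by (intro image_eqI[of _ _ "(q, adjoint (tan_at Q euclid (snd c) q) b)"]) auto
qed auto

lemma cot_chart_inv:
  assumes "x \<in> snd c ` fst c"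
  shows "chart_inv (cot_chart Q c) (x, b) = (chart_inv c x, adjoint (tan_at Q euclid (snd c) (chart_inv c x)) b)"
proof (rule chart_inv_eq)
  show "inj_on (snd (cot_chart Q c)) (fst (cot_chart Q c))" by (simp add: inj_cot_chart)
  show "(chart_inv c x, adjoint (tan_at Q euclid (snd c) (chart_inv c x)) b) \<in> fst (cot_chart Q c)"
    by (simp add: chart_inv_in[OF assms])
  show "snd (cot_chart Q c) (chart_inv c x, adjoint (tan_at Q euclid (snd c) (chart_inv c x)) b) = (x, b)"
    using adjoint_chart_chart_inv(2)[OF chart_inv_in[OF assms]] by (simp add: chart_chart_inv[OF assms])
qed

end

lemma tan_transition:
  assumes c: "c \<in> atlas Q" and d: "d \<in> atlas Q" and y: "y \<in> snd d ` (fst d \<inter> fst c)"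
  shows "tan_at Q euclid (snd c) (chart_inv d y) (tan_at euclid Q (chart_inv d) y v) =
    frechet_derivative (snd c \<circ> chart_inv d) (at y) v"
proof -
  have y': "y \<in> snd d ` fst d" "chart_inv d y \<in> fst c" using y chart_inv_chart[OF Q d] by auto
  have "(snd c \<circ> chart_inv d has_derivative frechet_derivative (snd c \<circ> chart_inv d) (at y)) (at y)"
    using transition_differentiable[OF Q d c y] frechet_derivative_works by blast
  from tan_at_euclid[OF this] show ?thesis
    using mdiff_compose(2)[OF diff_atlas_euclid Q mdiff_chart_inv[OF Q d y'(1)] mdiff_chart[OF Q c y'(2)], of v]
    by (simp add: o_def)
qed

text \<open>The fibre part of a change of bundle charts is the adjoint of the derivative of the
  reverse transition \<open>?\<phi>\<close>, taken at \<open>?\<psi> x\<close>. Its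
  differentiability concerns second derivatives, which is where smoothness of the transition maps of
  \<open>Q\<close> is used.\<close>

lemma diff_atlas_cotangent: "diff_atlas (cotangent Q)"
  unfolding diff_atlas_def
proof (intro conjI ballI)
  fix C assume "C \<in> atlas (cotangent Q)"
  then obtain c where C: "C = cot_chart Q c" and c: "c \<in> atlas Q" by auto
  show "inj_on (snd C) (fst C)" by (simp add: C inj_cot_chart[OF c])
  show "open (snd C ` fst C)" by (simp add: C cot_chart_image[OF c] open_Times chart_open[OF Q c])
  fix D assume "D \<in> atlas (cotangent Q)"
  then obtain d where D: "D = cot_chart Q d" and d: "d \<in> atlas Q" by auto
  have CD: "fst C \<inter> fst D = (fst c \<inter> fst d) \<times> UNIV" by (auto simp: C D)
  show op: "open (snd C ` (fst C \<inter> fst D))"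
    unfolding CD by (simp add: C cot_chart_image[OF c] open_Times chart_overlap_open[OF Q c d])
  fix z assume z: "z \<in> snd C ` (fst C \<inter> fst D)"
  let ?\<psi> = "snd d \<circ> chart_inv c" and ?\<phi> = "snd c \<circ> chart_inv d"
  let ?h = "\<lambda>w. (?\<psi> (fst w), \<Sum>e\<in>frame. (frechet_derivative ?\<phi> (at (?\<psi> (fst w))) e \<bullet> snd w) *\<^sub>R e)"
  have ov: "x \<in> snd c ` (fst c \<inter> fst d) \<Longrightarrow> ?\<psi> x \<in> snd d ` (fst d \<inter> fst c)" for x
    by (auto simp: chart_inv_chart[OF Q c])
  have "\<forall>\<^sub>F w in nhds z. ?h w = (snd D \<circ> chart_inv C) w"
    using eventually_nhds_in_open[OF op z]
  proof eventually_elim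
    case (elim w)
    obtain x b where w: "w = (x, b)" by (cases w)
    have x: "x \<in> snd c ` (fst c \<inter> fst d)" using elim unfolding CD by (simp add: C w cot_chart_image[OF c])
    then have x': "x \<in> snd c ` fst c" by auto
    let ?q = "chart_inv c x"
    have q: "?q \<in> fst c" "?q \<in> fst d" using x chart_inv_chart[OF Q c] by auto
    let ?T = "tan_at Q euclid (snd c) ?q" and ?U = "tan_at euclid Q (chart_inv d) (snd d ?q)"
    have lin: "linear ?T" "linear ?U"
      using linear_tan_chart[OF c q(1)] linear_tan_chart_inv[OF d q(2)] .
    have "adjoint ?U (adjoint ?T b) = adjoint (?T \<circ> ?U) b"
      by (simp add: adjoint_comp[OF lin(2,1)])
    also have "\<dots> = (\<Sum>e\<in>frame. ((?T \<circ> ?U) e \<bullet> b) *\<^sub>R e)"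
      by (rule adjoint_frame[OF linear_compose[OF lin(2,1)]])
    finally have "adjoint ?U (adjoint ?T b) = (\<Sum>e\<in>frame. (frechet_derivative ?\<phi> (at (?\<psi> x)) e \<bullet> b) *\<^sub>R e)"
      using tan_transition[OF c d ov[OF x]] by (simp add: chart_inv_chart[OF Q d q(2)])
    then show ?case by (simp add: w C D cot_chart_inv[OF c x'])
  qed
  moreover have "?h differentiable (at z)"
  proof -
    have z': "fst z \<in> snd c ` (fst c \<inter> fst d)" using z unfolding CD by (auto simp: C cot_chart_image[OF c])
    obtain D1 where D1: "(?\<psi> has_derivative D1) (at (fst z))"
      using transition_differentiable[OF Q c d z'] by (auto simp: differentiable_def)
    have f: "((\<lambda>w. ?\<psi> (fst w)) has_derivative (\<lambda>v. D1 (fst v))) (at z)"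
      by (rule has_derivative_compose[OF has_derivative_fst[OF has_derivative_ident] D1])
    have sm: "smooth_on (snd d ` (fst d \<inter> fst c)) ?\<phi>"
      using manifold_base c d by (simp add: manifold_def)
    have "mdiff euclid euclid (\<lambda>w. \<Sum>e\<in>frame. (frechet_derivative ?\<phi> (at (?\<psi> (fst w))) e \<bullet> snd w) *\<^sub>R e) z"
    proof (rule mdiff_to_euclid_sum_inner_scaleR)
      fix e :: 'e
      obtain D2 where "((\<lambda>y. frechet_derivative ?\<phi> (at y) e) has_derivative D2) (at (?\<psi> (fst z)))"
        using smooth_on_differentiable_derivative[OF sm ov[OF z']] by (auto simp: differentiable_def)
      from mdiff_euclidI[OF has_derivative_compose[OF f this]]
      show "mdiff euclid euclid (\<lambda>w. frechet_derivative ?\<phi> (at (?\<psi> (fst w))) e) z" .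
      show "mdiff euclid euclid snd z"
        by (rule mdiff_euclidI[OF has_derivative_snd[OF has_derivative_ident]])
    qed
    from mdiff_to_euclid_Pair[OF mdiff_euclidI[OF f] this] show ?thesis
      by (simp only: mdiff_euclid_iff)
  qed
  ultimately show "(snd D \<circ> chart_inv C) differentiable (at z)"
    by (rule differentiable_cong_nhds[THEN iffD1])
next
  fix z assume "z \<in> mcarrier (cotangent Q)"
  then obtain q a where z: "z = (q, a)" "q \<in> mcarrier Q" by auto
  show "chart_at (cotangent Q) z \<in> atlas (cotangent Q)" "z \<in> fst (chart_at (cotangent Q) z)"
    using chart_at_atlas[OF Q z(2)] chart_at_domain[OF Q z(2)] by (simp_all add: z)
qed

section \<open>The bundle projection, the canonical form and its Hamiltonian vector fields\<close>

lemma mdiff_cotangent_fst: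
  assumes "z \<in> mcarrier (cotangent Q)"
  shows "mdiff (cotangent Q) Q fst z" "tan_at (cotangent Q) Q fst z v = fst v"
proof -
  obtain q a where z: "z = (q, a)" by (cases z)
  then have q: "q \<in> mcarrier Q" using assms by simp
  let ?c = "chart_at Q q"
  note c = chart_at_atlas[OF Q q] chart_at_domain[OF Q q]
  have op: "open (snd ?c ` fst ?c \<times> (UNIV :: 'e set))" by (simp add: open_Times chart_open[OF Q c(1)])
  have "\<forall>\<^sub>F w in nhds (snd (chart_at (cotangent Q) z) z). w \<in> snd ?c ` fst ?c \<times> UNIV"
    by (rule eventually_nhds_in_open[OF op]) (simp add: z c)
  then have "\<forall>\<^sub>F w in nhds (snd (chart_at (cotangent Q) z) z). fst w = mrep (cotangent Q) Q fst z w"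
    by eventually_elim (auto simp: z mrep_def cot_chart_inv[OF c(1)] chart_chart_inv chart_inv_chart[OF Q c(1)])
  from has_derivative_transform_nhds[OF has_derivative_fst[OF has_derivative_ident] this]
  have *: "(mrep (cotangent Q) Q fst z has_derivative fst) (at (snd (chart_at (cotangent Q) z) z))" .
  have "\<forall>\<^sub>F w in mnhds (cotangent Q) z. fst w \<in> fst ?c"
    using mnhds_chart[OF diff_atlas_cotangent assms] by eventually_elim (auto simp: z)
  then show "mdiff (cotangent Q) Q fst z"
    using * q by (auto simp: mdiff_def z differentiable_def)
  show "tan_at (cotangent Q) Q fst z v = fst v" using * by (simp add: tan_at_unique)
qed

text \<open>The preferred bundle chart is a Darboux chart: there the tautological form is
  \<open>p dq\<close>, and minus its exterior derivative is the standard form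
  \<open>dq \<and> dp\<close>.\<close>

lemma canonical_form_eq:
  assumes z: "z \<in> mcarrier (cotangent Q)"
  shows "canonical_form Q z v w = fst v \<bullet> snd w - fst w \<bullet> snd v"
proof -
  define c where "c = chart_at Q (fst z)"
  have q: "fst z \<in> mcarrier Q" using z by auto
  have c: "c \<in> atlas Q" "fst z \<in> fst c" using chart_at_atlas[OF Q q] chart_at_domain[OF Q q] by (simp_all add: c_def)
  let ?C = "cot_chart Q c" and ?M = "cotangent Q"
  have C: "chart_at ?M z = ?C" "?C \<in> atlas ?M" using c by (cases z; simp add: c_def)+
  let ?x0 = "snd ?C z" and ?\<theta> = "pullback1 euclid ?M (chart_inv ?C) (tautological_form Q)"
  have op: "open (snd c ` fst c \<times> (UNIV :: 'e set))" by (simp add: open_Times chart_open[OF Q c(1)])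
  have x0: "?x0 \<in> snd c ` fst c \<times> UNIV" using c by (cases z) auto
  have \<theta>: "?\<theta> x w = fst w \<bullet> snd x" if x: "x \<in> snd c ` fst c \<times> UNIV" for x w
  proof -
    have x1: "fst x \<in> snd c ` fst c" using x by auto
    have xC: "x \<in> snd ?C ` fst ?C" using x by (simp add: cot_chart_image[OF c(1)])
    let ?z = "chart_inv ?C x"
    have zM: "?z \<in> mcarrier ?M" using chart_inv_in[OF xC] chart_domain_carrier[OF diff_atlas_cotangent C(2)] by blast
    note dC = mdiff_chart_inv[OF diff_atlas_cotangent C(2) xC]
    have fst_inv: "fst (chart_inv ?C y) = chart_inv c (fst y)" if "y \<in> snd c ` fst c \<times> UNIV" for y
      using that by (cases y) (auto simp: cot_chart_inv[OF c(1)])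
    have ev: "\<forall>\<^sub>F y in mnhds euclid x. fst (chart_inv ?C y) = chart_inv c (fst y)"
      unfolding mnhds_euclid using eventually_nhds_in_open[OF op x] by eventually_elim (rule fst_inv)
    have fx: "mdiff euclid euclid fst x" "tan_at euclid euclid fst x = fst"
      by (rule mdiff_euclidI tan_at_euclid, rule has_derivative_fst[OF has_derivative_ident])+
    have "tan_at ?M Q fst ?z (tan_at euclid ?M (chart_inv ?C) x w) = tan_at euclid Q (\<lambda>y. fst (chart_inv ?C y)) x w"
      by (rule mdiff_compose(2)[OF diff_atlas_euclid diff_atlas_cotangent dC mdiff_cotangent_fst(1)[OF zM], symmetric])
    also have "\<dots> = tan_at euclid Q (\<lambda>y. chart_inv c (fst y)) x w"
      using mdiff_cong(2)[OF diff_atlas_euclid Q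
          mdiff_compose(1)[OF diff_atlas_euclid diff_atlas_cotangent dC mdiff_cotangent_fst(1)[OF zM]] ev] by simp
    also have "\<dots> = tan_at euclid Q (chart_inv c) (fst x) (fst w)"
      using mdiff_compose(2)[OF diff_atlas_euclid diff_atlas_euclid fx(1) mdiff_chart_inv[OF Q c(1) x1]] fx(2) by simp
    finally have "?\<theta> x w = snd ?z \<bullet> tan_at euclid Q (chart_inv c) (fst x) (fst w)"
      by (simp add: pullback1_def tautological_form_def)
    \<comment> \<open>Moving the tangent map across the inner product produces exactly the fibre
      coordinate of the bundle chart, which is \<open>snd x\<close>.\<close>
    also have "\<dots> = fst w \<bullet> adjoint (tan_at euclid Q (chart_inv c) (fst x)) (snd ?z)"
      using adjoint_inner[OF linear_tan_at[OF mdiff_chart_inv[OF Q c(1) x1]]] by (simp add: inner_commute)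
    also have "adjoint (tan_at euclid Q (chart_inv c) (fst x)) (snd ?z) = snd x"
    proof -
      have "snd ?C ?z = x" by (rule chart_chart_inv[OF xC])
      moreover have "?z = (chart_inv c (fst x), snd ?z)" using fst_inv[OF x] by (metis prod.collapse)
      ultimately have "snd ?C (chart_inv c (fst x), snd ?z) = x" by simp
      then show ?thesis unfolding cot_chart_simps chart_chart_inv[OF x1] by (metis snd_conv)
    qed
    finally show ?thesis .
  qed
  have "frechet_derivative (\<lambda>x. ?\<theta> x w) (at ?x0) = (\<lambda>v. fst w \<bullet> snd v)" for w
  proof (rule frechet_derivative_at[symmetric], rule has_derivative_transform_nhds)
    show "((\<lambda>x. fst w \<bullet> snd x) has_derivative (\<lambda>v. fst w \<bullet> snd v)) (at ?x0)"
      by (rule has_derivative_inner_right[OF has_derivative_snd[OF has_derivative_ident]])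
    show "\<forall>\<^sub>F x in nhds ?x0. fst w \<bullet> snd x = ?\<theta> x w"
      using eventually_nhds_in_open[OF op x0] by eventually_elim (simp only: \<theta>)
  qed
  then show ?thesis by (simp add: canonical_form_def ext_deriv1_def C(1) Let_def)
qed

lemma canonical_form_nondegenerate:
  assumes z: "z \<in> mcarrier (cotangent Q)" and eq: "\<And>w. canonical_form Q z u w = canonical_form Q z v w"
  shows "u = v"
proof -
  have "fst u \<bullet> w = fst v \<bullet> w" "w \<bullet> snd u = w \<bullet> snd v" for w
    using eq[of "(0, w)"] eq[of "(w, 0)"] by (simp_all add: canonical_form_eq[OF z])
  then have "fst u = fst v" "snd u = snd v" by (metis vector_eq_rdot, metis vector_eq_ldot)
  then show ?thesis by (rule prod_eqI)
qed

lemma ham_vf_canonical: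
  assumes f: "mdiff (cotangent Q) euclid f z"
  shows "canonical_form Q z (snd (ham_vf (cotangent Q) (canonical_form Q) f z)) v = tan_at (cotangent Q) euclid f z v"
proof -
  note z = mdiff_carrier(1)[OF f]
  let ?F = "tan_at (cotangent Q) euclid f z"
  have lin: "linear (\<lambda>w. ?F (0, w))" "linear (\<lambda>w. ?F (w, 0))"
    using linear_compose[OF _ linear_tan_at[OF f], of "\<lambda>w. (0, w)"]
      linear_compose[OF _ linear_tan_at[OF f], of "\<lambda>w. (w, 0)"]
    by (simp_all add: o_def linear_iff)
  \<comment> \<open>Hamilton's equations: the momentum gradient of \<open>f\<close> and minus its
    position gradient, each written by Riesz in \<open>frame\<close>.\<close>
  define X where "X = ((\<Sum>e\<in>frame. ?F (0, e) *\<^sub>R e), - (\<Sum>e\<in>frame. ?F (e, 0) *\<^sub>R e))"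
  have X: "canonical_form Q z X v = ?F v" for v
  proof -
    have "?F v = ?F ((fst v, 0) + (0, snd v))" by simp
    also have "\<dots> = ?F (fst v, 0) + ?F (0, snd v)" by (rule linear_add[OF linear_tan_at[OF f]])
    also have "\<dots> = canonical_form Q z X v"
      unfolding canonical_form_eq[OF z] X_def
      by (simp add: riesz_finite_dim[OF lin(1), of "snd v"] riesz_finite_dim[OF lin(2), of "fst v"] inner_commute)
    finally show ?thesis by simp
  qed
  have "(THE X. \<forall>v. canonical_form Q z X v = ?F v) = X"
  proof (rule the_equality)
    show "\<forall>v. canonical_form Q z X v = ?F v" using X by blast
    show "Y = X" if "\<forall>v. canonical_form Q z Y v = ?F v" for Y
      by (rule canonical_form_nondegenerate[OF z]) (simp only: X that)
  qed
  then show ?thesis by (simp add: ham_vf_def X)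
qed

text \<open>Splits differentiability into base point and fibre coordinate. The latter is read in one
  fixed chart, that around the base point of \<open>f p\<close>, because \<open>mrep\<close> fixes
  the target chart at \<open>p\<close>.\<close>

lemma mdiff_cotangentI:
  fixes A :: "('a, 'b::finite_dim_inner) mfd"
  assumes f: "mdiff A Q (\<lambda>x. fst (f x)) p"
    and g: "mdiff A euclid (\<lambda>x. adjoint (tan_at euclid Q (chart_inv (chart_at Q (fst (f p))))
        (snd (chart_at Q (fst (f p))) (fst (f x)))) (snd (f x))) p"
  shows "mdiff A (cotangent Q) f p"
proof -
  let ?d = "chart_at Q (fst (f p))" and ?x = "snd (chart_at A p) p"
  have fp: "chart_at (cotangent Q) (f p) = cot_chart Q ?d" by (cases "f p") simp
  have "mrep A (cotangent Q) f p = (\<lambda>x. (mrep A Q (\<lambda>x. fst (f x)) p x,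
      mrep A euclid (\<lambda>x. adjoint (tan_at euclid Q (chart_inv ?d) (snd ?d (fst (f x)))) (snd (f x))) p x))"
    by (rule ext) (simp add: mrep_def fp cot_chart_def case_prod_beta)
  with has_derivative_Pair[OF mrep_has_derivative[OF f] mrep_has_derivative[OF g]]
  have "mrep A (cotangent Q) f p differentiable (at ?x)" by (auto simp: differentiable_def)
  moreover have "\<forall>\<^sub>F q in mnhds A p. f q \<in> fst (chart_at (cotangent Q) (f p))"
    using f unfolding mdiff_def fp by (elim conjE eventually_mono) (auto simp: mem_Times_iff)
  ultimately show ?thesis using f by (auto simp: mdiff_def mem_Times_iff)
qed

lemma mdiff_cotangent_fibre:
  assumes z: "z \<in> mcarrier (cotangent Q)"
  defines "c \<equiv> chart_at Q (fst z)"
  shows "mdiff (cotangent Q) euclid (\<lambda>w. adjoint (tan_at euclid Q (chart_inv c) (snd c (fst w))) (snd w)) z"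
proof -
  let ?C = "cot_chart Q c" and ?M = "cotangent Q"
  have q: "fst z \<in> mcarrier Q" using z by auto
  have c: "c \<in> atlas Q" "fst z \<in> fst c" using chart_at_atlas[OF Q q] chart_at_domain[OF Q q] by (simp_all add: c_def)
  have "mdiff ?M euclid (snd ?C) z"
    by (rule mdiff_chart[OF diff_atlas_cotangent]) (use c in \<open>auto simp: mem_Times_iff\<close>)
  from mdiff_compose(1)[OF diff_atlas_cotangent diff_atlas_euclid this
      mdiff_euclidI[OF has_derivative_snd[OF has_derivative_ident]]]
  show ?thesis by (simp add: cot_chart_def case_prod_beta)
qed

end

section \<open>The cotangent lifted action\<close>

declare cotangent_simps(3) [simp del]

lemma mcarrier_cotangent_iff: "z \<in> mcarrier (cotangent Q) \<longleftrightarrow> fst z \<in> mcarrier Q"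
  by (cases z) (simp add: cotangent_simps(3))

lemma cot_lift_sel:
  "fst (cot_lift G Q act g z) = act g (fst z)"
  "snd (cot_lift G Q act g z) = adjoint (tan_at Q Q (act (inv\<^bsub>G\<^esub> g)) (act g (fst z))) (snd z)"
  by (simp_all add: cot_lift_def case_prod_beta)

locale cotangent_action = cotangent_bundle Q
  for Q :: "('q, 'e::finite_dim_inner) mfd" +
  fixes G :: "'g monoid" and L :: "('g, 'k::finite_dim_inner) mfd" and act :: "'g \<Rightarrow> 'q \<Rightarrow> 'q"
  assumes lie_group: "lie_group G L" and lie_action: "lie_action G L Q act"
begin

sublocale group G using lie_group by (simp add: lie_group_def)

abbreviation "M \<equiv> cotangent Q"
abbreviation "lift \<equiv> cot_lift G Q act"

lemmas M = diff_atlas_cotangent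

lemma L: "diff_atlas L" and carrier_L [simp]: "mcarrier L = carrier G"
  using lie_group manifold_diff_atlas by (auto simp: lie_group_def)

lemma mdiff_mult:
  fixes A :: "('a, 'b::finite_dim_inner) mfd"
  assumes A: "diff_atlas A" and f: "mdiff A L f p" and h: "mdiff A L h p"
  shows "mdiff A L (\<lambda>x. f x \<otimes>\<^bsub>G\<^esub> h x) p"
proof -
  note fh = mdiff_carrier(2)[OF f] mdiff_carrier(2)[OF h]
  have "mdiff (prod_mfd L L) L (\<lambda>(g, h). g \<otimes>\<^bsub>G\<^esub> h) (f p, h p)"
    using lie_group fh by (intro smooth_map_mdiff diff_atlas_prod L) (simp_all add: lie_group_def)
  from mdiff_compose(1)[OF A diff_atlas_prod[OF L L] mdiff_Pair(1)[OF L L f h] this]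
  show ?thesis by simp
qed

lemma mdiff_inv: "g \<in> carrier G \<Longrightarrow> mdiff L L (\<lambda>g. inv\<^bsub>G\<^esub> g) g"
  using lie_group by (intro smooth_map_mdiff L) (simp_all add: lie_group_def)

lemma act_smooth: "smooth_map (prod_mfd L Q) Q (\<lambda>(g, x). act g x)"
  using lie_action by (simp add: lie_action_def)

lemma act_closed [simp]: "g \<in> carrier G \<Longrightarrow> q \<in> mcarrier Q \<Longrightarrow> act g q \<in> mcarrier Q"
  using act_smooth by (auto simp: smooth_map_def)

lemma act_one [simp]: "q \<in> mcarrier Q \<Longrightarrow> act \<one>\<^bsub>G\<^esub> q = q"
  and act_mult: "q \<in> mcarrier Q \<Longrightarrow> g \<in> carrier G \<Longrightarrow> h \<in> carrier G \<Longrightarrow> act (g \<otimes>\<^bsub>G\<^esub> h) q = act g (act h q)"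
  using lie_action by (auto simp: lie_action_def)

lemma act_inv [simp]: "q \<in> mcarrier Q \<Longrightarrow> g \<in> carrier G \<Longrightarrow> act (inv\<^bsub>G\<^esub> g) (act g q) = q"
  by (simp flip: act_mult)

lemma mdiff_act:
  fixes A :: "('a, 'b::finite_dim_inner) mfd"
  assumes A: "diff_atlas A" and f: "mdiff A L f p" and h: "mdiff A Q h p"
  shows "mdiff A Q (\<lambda>x. act (f x) (h x)) p"
proof -
  have "mdiff (prod_mfd L Q) Q (\<lambda>(g, x). act g x) (f p, h p)"
    using mdiff_carrier(2)[OF f] mdiff_carrier(2)[OF h]
    by (intro smooth_map_mdiff[OF diff_atlas_prod[OF L Q] Q act_smooth]) simp
  from mdiff_compose(1)[OF A diff_atlas_prod[OF L Q] mdiff_Pair(1)[OF L Q f h] this]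
  show ?thesis by simp
qed

lemma mdiff_act_point: "g \<in> carrier G \<Longrightarrow> q \<in> mcarrier Q \<Longrightarrow> mdiff Q Q (act g) q"
  using mdiff_act[OF Q mdiff_const(1)[OF Q L] mdiff_id(1)[OF Q]] by simp

lemma lift_closed [simp]: "g \<in> carrier G \<Longrightarrow> z \<in> mcarrier M \<Longrightarrow> lift g z \<in> mcarrier M"
  by (simp add: mcarrier_cotangent_iff cot_lift_sel)

text \<open>Inversion reverses products and \<open>adjoint\<close> reverses composition; together
  with the chain rule the two reversals cancel and leave a left action.\<close>

lemma lift_mult:
  assumes z: "z \<in> mcarrier M" and g: "g \<in> carrier G" and h: "h \<in> carrier G"
  shows "lift (h \<otimes>\<^bsub>G\<^esub> g) z = lift h (lift g z)"
proof (rule prod_eqI)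
  have q: "fst z \<in> mcarrier Q" using z by (simp add: mcarrier_cotangent_iff)
  then show "fst (lift (h \<otimes>\<^bsub>G\<^esub> g) z) = fst (lift h (lift g z))" by (simp add: cot_lift_sel act_mult g h)
  let ?y = "act h (act g (fst z))"
  have y: "?y \<in> mcarrier Q" using q g h by simp
  have ret: "act (inv\<^bsub>G\<^esub> h) ?y = act g (fst z)" using q g h by simp
  let ?T = "tan_at Q Q (act (inv\<^bsub>G\<^esub> h)) ?y" and ?U = "tan_at Q Q (act (inv\<^bsub>G\<^esub> g)) (act g (fst z))"
  have dh: "mdiff Q Q (act (inv\<^bsub>G\<^esub> h)) ?y" by (rule mdiff_act_point[OF inv_closed[OF h] y])
  have dg: "mdiff Q Q (act (inv\<^bsub>G\<^esub> g)) (act (inv\<^bsub>G\<^esub> h) ?y)"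
    unfolding ret using g q by (intro mdiff_act_point inv_closed act_closed)
  \<comment> \<open>The action laws are known on the carrier only, so the functions are compared
    near \<open>?y\<close> rather than everywhere.\<close>
  have "\<forall>\<^sub>F x in mnhds Q ?y. act (inv\<^bsub>G\<^esub> g) (act (inv\<^bsub>G\<^esub> h) x) = act (inv\<^bsub>G\<^esub> (h \<otimes>\<^bsub>G\<^esub> g)) x"
    by (rule mnhds_mono[OF Q y]) (simp add: g h inv_mult_group act_mult)
  from mdiff_cong(2)[OF Q Q mdiff_compose(1)[OF Q Q dh dg] this]
  have "tan_at Q Q (act (inv\<^bsub>G\<^esub> (h \<otimes>\<^bsub>G\<^esub> g))) ?y = ?U \<circ> ?T"
    by (simp add: fun_eq_iff mdiff_compose(2)[OF Q Q dh dg] ret)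
  moreover have "linear ?T" "linear ?U" using linear_tan_at[OF dh] linear_tan_at[OF dg] ret by simp_all
  ultimately show "snd (lift (h \<otimes>\<^bsub>G\<^esub> g) z) = snd (lift h (lift g z))"
    by (simp add: cot_lift_sel act_mult g h q adjoint_comp)
qed

lemma lift_one [simp]:
  assumes z: "z \<in> mcarrier M"
  shows "lift \<one>\<^bsub>G\<^esub> z = z"
proof (rule prod_eqI)
  have q: "fst z \<in> mcarrier Q" using z by (simp add: mcarrier_cotangent_iff)
  then show "fst (lift \<one>\<^bsub>G\<^esub> z) = fst z" by (simp add: cot_lift_sel)
  have "\<forall>\<^sub>F x in mnhds Q (fst z). x = act \<one>\<^bsub>G\<^esub> x" by (rule mnhds_mono[OF Q q]) simp
  from mdiff_cong(2)[OF Q Q mdiff_id(1)[OF Q q] this]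
  have "tan_at Q Q (act \<one>\<^bsub>G\<^esub>) (fst z) = (\<lambda>v. v)" by (simp add: fun_eq_iff mdiff_id(2)[OF Q q])
  then show "snd (lift \<one>\<^bsub>G\<^esub> z) = snd z" by (simp add: cot_lift_sel q)
qed

lemma lift_inv [simp]:
  assumes "z \<in> mcarrier M" "g \<in> carrier G"
  shows "lift (inv\<^bsub>G\<^esub> g) (lift g z) = z" "lift g (lift (inv\<^bsub>G\<^esub> g) z) = z"
  using assms lift_mult[OF assms(1), of g "inv\<^bsub>G\<^esub> g"] lift_mult[OF assms(1), of "inv\<^bsub>G\<^esub> g" g] by simp_all

text \<open>In bundle charts the fibre component of the lift is the adjoint of a partial derivative of the
  action map, so joint differentiability of the lift comes from second derivatives of the action.\<close>

lemma mdiff_lift_joint: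
  assumes g0: "g0 \<in> carrier G" and z0: "z0 \<in> mcarrier M"
  shows "mdiff (prod_mfd L M) M (\<lambda>w. lift (fst w) (snd w)) (g0, z0)"
proof -
  let ?P = "prod_mfd L M" and ?p = "(g0, z0)"
  define q0 where "q0 = fst z0"
  define y0 where "y0 = act g0 q0"
  define c d l where "c = chart_at Q q0" and "d = chart_at Q y0" and "l = chart_at L (inv\<^bsub>G\<^esub> g0)"
  have q0: "q0 \<in> mcarrier Q" using z0 by (simp add: q0_def mcarrier_cotangent_iff)
  have y0: "y0 \<in> mcarrier Q" using q0 g0 by (simp add: y0_def)
  have ig: "inv\<^bsub>G\<^esub> g0 \<in> mcarrier L" using g0 by simp
  have P: "diff_atlas ?P" by (rule diff_atlas_prod[OF L M])
  have pP: "?p \<in> mcarrier ?P" using g0 z0 by simp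
  have c: "c \<in> atlas Q" "q0 \<in> fst c" using chart_at_atlas[OF Q q0] chart_at_domain[OF Q q0] by (simp_all add: c_def)
  have d: "d \<in> atlas Q" "y0 \<in> fst d" using chart_at_atlas[OF Q y0] chart_at_domain[OF Q y0] by (simp_all add: d_def)
  have l: "l \<in> atlas L" "inv\<^bsub>G\<^esub> g0 \<in> fst l" using chart_at_atlas[OF L ig] chart_at_domain[OF L ig] by (simp_all add: l_def)
  \<comment> \<open>The lift differentiates the action of the inverse of \<open>g\<close> at
    \<open>act g q\<close>, so the action is read in charts around the inverse of \<open>g0\<close>
    and \<open>y0\<close> rather than around \<open>g0\<close> and \<open>q0\<close>.\<close>
  define F where "F = mrep (prod_mfd L Q) Q (\<lambda>(g, x). act g x) (inv\<^bsub>G\<^esub> g0, y0)"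
  obtain S where S: "open S" "(snd l (inv\<^bsub>G\<^esub> g0), snd d y0) \<in> S" "smooth_on S F"
  proof (rule smooth_map_mrep[OF diff_atlas_prod[OF L Q] Q act_smooth, of "(inv\<^bsub>G\<^esub> g0, y0)"])
    show "(inv\<^bsub>G\<^esub> g0, y0) \<in> mcarrier (prod_mfd L Q)" using ig y0 by simp
  qed (auto simp: F_def l_def d_def intro: that)
  have Feq: "F (s, y) = snd c (act (chart_inv l s) (chart_inv d y))"
    if "s \<in> snd l ` fst l" "y \<in> snd d ` fst d" for s y
    using that g0 q0
    by (simp add: F_def mrep_def chart_inv_prod chart_inj[OF L l(1)] chart_inj[OF Q d(1)]
        flip: l_def d_def) (simp add: y0_def c_def)

  have m1: "mdiff ?P L fst ?p" and m2: "mdiff ?P M snd ?p"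
    using mdiff_fst_snd[OF L M, of g0 z0] g0 z0 by auto
  have mq: "mdiff ?P Q (\<lambda>w. fst (snd w)) ?p"
    using mdiff_compose(1)[OF P M m2, of Q fst] mdiff_cotangent_fst(1)[OF z0] by simp
  have my: "mdiff ?P Q (\<lambda>w. act (fst w) (fst (snd w))) ?p" by (rule mdiff_act[OF P m1 mq])
  have mi: "mdiff ?P L (\<lambda>w. inv\<^bsub>G\<^esub> (fst w)) ?p"
    using mdiff_compose(1)[OF P L m1, of L "\<lambda>g. inv\<^bsub>G\<^esub> g"] mdiff_inv[OF g0] by simp
  \<comment> \<open>\<open>\<sigma>\<close> gives the coordinates of the point at which the action
    is differentiated, and \<open>b\<close> the fibre coordinate of the covector in the chart
    \<open>c\<close>.\<close>
  define \<sigma> where "\<sigma> w = (snd l (inv\<^bsub>G\<^esub> (fst w)), snd d (act (fst w) (fst (snd w))))" for w :: "'g \<times> 'q \<times> 'e"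
  define b where "b w = adjoint (tan_at euclid Q (chart_inv c) (snd c (fst (snd w)))) (snd (snd w))"
    for w :: "'g \<times> 'q \<times> 'e"
  have \<sigma>S: "\<sigma> ?p \<in> S" using S(2) by (simp add: \<sigma>_def y0_def q0_def)
  have m\<sigma>: "mdiff ?P euclid \<sigma> ?p"
    unfolding \<sigma>_def
  proof (rule mdiff_to_euclid_Pair)
    show "mdiff ?P euclid (\<lambda>w. snd l (inv\<^bsub>G\<^esub> (fst w))) ?p"
      using mdiff_compose(1)[OF P L mi, of euclid "snd l"] mdiff_chart[OF L l] by simp
    show "mdiff ?P euclid (\<lambda>w. snd d (act (fst w) (fst (snd w)))) ?p"
      using mdiff_compose(1)[OF P Q my, of euclid "snd d"] mdiff_chart[OF Q d] by (simp add: y0_def q0_def)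
  qed
  have mb: "mdiff ?P euclid b ?p"
    unfolding b_def c_def q0_def
    using mdiff_compose(1)[OF P M m2, of euclid, OF mdiff_cotangent_fibre] z0 by simp
  \<comment> \<open>The adjoint of the partial derivative of \<open>F\<close> in its second
    argument, in the form of \<open>adjoint_frame\<close>; the aim is to identify it with the fibre
    coordinate of the lift.\<close>
  let ?rhs = "\<lambda>w. \<Sum>e\<in>frame. (frechet_derivative F (at (\<sigma> w)) (0, e) \<bullet> b w) *\<^sub>R e"
  have mr: "mdiff ?P euclid ?rhs ?p"
  proof (rule mdiff_to_euclid_sum_inner_scaleR[OF _ mb])
    fix e :: 'e
    obtain D where "((\<lambda>x. frechet_derivative F (at x) (0, e)) has_derivative D) (at (\<sigma> ?p))"
      using smooth_on_differentiable_derivative[OF S(3) \<sigma>S] by (auto simp: differentiable_def)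
    from mdiff_compose(1)[OF P diff_atlas_euclid m\<sigma> mdiff_euclidI[OF this]]
    show "mdiff ?P euclid (\<lambda>w. frechet_derivative F (at (\<sigma> w)) (0, e)) ?p" .
  qed
  have ev: "\<forall>\<^sub>F w in mnhds ?P ?p. w \<in> mcarrier ?P" "\<forall>\<^sub>F w in mnhds ?P ?p. inv\<^bsub>G\<^esub> (fst w) \<in> fst l"
    "\<forall>\<^sub>F w in mnhds ?P ?p. fst (snd w) \<in> fst c" "\<forall>\<^sub>F w in mnhds ?P ?p. act (fst w) (fst (snd w)) \<in> fst d"
    "\<forall>\<^sub>F w in mnhds ?P ?p. \<sigma> w \<in> S"
  proof -
    show "\<forall>\<^sub>F w in mnhds ?P ?p. w \<in> mcarrier ?P" by (rule mnhds_carrier[OF P pP])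
    show "\<forall>\<^sub>F w in mnhds ?P ?p. inv\<^bsub>G\<^esub> (fst w) \<in> fst l" "\<forall>\<^sub>F w in mnhds ?P ?p. fst (snd w) \<in> fst c"
      "\<forall>\<^sub>F w in mnhds ?P ?p. act (fst w) (fst (snd w)) \<in> fst d"
      using mi mq my by (simp_all add: mdiff_def l_def c_def d_def y0_def q0_def)
    have "filterlim \<sigma> (nhds (\<sigma> ?p)) (mnhds ?P ?p)"
      using mdiff_filterlim[OF diff_atlas_euclid P m\<sigma>] by simp
    then show "\<forall>\<^sub>F w in mnhds ?P ?p. \<sigma> w \<in> S"
      unfolding filterlim_iff using eventually_nhds_in_open[OF S(1) \<sigma>S] by blast
  qed
  have "\<forall>\<^sub>F w in mnhds ?P ?p. ?rhs w =
      adjoint (tan_at euclid Q (chart_inv d) (snd d (fst (lift (fst w) (snd w))))) (snd (lift (fst w) (snd w)))"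
    using ev
  proof eventually_elim
    case (elim w)
    obtain g q a where w: "w = (g, q, a)" by (cases w)
    have g: "g \<in> carrier G" and q: "q \<in> mcarrier Q"
      using elim(1) by (simp_all add: w mcarrier_cotangent_iff)
    have il: "inv\<^bsub>G\<^esub> g \<in> fst l" and qc: "q \<in> fst c" and yd: "act g q \<in> fst d" using elim(2-4) by (simp_all add: w)
    define s y where "s = snd l (inv\<^bsub>G\<^esub> g)" and "y = snd d (act g q)"
    have sy: "\<sigma> w = (s, y)" by (simp add: \<sigma>_def w s_def y_def)
    have s: "s \<in> snd l ` fst l" "chart_inv l s = inv\<^bsub>G\<^esub> g" using il by (simp_all add: s_def chart_inv_chart[OF L l(1)])
    have y: "y \<in> snd d ` fst d" "chart_inv d y = act g q" using yd by (simp_all add: y_def chart_inv_chart[OF Q d(1)])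
    let ?Td = "tan_at euclid Q (chart_inv d) y" and ?Ta = "tan_at Q Q (act (inv\<^bsub>G\<^esub> g)) (act g q)"
      and ?Tc = "tan_at Q euclid (snd c) q"
    have md: "mdiff euclid Q (chart_inv d) y" by (rule mdiff_chart_inv[OF Q d(1) y(1)])
    have ma: "mdiff Q Q (act (inv\<^bsub>G\<^esub> g)) (chart_inv d y)" using g q by (simp add: y(2) mdiff_act_point)
    have mc: "mdiff Q euclid (snd c) (act (inv\<^bsub>G\<^esub> g) (chart_inv d y))"
      using mdiff_chart[OF Q c(1) qc] g q by (simp add: y(2))
    note mda = mdiff_compose[OF diff_atlas_euclid Q md ma]
    note mk = mdiff_compose[OF diff_atlas_euclid Q mda(1) mc]
    let ?k = "\<lambda>y'. snd c (act (inv\<^bsub>G\<^esub> g) (chart_inv d y'))"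
    have tk: "tan_at euclid euclid ?k y = ?Tc \<circ> (?Ta \<circ> ?Td)"
      using g q by (simp add: fun_eq_iff mk(2) mda(2) y(2))
    have "(?k has_derivative tan_at euclid euclid ?k y) (at y)"
      using mrep_has_derivative[OF mk(1)] by (simp add: mrep_def o_def)
    moreover have "\<forall>\<^sub>F y' in nhds y. ?k y' = F (s, y')"
      using eventually_nhds_in_open[OF chart_open[OF Q d(1)] y(1)]
      by eventually_elim (simp add: Feq s)
    ultimately have "((\<lambda>y'. F (s, y')) has_derivative ?Tc \<circ> (?Ta \<circ> ?Td)) (at y)"
      unfolding tk by (rule has_derivative_transform_nhds)
    \<comment> \<open>The same slice of \<open>F\<close>, now differentiated through the joint
      derivative; uniqueness of derivatives identifies this with the composite of tangent
      maps.\<close>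
    moreover have "((\<lambda>y'. F (s, y')) has_derivative (\<lambda>e. frechet_derivative F (at (s, y)) (0, e))) (at y)"
    proof (rule has_derivative_compose[where f="\<lambda>y'. (s, y')"])
      show "((\<lambda>y'. (s, y')) has_derivative (\<lambda>e. (0, e))) (at y)"
        by (rule has_derivative_Pair[OF has_derivative_const has_derivative_ident])
      show "(F has_derivative frechet_derivative F (at (s, y))) (at (s, y))"
        using smooth_on_differentiable[OF S(3)] elim(5) by (simp add: sy frechet_derivative_works)
    qed
    ultimately have DF: "frechet_derivative F (at (s, y)) (0, e) = (?Tc \<circ> (?Ta \<circ> ?Td)) e" for e
      by (metis has_derivative_unique)
    have lin: "linear ?Td" "linear ?Ta" "linear ?Tc"
      using linear_tan_at[OF md] linear_tan_at[OF ma] linear_tan_at[OF mc] g q by (simp_all add: y(2))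
    have lin': "linear (?Ta \<circ> ?Td)" by (rule linear_compose[OF lin(1,2)])
    have "?rhs w = (\<Sum>e\<in>frame. ((?Tc \<circ> (?Ta \<circ> ?Td)) e \<bullet> b w) *\<^sub>R e)" by (simp only: sy DF)
    also have "\<dots> = adjoint (?Tc \<circ> (?Ta \<circ> ?Td)) (b w)"
      by (rule adjoint_frame[OF linear_compose[OF lin' lin(3)], symmetric])
    also have "\<dots> = adjoint ?Td (adjoint ?Ta (adjoint ?Tc (b w)))"
      by (simp only: adjoint_comp[OF lin' lin(3)] adjoint_comp[OF lin(1,2)])
    also have "adjoint ?Tc (b w) = a"
      using adjoint_chart_chart_inv(1)[OF c(1) qc, of a] by (simp add: b_def w)
    finally show ?case by (simp add: w cot_lift_sel y_def)
  qed
  from mdiff_cong(1)[OF P diff_atlas_euclid mr this]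
  show ?thesis
    by (intro mdiff_cotangentI) (use my in \<open>simp_all add: cot_lift_sel d_def y0_def q0_def\<close>)
qed

lemma mdiff_lift:
  fixes A :: "('a, 'b::finite_dim_inner) mfd"
  assumes A: "diff_atlas A" and f: "mdiff A L f p" and h: "mdiff A M h p"
  shows "mdiff A M (\<lambda>x. lift (f x) (h x)) p"
proof -
  have "mdiff (prod_mfd L M) M (\<lambda>w. lift (fst w) (snd w)) (f p, h p)"
    using mdiff_carrier(2)[OF f] mdiff_carrier(2)[OF h] by (intro mdiff_lift_joint) simp_all
  from mdiff_compose(1)[OF A diff_atlas_prod[OF L M] mdiff_Pair(1)[OF L M f h] this]
  show ?thesis by simp
qed

lemma mdiff_lift_point: "g \<in> carrier G \<Longrightarrow> z \<in> mcarrier M \<Longrightarrow> mdiff M M (lift g) z"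
  using mdiff_lift[OF M mdiff_const(1)[OF M L] mdiff_id(1)[OF M]] by simp

lemma surj_tan_lift:
  assumes g: "g \<in> carrier G" and z: "z \<in> mcarrier M"
  shows "surj (tan_at M M (lift g) z)"
proof -
  let ?z = "lift g z"
  have z': "?z \<in> mcarrier M" "lift (inv\<^bsub>G\<^esub> g) ?z = z" using g z by simp_all
  have d1: "mdiff M M (lift (inv\<^bsub>G\<^esub> g)) ?z" by (rule mdiff_lift_point[OF inv_closed[OF g] z'(1)])
  have d2: "mdiff M M (lift g) (lift (inv\<^bsub>G\<^esub> g) ?z)" unfolding z'(2) by (rule mdiff_lift_point[OF g z])
  have "\<forall>\<^sub>F x in mnhds M ?z. x = lift g (lift (inv\<^bsub>G\<^esub> g) x)"
    by (rule mnhds_mono[OF M z'(1)]) (simp add: g)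
  from mdiff_cong(2)[OF M M mdiff_id(1)[OF M z'(1)] this]
  have "tan_at M M (lift g) z (tan_at M M (lift (inv\<^bsub>G\<^esub> g)) ?z v) = v" for v
    using mdiff_compose(2)[OF M M d1 d2, of v] by (simp add: z'(2) mdiff_id(2)[OF M z'(1)])
  then show ?thesis by (metis surjI)
qed

lemma linear_Ad:
  assumes g: "g \<in> carrier G"
  shows "linear (Ad G L g)"
proof -
  have "mdiff L L (\<lambda>h. g \<otimes>\<^bsub>G\<^esub> h \<otimes>\<^bsub>G\<^esub> inv\<^bsub>G\<^esub> g) \<one>\<^bsub>G\<^esub>"
    using g by (intro mdiff_mult[OF L] mdiff_const(1)[OF L L] mdiff_id(1)[OF L]) simp_all
  from linear_tan_at[OF this] show ?thesis by (simp add: Ad_def)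
qed

lemma linear_coadjoint: "g \<in> carrier G \<Longrightarrow> linear (coadjoint G L g)"
  unfolding coadjoint_def by (rule linear_adjoint[OF linear_Ad[OF inv_closed]])

end

section \<open>Momentum maps: Noether's theorem and regularity along the orbit\<close>

locale momentum = cotangent_action Q G L act
  for Q :: "('q, 'e::finite_dim_inner) mfd" and G :: "'g monoid" and L :: "('g, 'k::finite_dim_inner) mfd"
    and act +
  fixes J :: "'q \<times> 'e \<Rightarrow> 'k"
  assumes momentum_map: "momentum_map G L Q act J"
begin

lemma mdiff_J: "z \<in> mcarrier M \<Longrightarrow> mdiff M euclid J z"
  using momentum_map by (intro smooth_map_mdiff[OF M diff_atlas_euclid]) (simp_all add: momentum_map_def)

lemma J_equivariant: "g \<in> carrier G \<Longrightarrow> z \<in> mcarrier M \<Longrightarrow> J (lift g z) = coadjoint G L g (J z)"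
  using momentum_map unfolding momentum_map_def by blast

lemma momentum_tan:
  assumes z: "z \<in> mcarrier M"
  shows "canonical_form Q z (inf_gen G L M lift \<xi> z) v = tan_at M euclid J z v \<bullet> \<xi>"
proof -
  have *: "((\<lambda>x. x \<bullet> \<xi>) has_derivative (\<lambda>x. x \<bullet> \<xi>)) (at (J z))"
    by (rule has_derivative_inner_left[OF has_derivative_ident])
  have "tan_at M euclid (\<lambda>z. J z \<bullet> \<xi>) z v = tan_at M euclid J z v \<bullet> \<xi>"
    using mdiff_compose(2)[OF M diff_atlas_euclid mdiff_J[OF z] mdiff_euclidI[OF *]]
    by (simp add: tan_at_euclid[OF *])
  moreover have "\<forall>z\<in>mcarrier M. \<forall>\<xi> v. canonical_form Q z (inf_gen G L M lift \<xi> z) v =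
      tan_at M euclid (\<lambda>z. J z \<bullet> \<xi>) z v"
    using momentum_map unfolding momentum_map_def by (elim conjE)
  note this[rule_format, OF z, of \<xi> v]
  ultimately show ?thesis by simp
qed

text \<open>\<open>H\<close> is constant along group orbits, so \<open>dH\<close> kills the
  infinitesimal generators: the canonical form vanishes on \<open>X_H\<close> and each generator.
  Read with the arguments exchanged, the momentum map condition says that the derivative of
  \<open>J \<bullet> \<xi>\<close> along \<open>X_H\<close> vanishes.\<close>

theorem noether:
  assumes H: "\<And>z. z \<in> mcarrier M \<Longrightarrow> mdiff M euclid H z"
    and inv: "\<And>g z. g \<in> carrier G \<Longrightarrow> z \<in> mcarrier M \<Longrightarrow> H (lift g z) = H z"
    and z: "z \<in> mcarrier M"
  shows "tan_at M euclid J z (snd (ham_vf M (canonical_form Q) H z)) = 0"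
proof -
  let ?X = "snd (ham_vf M (canonical_form Q) H z)"
  have "tan_at M euclid J z ?X \<bullet> \<xi> = 0" for \<xi>
  proof -
    let ?u = "inf_gen G L M lift \<xi> z"
    have one: "\<one>\<^bsub>G\<^esub> \<in> mcarrier L" by simp
    have orb: "mdiff L M (\<lambda>g. lift g z) \<one>\<^bsub>G\<^esub>"
      by (rule mdiff_lift[OF L mdiff_id(1)[OF L one] mdiff_const(1)[OF L M one z]])
    have "\<forall>\<^sub>F g in mnhds L \<one>\<^bsub>G\<^esub>. H z = H (lift g z)"
      by (rule mnhds_mono[OF L one]) (simp add: inv z)
    from mdiff_cong(2)[OF L diff_atlas_euclid mdiff_const(1)[OF L diff_atlas_euclid one] this]
    have "tan_at L euclid (\<lambda>g. H (lift g z)) \<one>\<^bsub>G\<^esub> \<xi> = 0"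
      by (simp add: mdiff_const(2)[OF L diff_atlas_euclid one])
    then have "tan_at M euclid H z ?u = 0"
      using mdiff_compose(2)[OF L M orb, of euclid H] H z by (simp add: inf_gen_def)
    then have "canonical_form Q z ?X ?u = 0" by (simp add: ham_vf_canonical[OF H[OF z]])
    then have "canonical_form Q z ?u ?X = 0" by (simp add: canonical_form_eq[OF z])
    then show "tan_at M euclid J z ?X \<bullet> \<xi> = 0" by (simp add: momentum_tan[OF z])
  qed
  from this[of "tan_at M euclid J z ?X"] show ?thesis by simp
qed

text \<open>Translating \<open>z\<close> back by the inverse group element lands in the fibre over
  \<open>\<mu>\<close>, where the derivative of \<open>J\<close> is onto. Equivariance relates the
  two derivatives by an invertible linear map.\<close>

lemma regular_along_orbit:
  assumes reg: "regular_value M euclid J \<mu>" and z0: "z0 \<in> mcarrier M" "J z0 = \<mu>"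
    and z: "z \<in> mcarrier M" "J z \<in> orbit G (coadjoint G L) \<mu>"
  shows "surj (tan_at M euclid J z)"
proof -
  obtain g where g: "g \<in> carrier G" "J z = coadjoint G L g \<mu>" using z(2) by (auto simp: orbit_def)
  let ?i = "inv\<^bsub>G\<^esub> g"
  let ?y = "lift ?i z"
  have i: "?i \<in> carrier G" using g by simp
  have y: "?y \<in> mcarrier M" using i z by simp
  \<comment> \<open>The point \<open>z0\<close> over \<open>\<mu>\<close> lets \<open>J z\<close> be
    written as \<open>J (lift g z0)\<close>. The composition law is then used for the lift, and
    equivariance carries it to the dual of the Lie algebra.\<close>
  have "J ?y = coadjoint G L ?i (J (lift g z0))"
    using z0 g i z by (simp add: J_equivariant)
  also have "\<dots> = J (lift ?i (lift g z0))" by (rule J_equivariant[symmetric]) (use i g z0 in auto)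
  also have "\<dots> = \<mu>" using g z0 by simp
  finally have "surj (tan_at M euclid J ?y)" using reg y by (simp add: regular_value_def)
  then have *: "surj (\<lambda>v. tan_at M euclid J ?y (tan_at M M (lift ?i) z v))"
    using comp_surj[OF surj_tan_lift[OF i z(1)]] by (simp add: o_def)
  have lin: "linear (coadjoint G L ?i)" by (rule linear_coadjoint[OF i])
  have hd: "(coadjoint G L ?i has_derivative coadjoint G L ?i) (at (J z))"
    by (rule bounded_linear_imp_has_derivative[OF linear_imp_bounded_linear[OF lin]])
  have "\<forall>\<^sub>F x in mnhds M z. J (lift ?i x) = coadjoint G L ?i (J x)"
    by (rule mnhds_mono[OF M z(1)]) (rule J_equivariant[OF i])
  from mdiff_cong(2)[OF M diff_atlas_euclid
      mdiff_compose(1)[OF M M mdiff_lift_point[OF i z(1)] mdiff_J[OF y]] this]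
  have eq: "coadjoint G L ?i (tan_at M euclid J z v) = tan_at M euclid J ?y (tan_at M M (lift ?i) z v)" for v
    using mdiff_compose(2)[OF M M mdiff_lift_point[OF i z(1)] mdiff_J[OF y], of v]
      mdiff_compose(2)[OF M diff_atlas_euclid mdiff_J[OF z(1)] mdiff_euclidI[OF hd], of v]
    by (simp add: tan_at_euclid[OF hd])
  \<comment> \<open>Surjectivity of the composite makes the coadjoint map onto, hence injective by
    dimension; it can then be cancelled on the left.\<close>
  have s: "surj (\<lambda>v. coadjoint G L ?i (tan_at M euclid J z v))" using * by (simp only: eq)
  then have "surj (coadjoint G L ?i)" by (auto simp: surj_def)
  then have "inj (coadjoint G L ?i)" using linear_surj_iff_inj_finite_dim[OF lin] by simp
  show ?thesis
  proof (rule surjI[where f="\<lambda>w. SOME v. tan_at M euclid J z v = w"])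
    fix w
    obtain v where "coadjoint G L ?i (tan_at M euclid J z v) = coadjoint G L ?i w"
      using s by (metis surjD)
    then have "tan_at M euclid J z v = w" using \<open>inj (coadjoint G L ?i)\<close> by (simp add: inj_eq)
    then show "tan_at M euclid J z (SOME v. tan_at M euclid J z v = w) = w" by (rule someI)
  qed
qed

end

section \<open>Maps into embedded submanifolds\<close>

text \<open>If \<open>E\<close> is a left inverse of \<open>D\<close>, then
  \<open>E \<circ> K\<close> is the only candidate for the derivative of \<open>n\<close>.
  Continuity of \<open>n\<close> lets the expansion of \<open>\<phi>\<close> be applied at
  \<open>n x\<close>; bounding the increment of \<open>n\<close> by that of \<open>x\<close> closes
  the estimate.\<close>

lemma has_derivative_through_immersion:
  fixes n :: "'a::real_normed_vector \<Rightarrow> 'b::finite_dim_inner" and \<phi> :: "'b \<Rightarrow> 'c::finite_dim_inner"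
  assumes n: "filterlim n (nhds (n x0)) (nhds x0)"
    and \<phi>: "(\<phi> has_derivative D) (at (n x0))" and inj: "inj D"
    and \<psi>: "(\<psi> has_derivative K) (at x0)"
    and eq: "\<forall>\<^sub>F x in nhds x0. \<psi> x = \<phi> (n x)"
  shows "\<exists>N. (n has_derivative N) (at x0)"
proof -
  have linD: "linear D" by (rule has_derivative_linear[OF \<phi>])
  obtain E where E: "linear E" "E \<circ> D = id"
    using linear_injective_left_inverse[OF linD inj] by blast
  have ED: "E (D w) = w" for w using E(2) by (simp add: fun_eq_iff)
  have blE: "bounded_linear E" by (rule linear_imp_bounded_linear[OF E(1)])
  have blK: "bounded_linear K" by (rule has_derivative_bounded_linear[OF \<psi>])
  obtain C where C: "C > 0" "\<And>w. norm (E w) \<le> norm w * C"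
    using bounded_linear.pos_bounded[OF blE] by blast
  obtain C' where C': "C' > 0" "\<And>w. norm (K w) \<le> norm w * C'"
    using bounded_linear.pos_bounded[OF blK] by blast
  \<comment> \<open>For the increments \<open>u\<close> of \<open>n\<close> and \<open>h\<close> of
    \<open>x\<close>, this solves
    \<open>norm u \<le> (norm h + norm u) / 2 + C * C' * norm h\<close> for
    \<open>norm u\<close>.\<close>
  define B where "B = 2 * C * C' + 1"
  have B: "B > 0" using C(1) C'(1) by (simp add: B_def add_pos_pos)
  have \<psi>0: "\<psi> x0 = \<phi> (n x0)" by (rule eventually_nhds_x_imp_x[OF eq])
  have "(n has_derivative (\<lambda>h. E (K h))) (at x0)"
    unfolding has_derivative_at_alt
  proof (intro conjI allI impI)
    show "bounded_linear (\<lambda>h. E (K h))" by (rule bounded_linear_compose[OF blE blK])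
    fix e :: real assume e: "e > 0"
    \<comment> \<open>The first bound lets half of the increment of \<open>n\<close> be absorbed
      into the left side; the second brings the final error below \<open>e\<close>.\<close>
    define \<eta> where "\<eta> = min (1 / (2 * C)) (e / (C * (1 + B)))"
    have \<eta>: "\<eta> > 0" "C * \<eta> \<le> 1/2" "C * \<eta> * (1 + B) \<le> e"
    proof -
      show "\<eta> > 0" using e C(1) B by (simp add: \<eta>_def)
      have "C * \<eta> \<le> C * (1 / (2 * C))" using C(1) by (intro mult_left_mono) (simp_all add: \<eta>_def)
      then show "C * \<eta> \<le> 1/2" using C(1) by simp
      have "(C * (1 + B)) * \<eta> \<le> (C * (1 + B)) * (e / (C * (1 + B)))"
        using C(1) B by (intro mult_left_mono) (simp_all add: \<eta>_def)
      moreover have "C * (1 + B) \<noteq> 0" using C(1) B by simp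
      ultimately show "C * \<eta> * (1 + B) \<le> e" by (simp add: mult.commute mult.left_commute)
    qed
    obtain d1 where d1: "d1 > 0"
      "\<And>y. norm (y - n x0) < d1 \<Longrightarrow> norm (\<phi> y - \<phi> (n x0) - D (y - n x0)) \<le> \<eta> * norm (y - n x0)"
      using \<phi> \<eta>(1) unfolding has_derivative_at_alt by blast
    obtain d2 where d2: "d2 > 0"
      "\<And>x. norm (x - x0) < d2 \<Longrightarrow> norm (\<psi> x - \<psi> x0 - K (x - x0)) \<le> \<eta> * norm (x - x0)"
      using \<psi> \<eta>(1) unfolding has_derivative_at_alt by blast
    have "\<forall>\<^sub>F x in nhds x0. dist (n x) (n x0) < d1"
      using n d1(1) by (rule tendstoD)
    then have "\<forall>\<^sub>F x in nhds x0. dist (n x) (n x0) < d1 \<and> \<psi> x = \<phi> (n x)"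
      using eq by (rule eventually_conj)
    then obtain d3 where d3: "d3 > 0" "\<And>x. dist x x0 < d3 \<Longrightarrow> dist (n x) (n x0) < d1 \<and> \<psi> x = \<phi> (n x)"
      unfolding eventually_nhds_metric by blast
    have "norm (n x - n x0 - E (K (x - x0))) \<le> e * norm (x - x0)" if x: "norm (x - x0) < min d2 d3" for x
    proof -
      let ?u = "n x - n x0" and ?h = "x - x0"
      have nx: "norm ?u < d1" "\<psi> x = \<phi> (n x)" using d3(2)[of x] x by (simp_all add: dist_norm)
      define r1 r2 where "r1 = \<phi> (n x) - \<phi> (n x0) - D ?u" and "r2 = \<psi> x - \<psi> x0 - K ?h"
      have r: "norm r1 \<le> \<eta> * norm ?u" "norm r2 \<le> \<eta> * norm ?h"
        using d1(2)[OF nx(1)] d2(2)[of x] x by (simp_all add: r1_def r2_def)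
      have "D ?u + r1 = K ?h + r2" by (simp add: r1_def r2_def nx(2) \<psi>0)
      then have "E (D ?u) + E r1 = E (K ?h) + E r2" by (simp only: linear_add[OF E(1), symmetric])
      then have main: "?u - E (K ?h) = E r2 - E r1" by (simp add: ED algebra_simps)
      have "norm (E r2 - E r1) \<le> norm r2 * C + norm r1 * C"
        using norm_triangle_ineq4[of "E r2" "E r1"] C(2)[of r1] C(2)[of r2] by linarith
      also have "\<dots> \<le> (\<eta> * norm ?h) * C + (\<eta> * norm ?u) * C"
        using r C(1) by (intro add_mono mult_right_mono) auto
      finally have small: "norm (?u - E (K ?h)) \<le> C * \<eta> * (norm ?h + norm ?u)"
        unfolding main by (simp add: algebra_simps)
      have EK: "norm (E (K ?h)) \<le> C * C' * norm ?h"
        using order_trans[OF C(2)[of "K ?h"] mult_right_mono[OF C'(2)[of ?h], of C]] C(1) by (simp add: mult_ac)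
      have "norm ?u \<le> norm (?u - E (K ?h)) + norm (E (K ?h))"
        by (metis diff_add_cancel norm_triangle_ineq)
      also have "\<dots> \<le> 1/2 * (norm ?h + norm ?u) + C * C' * norm ?h"
        by (intro add_mono order_trans[OF small mult_right_mono[OF \<eta>(2)]] EK) simp
      finally have "norm ?u \<le> B * norm ?h" by (simp add: B_def algebra_simps)
      then have "C * \<eta> * (norm ?h + norm ?u) \<le> C * \<eta> * (norm ?h + B * norm ?h)"
        using C(1) \<eta>(1) by (intro mult_left_mono) auto
      also have "\<dots> = (C * \<eta> * (1 + B)) * norm ?h" by (simp add: algebra_simps)
      also have "\<dots> \<le> e * norm ?h" using \<eta>(3) by (intro mult_right_mono) auto
      finally show ?thesis using small by linarith
    qed
    then show "\<exists>d>0. \<forall>y. norm (y - x0) < d \<longrightarrow> norm (n y - n x0 - E (K (y - x0))) \<le> e * norm (y - x0)"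
      using d2(1) d3(1) by (intro exI[of _ "min d2 d3"]) auto
  qed
  then show ?thesis by blast
qed

text \<open>The embedding topology gives continuity of \<open>f\<close> into \<open>N\<close>, which
  differentiability of \<open>\<iota> \<circ> f\<close> into \<open>P\<close> would not give for a
  mere immersion. The immersion property then upgrades continuity to differentiability in
  charts.\<close>

lemma mdiff_into_embedded:
  fixes A :: "('a, 'e::finite_dim_inner) mfd" and N :: "('b, 'n::finite_dim_inner) mfd"
    and P :: "('c, 'p::finite_dim_inner) mfd"
  assumes A: "diff_atlas A" and N: "diff_atlas N" and P: "diff_atlas P"
    and emb: "smooth_embedding N P \<iota>" and p: "p \<in> mcarrier A"
    and ev: "\<forall>\<^sub>F x in mnhds A p. f x \<in> mcarrier N"
    and F: "mdiff A P (\<lambda>x. \<iota> (f x)) p"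
  shows "mdiff A N f p"
proof -
  let ?y = "f p" and ?x0 = "snd (chart_at A p) p"
  let ?c = "chart_at N ?y"
  have y: "?y \<in> mcarrier N" by (rule mnhds_at[OF A p ev])
  note c = chart_at_atlas[OF N y] chart_at_domain[OF N y]
  have p': "chart_inv (chart_at A p) ?x0 = p"
    by (rule chart_inv_chart[OF A chart_at_atlas[OF A p] chart_at_domain[OF A p]])
  have hom: "homeomorphic_map (mtop N) (subtopology (mtop P) (\<iota> ` mcarrier N)) \<iota>"
    using emb by (simp add: smooth_embedding_def embedding_map_def topspace_mtop[OF N])
  \<comment> \<open>A chart neighbourhood in \<open>N\<close> corresponds to the trace of an open
    set of \<open>P\<close>, because \<open>\<iota>\<close> is a homeomorphism onto its image;
    \<open>\<iota> \<circ> f\<close> eventually lies in that open set.\<close>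
  have cont: "\<forall>\<^sub>F x in mnhds A p. f x \<in> fst ?c \<inter> snd ?c -` W" if W: "open W" "snd ?c ?y \<in> W" for W
  proof -
    let ?U = "fst ?c \<inter> snd ?c -` W"
    have "openin (mtop N) ?U" by (rule openin_chart_domain[OF N c(1) W(1)])
    then have "openin (subtopology (mtop P) (\<iota> ` mcarrier N)) (\<iota> ` ?U)"
      using homeomorphic_imp_open_map[OF hom] by (simp add: open_map_def)
    then obtain V where V: "openin (mtop P) V" "\<iota> ` ?U = V \<inter> \<iota> ` mcarrier N"
      unfolding openin_subtopology by blast
    have "\<iota> ?y \<in> \<iota> ` ?U" using c(2) W(2) by (intro imageI) simp
    then have "\<iota> ?y \<in> V" unfolding V(2) by simp
    from mnhds_open[OF P V(1) this]
    have "\<forall>\<^sub>F x in mnhds A p. \<iota> (f x) \<in> V"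
      using mdiff_filterlim[OF P A F] unfolding filterlim_iff by blast
    with ev show ?thesis
    proof eventually_elim
      case (elim x)
      then have "\<iota> (f x) \<in> \<iota> ` ?U" unfolding V(2) by simp
      then obtain u where "u \<in> ?U" "\<iota> u = \<iota> (f x)" by (elim imageE) simp
      moreover have "inj_on \<iota> (mcarrier N)"
        using homeomorphic_imp_injective_map[OF hom] by (simp add: topspace_mtop[OF N])
      ultimately have "u = f x"
        using elim(1) chart_domain_carrier[OF N c(1)] \<open>\<iota> u = \<iota> (f x)\<close> \<open>u \<in> ?U\<close>
        by (intro inj_onD[of \<iota> "mcarrier N"]) auto
      with \<open>u \<in> ?U\<close> show ?case by simp
    qed
  qed
  let ?n = "mrep A N f p"
  have n0: "?n ?x0 = snd ?c ?y" by (simp add: mrep_def p')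
  have "filterlim ?n (nhds (?n ?x0)) (nhds ?x0)"
    unfolding filterlim_iff
  proof (intro allI impI)
    fix Pr assume "eventually Pr (nhds (?n ?x0))"
    then obtain W where W: "open W" "?n ?x0 \<in> W" "\<And>w. w \<in> W \<Longrightarrow> Pr w" unfolding eventually_nhds by blast
    from cont[OF W(1)] W(2) have "\<forall>\<^sub>F x in mnhds A p. f x \<in> fst ?c \<inter> snd ?c -` W" by (simp only: n0)
    then show "\<forall>\<^sub>F x in nhds ?x0. Pr (?n x)"
      unfolding mnhds_def eventually_filtermap by eventually_elim (use W(3) in \<open>auto simp: mrep_def\<close>)
  qed
  moreover have "mdiff N P \<iota> ?y"
    using emb y by (intro smooth_map_mdiff[OF N P]) (simp_all add: smooth_embedding_def immersion_def)
  from mrep_has_derivative[OF this]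
  have "(mrep N P \<iota> ?y has_derivative tan_at N P \<iota> ?y) (at (?n ?x0))" by (simp only: n0)
  moreover have "inj (tan_at N P \<iota> ?y)"
    using emb y by (simp add: smooth_embedding_def immersion_def)
  moreover note mrep_has_derivative[OF F]
  moreover have dom: "\<forall>\<^sub>F x in mnhds A p. f x \<in> fst ?c" using cont[of UNIV] by simp
  then have "\<forall>\<^sub>F x in nhds ?x0. mrep A P (\<lambda>x. \<iota> (f x)) p x = mrep N P \<iota> ?y (?n x)"
    unfolding mnhds_def eventually_filtermap
    by eventually_elim (simp add: mrep_def chart_inv_chart[OF N c(1)])
  ultimately have "\<exists>D. (?n has_derivative D) (at ?x0)"
    by (rule has_derivative_through_immersion)
  then show ?thesis using p y dom by (simp add: mdiff_def differentiable_def)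
qed

section \<open>Regular orbit reduction\<close>

text \<open>A tangent map preserving a nondegenerate form is injective, hence onto, since both
  tangent spaces have the same model space. So every test vector at \<open>\<epsilon> z\<close> is
  an image, and the defining equations of the two vector fields can be compared.\<close>

lemma (in cotangent_bundle) symplectic_map_ham_vf:
  assumes \<epsilon>: "symplectic_map (cotangent Q) (canonical_form Q) \<epsilon>"
    and z: "z \<in> mcarrier (cotangent Q)"
    and H: "mdiff (cotangent Q) euclid H (\<epsilon> z)"
  shows "tan_map (cotangent Q) (cotangent Q) \<epsilon> (ham_vf (cotangent Q) (canonical_form Q) (H \<circ> \<epsilon>) z) =
    ham_vf (cotangent Q) (canonical_form Q) H (\<epsilon> z)"
proof -
  let ?M = "cotangent Q" and ?\<omega> = "canonical_form Q"
  let ?T = "tan_at ?M ?M \<epsilon> z"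
  let ?Y = "snd (ham_vf ?M ?\<omega> (H \<circ> \<epsilon>) z)"
  have d: "mdiff ?M ?M \<epsilon> z"
    using \<epsilon> z by (intro smooth_map_mdiff diff_atlas_cotangent) (simp_all add: symplectic_map_def)
  have pres: "?\<omega> (\<epsilon> z) (?T v) (?T w) = ?\<omega> z v w" for v w
    using \<epsilon> z unfolding symplectic_map_def pullback2_def by blast
  have lin: "linear ?T" by (rule linear_tan_at[OF d])
  have "inj ?T"
  proof (rule injI)
    fix u v assume "?T u = ?T v"
    then have "?\<omega> z u w = ?\<omega> z v w" for w by (metis pres)
    then show "u = v" by (rule canonical_form_nondegenerate[OF z])
  qed
  then have surj: "surj ?T" using linear_surj_iff_inj_finite_dim[OF lin] by simp
  have HE: "mdiff ?M euclid (H \<circ> \<epsilon>) z"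
    using mdiff_compose(1)[OF diff_atlas_cotangent diff_atlas_cotangent d H] by (simp add: o_def)
  have "?\<omega> (\<epsilon> z) (?T ?Y) v = ?\<omega> (\<epsilon> z) (snd (ham_vf ?M ?\<omega> H (\<epsilon> z))) v" for v
  proof -
    obtain w where w: "v = ?T w" using surj by (metis surjD)
    have "?\<omega> (\<epsilon> z) (?T ?Y) v = tan_at ?M euclid (H \<circ> \<epsilon>) z w"
      by (simp only: w pres ham_vf_canonical[OF HE])
    also have "\<dots> = tan_at ?M euclid H (\<epsilon> z) v"
      using mdiff_compose(2)[OF diff_atlas_cotangent diff_atlas_cotangent d H, of w] by (simp add: o_def w)
    finally show ?thesis by (simp only: ham_vf_canonical[OF H])
  qed
  then have "?T ?Y = snd (ham_vf ?M ?\<omega> H (\<epsilon> z))"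
    by (rule canonical_form_nondegenerate[OF mdiff_carrier(2)[OF d]])
  then show ?thesis by (simp add: tan_map_def ham_vf_def)
qed

locale orbit_reduction = momentum Q G L act J
  for Q :: "('q, 'e::finite_dim_inner) mfd" and G :: "'g monoid" and L :: "('g, 'k::finite_dim_inner) mfd"
    and act and J :: "'q \<times> 'e \<Rightarrow> 'k" +
  fixes H :: "'q \<times> 'e \<Rightarrow> real" and \<mu> :: 'k
    and Orb :: "('k, 'o::finite_dim_inner) mfd" and \<omega>p :: "'k \<Rightarrow> 'o \<Rightarrow> 'o \<Rightarrow> real"
    and N :: "('q \<times> 'e, 'n::finite_dim_inner) mfd"
    and R :: "(('q \<times> 'e) set, 'r::finite_dim_inner) mfd"
    and \<omega>R :: "('q \<times> 'e) set \<Rightarrow> 'r \<Rightarrow> 'r \<Rightarrow> real" and h :: "('q \<times> 'e) set \<Rightarrow> real"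
  assumes reducible: "regular_orbit_reducible G L Q act J H \<mu> Orb \<omega>p N R \<omega>R h"
begin

abbreviation "\<pi> \<equiv> orbit G lift"
abbreviation "X_H \<equiv> ham_vf M (canonical_form Q) H"

lemma Orb: "diff_atlas Orb" and carrier_Orb: "mcarrier Orb = orbit G (coadjoint G L) \<mu>"
  and immersion_Orb: "immersion Orb euclid (\<lambda>\<nu>. \<nu>)"
  and N: "diff_atlas N" and carrier_N: "mcarrier N = {z \<in> mcarrier M. J z \<in> mcarrier Orb}"
  and embedding_N: "smooth_embedding N (prod_mfd M Orb) (\<lambda>z. (z, J z))"
  and R: "diff_atlas R" and submersion_R: "submersion N R \<pi>"
  and symplectic_R: "symplectic_form R \<omega>R"
  and two_form_Orb: "two_form Orb \<omega>p"
  and smooth_h: "smooth_map R euclid h" and h_\<pi>: "z \<in> mcarrier N \<Longrightarrow> h (\<pi> z) = H z"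
  and smooth_H: "smooth_map M euclid H"
  and H_invariant: "g \<in> carrier G \<Longrightarrow> z \<in> mcarrier M \<Longrightarrow> H (lift g z) = H z"
  and regular_\<mu>: "regular_value M euclid J \<mu>"
  using reducible manifold_diff_atlas
  by (auto simp: regular_orbit_reducible_def coadjoint_orbit_def orbit_level_def orbit_space_def
      orbit_plus_form_def reduced_form_def)

lemma reduced_form_eq:
  "z \<in> mcarrier N \<Longrightarrow> canonical_form Q z (tan_at N M (\<lambda>z. z) z v) (tan_at N M (\<lambda>z. z) z w) =
    \<omega>R (\<pi> z) (tan_at N R \<pi> z v) (tan_at N R \<pi> z w) +
    \<omega>p (J z) (tan_at N Orb J z v) (tan_at N Orb J z w)"
  using reducible unfolding regular_orbit_reducible_def reduced_form_def pullback2_def by blast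

lemma mdiff_H: "z \<in> mcarrier M \<Longrightarrow> mdiff M euclid H z"
  by (rule smooth_map_mdiff[OF M diff_atlas_euclid smooth_H])

lemma N_subset: "z \<in> mcarrier N \<Longrightarrow> z \<in> mcarrier M" and J_N: "z \<in> mcarrier N \<Longrightarrow> J z \<in> mcarrier Orb"
  by (simp_all add: carrier_N)

section \<open>The preimage of the orbit as a submanifold\<close>

context
  fixes z assumes z: "z \<in> mcarrier N"
begin

lemma mdiff_embedding: "mdiff N (prod_mfd M Orb) (\<lambda>z. (z, J z)) z"
  using embedding_N z
  by (intro smooth_map_mdiff[OF N diff_atlas_prod[OF M Orb]]) (simp_all add: smooth_embedding_def immersion_def)

lemma mdiff_incl: "mdiff N M (\<lambda>z. z) z" and mdiff_J_Orb: "mdiff N Orb J z"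
  using mdiff_compose(1)[OF N diff_atlas_prod[OF M Orb] mdiff_embedding, of M fst]
    mdiff_compose(1)[OF N diff_atlas_prod[OF M Orb] mdiff_embedding, of Orb snd]
    mdiff_fst_snd[OF M Orb N_subset[OF z] J_N[OF z]] by simp_all

lemma tan_J_Orb:
  "tan_at Orb euclid (\<lambda>\<nu>. \<nu>) (J z) (tan_at N Orb J z v) = tan_at M euclid J z (tan_at N M (\<lambda>z. z) z v)"
proof -
  have "mdiff Orb euclid (\<lambda>\<nu>. \<nu>) (J z)"
    using immersion_Orb J_N[OF z] by (intro smooth_map_mdiff[OF Orb diff_atlas_euclid]) (simp_all add: immersion_def)
  from mdiff_compose(2)[OF N Orb mdiff_J_Orb this, of v]
    mdiff_compose(2)[OF N M mdiff_incl mdiff_J[OF N_subset[OF z]], of v]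
  show ?thesis by simp
qed

lemma inj_tan_Orb: "inj (tan_at Orb euclid (\<lambda>\<nu>. \<nu>) (J z))"
  using immersion_Orb J_N[OF z] by (simp add: immersion_def)

text \<open>Injectivity is given for the graph map into the product with \<open>Orb\<close>. The
  \<open>Orb\<close> component of its tangent map is determined by the first component, because the
  inclusion of \<open>Orb\<close> is an immersion.\<close>

lemma inj_tan_incl: "inj (tan_at N M (\<lambda>z. z) z)"
proof (rule injI)
  fix u v assume uv: "tan_at N M (\<lambda>z. z) z u = tan_at N M (\<lambda>z. z) z v"
  then have "tan_at N Orb J z u = tan_at N Orb J z v"
    by (intro injD[OF inj_tan_Orb]) (simp only: tan_J_Orb)
  with uv have "tan_at N (prod_mfd M Orb) (\<lambda>z. (z, J z)) z u = tan_at N (prod_mfd M Orb) (\<lambda>z. (z, J z)) z v"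
    by (simp add: mdiff_Pair(2)[OF M Orb mdiff_incl mdiff_J_Orb])
  moreover have "inj (tan_at N (prod_mfd M Orb) (\<lambda>z. (z, J z)) z)"
    using embedding_N z by (simp add: smooth_embedding_def immersion_def)
  ultimately show "u = v" by (simp add: inj_eq)
qed

end

text \<open>Injectivity turns \<open>inv_into\<close> into a genuine inverse, so
  \<open>tan_sub\<close> can be computed on any vector exhibited as tangent to
  \<open>N\<close>.\<close>

lemma tan_sub_incl:
  assumes z: "z \<in> mcarrier N"
  shows "tan_sub N M R' f (z, tan_at N M (\<lambda>z. z) z u) = (f z, tan_at N R' f z u)"
proof -
  have "inj_on (tan_map N M (\<lambda>z. z)) (tangent_bundle N)"
    using inj_tan_incl by (auto simp: inj_on_def tan_map_def tangent_bundle_def)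
  then have "inv_into (tangent_bundle N) (tan_map N M (\<lambda>z. z)) (z, tan_at N M (\<lambda>z. z) z u) = (z, u)"
    by (rule inv_into_f_eq) (use z in \<open>simp_all add: tan_map_def tangent_bundle_def\<close>)
  then show ?thesis by (simp add: tan_sub_def tan_map_def)
qed

text \<open>The graph map into the product has a constant \<open>Orb\<close> component near
  \<open>p\<close>, so it is differentiable there whatever the topology of
  \<open>Orb\<close>.\<close>

lemma mdiff_into_level:
  fixes A :: "('a, 'b::finite_dim_inner) mfd"
  assumes A: "diff_atlas A" and f: "mdiff A M f p" and fp: "f p \<in> mcarrier N"
    and const: "\<forall>\<^sub>F x in mnhds A p. J (f x) = J (f p)"
  shows "mdiff A N f p" "tan_at A M f p v = tan_at N M (\<lambda>z. z) (f p) (tan_at A N f p v)"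
proof -
  have p: "p \<in> mcarrier A" by (rule mdiff_carrier(1)[OF f])
  have "\<forall>\<^sub>F x in mnhds A p. f x \<in> mcarrier M"
    using mdiff_filterlim[OF M A f] mnhds_carrier[OF M mdiff_carrier(2)[OF f]]
    unfolding filterlim_iff by blast
  with const have ev: "\<forall>\<^sub>F x in mnhds A p. f x \<in> mcarrier N"
    by eventually_elim (use J_N[OF fp] in \<open>simp add: carrier_N\<close>)
  have "\<forall>\<^sub>F x in mnhds A p. J (f p) = J (f x)" using const by eventually_elim simp
  then have "mdiff A Orb (\<lambda>x. J (f x)) p"
    by (rule mdiff_cong(1)[OF A Orb mdiff_const(1)[OF A Orb p J_N[OF fp]]])
  from mdiff_Pair(1)[OF M Orb f this]
  show *: "mdiff A N f p"
    by (rule mdiff_into_embedded[OF A N diff_atlas_prod[OF M Orb] embedding_N p ev])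
  show "tan_at A M f p v = tan_at N M (\<lambda>z. z) (f p) (tan_at A N f p v)"
    by (rule mdiff_compose(2)[OF A N * mdiff_incl[OF fp]])
qed

lemma ker_tan_J_tangent:
  assumes z: "z \<in> mcarrier N" and surj: "surj (tan_at M euclid J z)" and v: "tan_at M euclid J z v = 0"
  obtains u where "v = tan_at N M (\<lambda>z. z) z u"
proof -
  have zM: "z \<in> mcarrier M" by (rule N_subset[OF z])
  let ?c = "chart_at M z"
  note c = chart_at_atlas[OF M zM] chart_at_domain[OF M zM]
  have "smooth_map M euclid J" using momentum_map by (simp add: momentum_map_def)
  then obtain S where S: "open S" "snd ?c z \<in> S" "smooth_on S (mrep M euclid J z)"
    by (rule smooth_map_mrep[OF M diff_atlas_euclid _ zM]) blast
  obtain \<kappa> :: "real \<Rightarrow> 'e \<times> 'e" where \<kappa>: "\<kappa> 0 = snd ?c z" "(\<kappa> has_derivative (\<lambda>t. t *\<^sub>R v)) (at 0)"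
    "\<forall>\<^sub>F t in nhds 0. mrep M euclid J z (\<kappa> t) = mrep M euclid J z (snd ?c z)"
  proof (rule curve_in_level_set[OF S(1,2)])
    show "(mrep M euclid J z has_derivative frechet_derivative (mrep M euclid J z) (at x)) (at x)" if "x \<in> S" for x
      using smooth_on_differentiable[OF S(3) that] frechet_derivative_works by blast
    show "continuous_on S (\<lambda>x. frechet_derivative (mrep M euclid J z) (at x) w)" for w
      by (rule smooth_on_continuous_derivative[OF S(3)])
  qed (use surj v in \<open>simp_all add: tan_at_mrep\<close>)
  \<comment> \<open>The curve is built in coordinates and returned to the manifold; its velocity is
    \<open>v\<close> because the inverse of the preferred chart has the identity as its tangent map
    at that point.\<close>
  let ?f = "\<lambda>t. chart_inv ?c (\<kappa> t)"
  have f0: "?f 0 = z" by (simp add: \<kappa>(1) chart_inv_chart[OF M c])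
  have mc: "mdiff euclid M (chart_inv ?c) (\<kappa> 0)"
    unfolding \<kappa>(1) by (rule mdiff_chart_inv[OF M c(1)]) (use c(2) in auto)
  have f: "mdiff euclid M ?f 0" "tan_at euclid M ?f 0 1 = v"
    using mdiff_compose[OF diff_atlas_euclid diff_atlas_euclid mdiff_euclidI[OF \<kappa>(2)] mc]
    by (simp_all add: tan_at_euclid[OF \<kappa>(2)] \<kappa>(1) tan_chart_inv_at[OF M zM])
  have "\<forall>\<^sub>F t in mnhds euclid 0. J (?f t) = J (?f 0)"
    using \<kappa>(3) by (simp add: mrep_def \<kappa>(1) o_def)
  from mdiff_into_level(2)[OF diff_atlas_euclid f(1) _ this, of 1] z
  show ?thesis by (intro that) (simp add: f0 f(2))
qed

lemma symplectic_form_unique: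
  assumes "p \<in> mcarrier R" "\<And>w. \<omega>R p u w = \<omega>R p v w"
  shows "u = v"
proof -
  have "bilinear (\<omega>R p)" and nd: "\<And>v. \<forall>w. \<omega>R p v w = 0 \<Longrightarrow> v = 0"
    using symplectic_R assms(1) by (auto simp: symplectic_form_def two_form_def)
  then have "\<omega>R p (u - v) w = 0" for w by (simp add: bilinear_lsub assms(2))
  then show ?thesis using nd[of "u - v"] by simp
qed

text \<open>As \<open>X_H\<close> is tangent to \<open>N\<close> and annihilated by the derivative
  of \<open>J\<close>, the orbit term of the reduced form equation drops out. What remains is the
  Hamiltonian equation for \<open>h\<close>, tested on images under the tangent map of
  \<open>\<pi>\<close>, which are all vectors.\<close>

theorem reduced_ham_vf:
  assumes z: "z \<in> mcarrier N" and surj: "surj (tan_at M euclid J z)"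
  shows "tan_sub N M R \<pi> (X_H z) = ham_vf R \<omega>R h (\<pi> z)"
proof -
  have zM: "z \<in> mcarrier M" by (rule N_subset[OF z])
  let ?X = "snd (X_H z)"
  have JX: "tan_at M euclid J z ?X = 0" by (rule noether[OF mdiff_H H_invariant zM])
  obtain u where u: "?X = tan_at N M (\<lambda>z. z) z u" by (rule ker_tan_J_tangent[OF z surj JX])
  have "tan_at Orb euclid (\<lambda>\<nu>. \<nu>) (J z) (tan_at N Orb J z u) = 0"
    using JX by (simp add: tan_J_Orb[OF z] u)
  moreover have "tan_at Orb euclid (\<lambda>\<nu>. \<nu>) (J z) 0 = 0"
    using immersion_Orb J_N[OF z]
    by (intro linear_0 linear_tan_at smooth_map_mdiff[OF Orb diff_atlas_euclid]) (simp_all add: immersion_def)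
  \<comment> \<open>Vanishing in the dual of the Lie algebra is transferred to the tangent space of
    \<open>Orb\<close>, where \<open>\<omega>p\<close> takes its arguments.\<close>
  ultimately have Ju: "tan_at N Orb J z u = 0" using inj_tan_Orb[OF z] by (metis injD)
  have d\<pi>: "mdiff N R \<pi> z" and surj\<pi>: "surj (tan_at N R \<pi> z)"
    using submersion_R z by (auto simp: submersion_def intro: smooth_map_mdiff[OF N R])
  have \<pi>z: "\<pi> z \<in> mcarrier R" by (rule mdiff_carrier(2)[OF d\<pi>])
  have bil: "bilinear (\<omega>p (J z))" using two_form_Orb J_N[OF z] by (simp add: two_form_def)
  have red: "\<omega>R (\<pi> z) (tan_at N R \<pi> z u) w = tan_at R euclid h (\<pi> z) w" for w
  proof -
    obtain w' where w: "w = tan_at N R \<pi> z w'" using surj\<pi> by (metis surjD)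
    have dh: "mdiff R euclid h (\<pi> z)" by (rule smooth_map_mdiff[OF R diff_atlas_euclid smooth_h \<pi>z])
    \<comment> \<open>\<open>h \<circ> \<pi>\<close> and \<open>H\<close> are known to agree on
      \<open>N\<close>, so their derivatives are compared along \<open>N\<close>.\<close>
    have "\<forall>\<^sub>F x in mnhds N z. H x = h (\<pi> x)" by (rule mnhds_mono[OF N z]) (simp add: h_\<pi>)
    from mdiff_cong(2)[OF N diff_atlas_euclid mdiff_compose(1)[OF N M mdiff_incl[OF z] mdiff_H[OF zM]] this]
    have "tan_at R euclid h (\<pi> z) w = tan_at M euclid H z (tan_at N M (\<lambda>z. z) z w')"
      using mdiff_compose(2)[OF N R d\<pi> dh, of w']
        mdiff_compose(2)[OF N M mdiff_incl[OF z] mdiff_H[OF zM], of w'] by (simp add: w)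
    also have "\<dots> = canonical_form Q z ?X (tan_at N M (\<lambda>z. z) z w')"
      by (simp only: ham_vf_canonical[OF mdiff_H[OF zM]])
    also have "\<dots> = \<omega>R (\<pi> z) (tan_at N R \<pi> z u) w"
      unfolding u by (simp add: reduced_form_eq[OF z] Ju bilinear_lzero[OF bil] w)
    finally show ?thesis by simp
  qed
  have "(THE X. \<forall>w. \<omega>R (\<pi> z) X w = tan_at R euclid h (\<pi> z) w) = tan_at N R \<pi> z u"
  proof (rule the_equality)
    show "\<forall>w. \<omega>R (\<pi> z) (tan_at N R \<pi> z u) w = tan_at R euclid h (\<pi> z) w" using red by blast
    show "Y = tan_at N R \<pi> z u" if "\<forall>w. \<omega>R (\<pi> z) Y w = tan_at R euclid h (\<pi> z) w" for Y
      by (rule symplectic_form_unique[OF \<pi>z]) (simp only: red that)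
  qed
  moreover have "X_H z = (z, tan_at N M (\<lambda>z. z) z u)" unfolding u[symmetric] by (simp add: ham_vf_def)
  ultimately show ?thesis by (simp add: tan_sub_incl[OF z]) (simp add: ham_vf_def)
qed

end

theorem theorem4p3:
  fixes Q :: "('q, 'e::finite_dim_inner) mfd"
    and G :: "'g monoid" and L :: "('g, 'k::finite_dim_inner) mfd"
    and act :: "'g \<Rightarrow> 'q \<Rightarrow> 'q"
    and J :: "'q \<times> 'e \<Rightarrow> 'k" and H :: "'q \<times> 'e \<Rightarrow> real" and \<mu> :: 'k
    and Orb :: "('k, 'o::finite_dim_inner) mfd" and \<omega>p :: "'k \<Rightarrow> 'o \<Rightarrow> 'o \<Rightarrow> real"
    and N :: "('q \<times> 'e, 'n::finite_dim_inner) mfd"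
    and R :: "(('q \<times> 'e) set, 'r::finite_dim_inner) mfd"
    and \<omega>R :: "('q \<times> 'e) set \<Rightarrow> 'r \<Rightarrow> 'r \<Rightarrow> real" and h :: "('q \<times> 'e) set \<Rightarrow> real"
    and \<gamma> :: "'q \<Rightarrow> 'q \<times> 'e" and \<epsilon> :: "'q \<times> 'e \<Rightarrow> 'q \<times> 'e"
  assumes "manifold Q"
    and "lie_group G L"
    and "lie_action G L Q act"
    and "free_action G Q act"
    and "proper_action L Q act"
    and "momentum_map G L Q act J"
    and "regular_orbit_reducible G L Q act J H \<mu> Orb \<omega>p N R \<omega>R h"
    and "one_form Q \<gamma>"
    and "\<forall>q\<in>mcarrier Q. J (\<gamma> q) = \<mu>"
    and "\<forall>g\<in>carrier G. \<forall>q\<in>mcarrier Q. \<gamma> (act g q) = cot_lift G Q act g (\<gamma> q)"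
    and "symplectic_map (cotangent Q) (canonical_form Q) \<epsilon>"
    and "\<forall>g\<in>carrier G. \<forall>z\<in>mcarrier (cotangent Q).
           \<epsilon> (cot_lift G Q act g z) = cot_lift G Q act g (\<epsilon> z)"
    and "\<epsilon> ` mcarrier N \<subseteq> mcarrier N"
  shows
    "let M = cotangent Q; X = ham_vf M (canonical_form Q);
         \<pi> = orbit G (cot_lift G Q act); T\<pi> = tan_sub N M R \<pi>;
         lam = \<gamma> \<circ> fst; gammabar = \<pi> \<circ> \<gamma>; epsbar = \<pi> \<circ> \<epsilon>;
         XHeps = tan_map M Q fst \<circ> X H \<circ> \<epsilon>
     in (\<forall>z\<in>mcarrier N. T\<pi> (tan_map M M \<epsilon> (X (H \<circ> \<epsilon>) z)) = T\<pi> (tan_map M M lam (X H (\<epsilon> z)))) \<longleftrightarrow>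
        (\<forall>z\<in>mcarrier N. tan_map Q R gammabar (XHeps z) = ham_vf R \<omega>R h (epsbar z))"
proof -
  interpret orbit_reduction Q G L act J H \<mu> Orb \<omega>p N R \<omega>R h
    by unfold_locales (rule assms)+
  have \<gamma>: "mdiff Q M \<gamma> q" "fst (\<gamma> q) = q" if "q \<in> mcarrier Q" for q
    using assms(8) that by (auto simp: one_form_def intro: smooth_map_mdiff[OF Q M])
  have "tan_sub N M R \<pi> (tan_map M M \<epsilon> (ham_vf M (canonical_form Q) (H \<circ> \<epsilon>) z)) = ham_vf R \<omega>R h (\<pi> (\<epsilon> z)) \<and>
    tan_sub N M R \<pi> (tan_map M M (\<gamma> \<circ> fst) (X_H (\<epsilon> z))) = tan_map Q R (\<pi> \<circ> \<gamma>) (tan_map M Q fst (X_H (\<epsilon> z)))"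
    if z: "z \<in> mcarrier N" for z
  proof
    let ?y = "\<epsilon> z"
    have y: "?y \<in> mcarrier N" and yM: "?y \<in> mcarrier M" using assms(13) z N_subset[of ?y] by auto
    let ?q = "fst ?y"
    have q: "?q \<in> mcarrier Q" using yM by (simp add: mcarrier_cotangent_iff)
    have \<gamma>M: "\<gamma> ?q \<in> mcarrier M" by (rule mdiff_carrier(2)[OF \<gamma>(1)[OF q]])
    have J\<gamma>: "J (\<gamma> x) = \<mu>" if "x \<in> mcarrier Q" for x using assms(9) that by blast
    have "J ?y \<in> orbit G (coadjoint G L) \<mu>" using J_N[OF y] by (simp add: carrier_Orb)
    then have surj: "surj (tan_at M euclid J ?y)"
      by (rule regular_along_orbit[OF regular_\<mu> \<gamma>M J\<gamma>[OF q] yM])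
    show "tan_sub N M R \<pi> (tan_map M M \<epsilon> (ham_vf M (canonical_form Q) (H \<circ> \<epsilon>) z)) = ham_vf R \<omega>R h (\<pi> ?y)"
      by (simp add: symplectic_map_ham_vf[OF assms(11) N_subset[OF z] mdiff_H[OF yM]]
          reduced_ham_vf[OF y surj])
    obtain X where X: "X_H ?y = (?y, X)" by (simp add: ham_vf_def)
    let ?w = "tan_at M Q fst ?y X"
    \<comment> \<open>That \<open>\<mu>\<close> lies in its own orbit is read off from equivariance
      at the identity, evaluated at a point over \<open>\<mu>\<close>.\<close>
    have "J (\<gamma> ?q) = coadjoint G L \<one>\<^bsub>G\<^esub> \<mu>"
      using J_equivariant[OF one_closed \<gamma>M] \<gamma>M by (simp add: J\<gamma>[OF q])
    then have \<gamma>N: "\<gamma> ?q \<in> mcarrier N"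
      using \<gamma>M unfolding carrier_N carrier_Orb orbit_def by blast
    have "\<forall>\<^sub>F x in mnhds Q ?q. J (\<gamma> x) = J (\<gamma> ?q)"
      by (rule mnhds_mono[OF Q q]) (simp add: J\<gamma> q)
    note \<gamma>_N = mdiff_into_level[OF Q \<gamma>(1)[OF q] \<gamma>N this]
    have d\<pi>: "mdiff N R \<pi> (\<gamma> ?q)"
      using submersion_R \<gamma>N by (intro smooth_map_mdiff[OF N R]) (simp_all add: submersion_def)
    have "tan_map M M (\<gamma> \<circ> fst) (X_H ?y) = (\<gamma> ?q, tan_at Q M \<gamma> ?q ?w)"
      unfolding X using mdiff_compose(2)[OF M Q mdiff_cotangent_fst(1)[OF yM] \<gamma>(1)[OF q], of X]
      by (simp add: tan_map_def o_def)
    \<comment> \<open>Since \<open>\<gamma>\<close> is differentiable into \<open>N\<close>, the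
      vector is recognised as tangent to \<open>N\<close> and \<open>tan_sub\<close> can be
      evaluated on it.\<close>
    then have "tan_sub N M R \<pi> (tan_map M M (\<gamma> \<circ> fst) (X_H ?y)) = (\<pi> (\<gamma> ?q), tan_at N R \<pi> (\<gamma> ?q) (tan_at Q N \<gamma> ?q ?w))"
      by (simp only: \<gamma>_N(2) tan_sub_incl[OF \<gamma>N])
    also have "\<dots> = tan_map Q R (\<pi> \<circ> \<gamma>) (tan_map M Q fst (X_H ?y))"
      unfolding X using mdiff_compose(2)[OF Q N \<gamma>_N(1) d\<pi>, of ?w] by (simp add: tan_map_def o_def)
    finally show "tan_sub N M R \<pi> (tan_map M M (\<gamma> \<circ> fst) (X_H ?y)) = tan_map Q R (\<pi> \<circ> \<gamma>) (tan_map M Q fst (X_H ?y))" .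
  qed
  note pointwise = conjunct1[OF this, unfolded o_def] conjunct2[OF this, unfolded o_def]
  show ?thesis
    unfolding Let_def o_def
    by (rule ball_cong[OF refl], simp only: pointwise, rule eq_commute)
qed

end
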